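(* Let $\mathbf m=(m_1,m_2,m_1',m_2',m_1'',m_2'')\in\mathbb C^6$. Fix a positive root $\Lambda$ of $E_6$, an integer $k\in\{0,\dots,5\}$ and a sign $\epsilon\in\{-1,1\}$, and let $\mathcal F=\epsilon\,\Xi_{\Lambda,k}$ be the associated $4$-face. Set $X^{\mathcal F}=\epsilon\mathcal A^{\mathcal F}$ and $Y^{\mathcal F}=\mathcal B^{\mathcal F}$, where $\mathcal A^{\mathcal F},\mathcal B^{\mathcal F}$ are the infinite tridiagonal matrices, indexed by $\mathbb Z$, defined in the context. Then the assignment $X\mapsto X^{\mathcal F}$, $Y\mapsto Y^{\mathcal F}$ provides a representation of the algebra $Z_2(\mathfrak{su}_3)_{\mathbf m}$.
   Context: Roots. $\alpha_1,\dots,\alpha_6$ are simple roots of type $E_6$ ($(\alpha_i,\alpha_i)=2$; Dynkin diagram: chain $1-2-3-4-5$ with node $6$ attached to node $3$). $W(E_6)$ is the Weyl group, generated by $s_i(x)=x-(x,\alpha_i)\alpha_i$. Parameters are identified with roots by $m_1=\alpha_3+\alpha_4+\alpha_5$, $m_2=\alpha_1+\alpha_2+\alpha_3+\alpha_4+\alpha_6$, $m_1'=\alpha_1+\alpha_2+\alpha_3$, $m_2'=\alpha_2+\alpha_3+\alpha_4+\alpha_5+\alpha_6$, $m_1''=\alpha_3+\alpha_6$, $m_2''=\alpha_2+\alpha_3+\alpha_4$. These six roots form a basis of the ambient space, so, given $\mathbf m\in\mathbb C^6$, every root acquires a complex value, and $W(E_6)$ acts linearly on the parameters, hence on polynomials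 in them. The algebra. For a polynomial $f$ in the six parameters let $\langle f\rangle=\frac1{51840}\sum_{s\in W(E_6)}s(f)$ and $p_2=\frac32\langle m_1^2\rangle$, $p_5=\frac83\langle (m_1')^2m_2'm_1''m_2''\rangle$, $p_6=10\langle m_1m_2m_1'm_2'm_1''m_2''\rangle$, $p_8=\frac53\langle m_1^2m_2(m_1')^2m_2'm_1''m_2''\rangle$, $p_9=\frac{40}{27}\langle (m_1m_2m_1')^2m_2'm_1''m_2''\rangle$, $p_{12}=\frac{20}3\langle(m_1m_2m_1'm_2'm_1''m_2'')^2\rangle$. Put $a_2=p_2-3$, $a_5=-p_5$, $a_6=p_6+\frac{p_2^3}9+\frac{2p_2^2}3-\frac{3p_2}2+1$, $a_8=-p_8+\frac{p_2^4}{54}+\frac{p_2p_6}{12}+\frac{p_2^3}{18}+\frac{p_6}2+\frac{p_2^2}6-\frac{p_2}4+\frac18$, $a_9=-p_9-p_5\bigl(\frac{p_2^2}{27}+\frac{p_2}3-\frac14\bigr)$, $$a_{12}=-p_{12}+\tfrac{35p_6^2}{12}+\tfrac{p_2^6}{36}+\tfrac{17p_2^3p_6}{72}-\tfrac{p_2^2p_8}{18}-\tfrac{7p_2p_5^2}{18}+\tfrac{p_2^5}{162}-\tfrac{p_2p_8}3+\tfrac{p_2^2p_6}{36}-\tfrac{p_5^2}4-\tfrac{13p_2^4}{108}+\tfrac{13p_8}2-\tfrac{13p_2p_6}{24}-\tfrac{19p_2^3}{54}-3p_6-\tfrac{11p_2^2}{12}+\tfrac{11p_2}8-\tfrac{11}{16}.$$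 $Z_2(\mathfrak{su}_3)_{\mathbf m}$ is the unital associative $\mathbb C$-algebra generated by $X,Y$ with, setting $Z=[X,Y]$ and $\{A,B\}=AB+BA$, the defining relations $$[X,Z]=-6Y^2+a_2X^2+a_5X+a_8,\qquad [Y,Z]=-2X^3-a_2\{X,Y\}-a_5Y+a_6X+a_9,$$ $$x_1X+x_2Y+x_3X^2+x_4\{X,Y\}+x_5Y^2+x_7XYX-X^4+4Y^3+Z^2=a_{12},$$ where $x_1=6a_5+2a_9$, $x_2=-2a_6-2a_8$, $x_3=6a_2+a_6$, $x_4=-a_5$, $x_5=8a_2-24$, $x_7=-2a_2+12$. The $4$-faces. Let $\Theta=\alpha_1+2\alpha_2+3\alpha_3+2\alpha_4+\alpha_5+2\alpha_6$ be the highest root and $$\Xi_{\Theta,0}=\{\alpha_1+\alpha_2+\alpha_3+\alpha_4+\alpha_5,\ \alpha_1+\alpha_2+\alpha_3+\alpha_4,\ \alpha_1+\alpha_2+\alpha_3,\ \alpha_1+\alpha_2,\ \alpha_1\}.$$ For a positive root $\Lambda$, let $w\in W(E_6)$ be the (unique) element of minimal length with $w(\Theta)=\Lambda$, and let $\Xi_{\Lambda,0}=w(\Xi_{\Theta,0})=\{\xi_1,\dots,\xi_5\}$ (the images of the five listed roots, in this order). For $k\in\{1,\dots,5\}$ let $\Xi_{\Lambda,k}=\{-\xi_k\}\cup\{\xi_j-\xi_k: j\ne k\}$, and let $-\Xi_{\Lambda,k}=\{-\xi:\xi\in\Xi_{\Lambda,k}\}$. (The sets $\pm\Xi_{\Lambda,k}$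 are 4-faces of the root polytope of $E_6$.) The matrices. For $\mathcal F=\pm\Xi_{\Lambda,k}=\{\xi_1,\dots,\xi_5\}$ (now denoting the elements of $\mathcal F$), let $\xi_6=0$, $\lambda_\pm=\pm\frac12\Lambda+\frac16(\xi_1+\dots+\xi_5)$ and $E_{j,k}=\sum_{i=1}^6(\xi_i-j+\frac12)^k$, all roots being replaced by their complex values. $\mathcal A^{\mathcal F}$ and $\mathcal B^{\mathcal F}$ have rows and columns indexed by $j\in\mathbb Z$, with only non-zero entries $$\mathcal A_{j+1,j}=1,\quad \mathcal A_{j,j+1}=j\prod_{i=1}^5(j-\xi_i),\quad \mathcal B_{j+1,j}=j-\lambda_+,\quad \mathcal B_{j,j+1}=j\,(j-\lambda_-)\prod_{i=1}^5(j-\xi_i),$$ $$\mathcal A_{jj}=-\tfrac1{108}\bigl(\tfrac72E_{j,1}^3-18E_{j,1}E_{j,2}+18E_{j,3}\bigr)-\tfrac1{24}E_{j,1}(\Lambda^2+2),$$ $$\mathcal B_{jj}=\tfrac1{288}\bigl(\tfrac52E_{j,1}^4+32E_{j,1}E_{j,3}+6(E_{j,2}^2-3E_{j,1}^2E_{j,2}-4E_{j,4})+6E_{j,2}(\Lambda^2+2)-3E_{j,1}^2(\Lambda^2-2)-\tfrac32\Lambda^4+6\Lambda^2-36\bigr).$$ They act on the vector space with basis $(v_j)_{j\in\mathbb Z}$ (products are well defined by tridiagonality). *)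

theory Defs
  imports
    "HOL-Analysis.Analysis"
    "HOL-Algebra.QuotRing"
    "HOL-Algebra.Module"
    "HOL-Library.Poly_Mapping"
begin

section \<open>The root system\<close>

text \<open>
  The ambient space is \<^typ>\<open>real ^ 6\<close> in coordinates with respect to the simple roots.
  In the index type \<^typ>\<open>6\<close> the numeral 6 is the same element as 0, so that \<open>1, \<dots>, 6\<close> are its
  six elements.
\<close>

abbreviation \<alpha> :: "6 \<Rightarrow> real ^ 6" where
  "\<alpha> i \<equiv> axis i 1"

definition e6_edges :: "(6 \<times> 6) set" where
  "e6_edges = {(1, 2), (2, 3), (3, 4), (4, 5), (3, 6)}"

definition e6_cartan :: "6 \<Rightarrow> 6 \<Rightarrow> real" where
  "e6_cartan i j =
     (if i = j then 2 else if (i, j) \<in> e6_edges \<or> (j, i) \<in> e6_edges then - 1 else 0)"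

definition e6_form :: "real ^ 6 \<Rightarrow> real ^ 6 \<Rightarrow> real" where
  "e6_form x y = (\<Sum>i\<in>UNIV. \<Sum>j\<in>UNIV. x $ i * e6_cartan i j * y $ j)"

definition simple_reflection :: "6 \<Rightarrow> real ^ 6 \<Rightarrow> real ^ 6" where
  "simple_reflection i x = x - e6_form x (\<alpha> i) *\<^sub>R \<alpha> i"

definition weyl_word :: "6 list \<Rightarrow> real ^ 6 \<Rightarrow> real ^ 6" where
  "weyl_word js = foldr (\<lambda>i w. simple_reflection i \<circ> w) js id"

text \<open>
  The reflections are involutions, so the group they generate consists of the products of
  simple reflections.
\<close>

definition weyl_group :: "(real ^ 6 \<Rightarrow> real ^ 6) set" where
  "weyl_group = range weyl_word"

definition weyl_length :: "(real ^ 6 \<Rightarrow> real ^ 6) \<Rightarrow> nat" where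
  "weyl_length w = (LEAST n. \<exists>js. length js = n \<and> weyl_word js = w)"

definition e6_roots :: "(real ^ 6) set" where
  "e6_roots = {w (\<alpha> i) |w i. w \<in> weyl_group}"

definition e6_positive_roots :: "(real ^ 6) set" where
  "e6_positive_roots = {\<Lambda> \<in> e6_roots. \<forall>i. \<Lambda> $ i \<ge> 0}"


section \<open>Parameters\<close>

datatype param = M1 | M2 | M1' | M2' | M1'' | M2''

primrec param_root :: "param \<Rightarrow> real ^ 6" where
  "param_root M1 = \<alpha> 3 + \<alpha> 4 + \<alpha> 5"
| "param_root M2 = \<alpha> 1 + \<alpha> 2 + \<alpha> 3 + \<alpha> 4 + \<alpha> 6"
| "param_root M1' = \<alpha> 1 + \<alpha> 2 + \<alpha> 3"
| "param_root M2' = \<alpha> 2 + \<alpha> 3 + \<alpha> 4 + \<alpha> 5 + \<alpha> 6"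
| "param_root M1'' = \<alpha> 3 + \<alpha> 6"
| "param_root M2'' = \<alpha> 2 + \<alpha> 3 + \<alpha> 4"

text \<open>
  A point \<open>m\<close> of the parameter space is a function \<^typ>\<open>param \<Rightarrow> complex\<close>. Since the six vectors
  \<^const>\<open>param_root\<close> form a basis, there is exactly one linear map taking the prescribed values
  on them.
\<close>

definition root_value :: "(param \<Rightarrow> complex) \<Rightarrow> real ^ 6 \<Rightarrow> complex" where
  "root_value m = (THE v. linear v \<and> (\<forall>p. v (param_root p) = m p))"

text \<open>
  A polynomial in the parameters is given by its polynomial function \<open>f\<close>. The polynomial \<open>s(f)\<close>
  is obtained by replacing each parameter, regarded as a root, by its image under \<open>s\<close>; its value
  at \<open>m\<close> is therefore \<open>f (weyl_act s m)\<close>.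
\<close>

definition weyl_act :: "(real ^ 6 \<Rightarrow> real ^ 6) \<Rightarrow> (param \<Rightarrow> complex) \<Rightarrow> param \<Rightarrow> complex" where
  "weyl_act s m = (\<lambda>p. root_value m (s (param_root p)))"

definition weyl_average :: "((param \<Rightarrow> complex) \<Rightarrow> complex) \<Rightarrow> (param \<Rightarrow> complex) \<Rightarrow> complex" where
  "weyl_average f m = 1 / 51840 * (\<Sum>s\<in>weyl_group. f (weyl_act s m))"

context
  fixes m :: "param \<Rightarrow> complex"
begin

definition p_2 :: complex where
  "p_2 = 3 / 2 * weyl_average (\<lambda>n. n M1 ^ 2) m"

definition p_5 :: complex where
  "p_5 = 8 / 3 * weyl_average (\<lambda>n. n M1' ^ 2 * n M2' * n M1'' * n M2'') m"

definition p_6 :: complex where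
  "p_6 = 10 * weyl_average (\<lambda>n. n M1 * n M2 * n M1' * n M2' * n M1'' * n M2'') m"

definition p_8 :: complex where
  "p_8 = 5 / 3 * weyl_average (\<lambda>n. n M1 ^ 2 * n M2 * n M1' ^ 2 * n M2' * n M1'' * n M2'') m"

definition p_9 :: complex where
  "p_9 = 40 / 27 * weyl_average (\<lambda>n. (n M1 * n M2 * n M1') ^ 2 * n M2' * n M1'' * n M2'') m"

definition p_12 :: complex where
  "p_12 = 20 / 3 * weyl_average (\<lambda>n. (n M1 * n M2 * n M1' * n M2' * n M1'' * n M2'') ^ 2) m"

definition a_2 :: complex where
  "a_2 = p_2 - 3"

definition a_5 :: complex where
  "a_5 = - p_5"

definition a_6 :: complex where
  "a_6 = p_6 + p_2 ^ 3 / 9 + 2 * p_2 ^ 2 / 3 - 3 * p_2 / 2 + 1"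

definition a_8 :: complex where
  "a_8 = - p_8 + p_2 ^ 4 / 54 + p_2 * p_6 / 12 + p_2 ^ 3 / 18 + p_6 / 2 + p_2 ^ 2 / 6
         - p_2 / 4 + 1 / 8"

definition a_9 :: complex where
  "a_9 = - p_9 - p_5 * (p_2 ^ 2 / 27 + p_2 / 3 - 1 / 4)"

definition a_12 :: complex where
  "a_12 = - p_12 + 35 * p_6 ^ 2 / 12 + p_2 ^ 6 / 36 + 17 * p_2 ^ 3 * p_6 / 72
          - p_2 ^ 2 * p_8 / 18 - 7 * p_2 * p_5 ^ 2 / 18 + p_2 ^ 5 / 162 - p_2 * p_8 / 3
          + p_2 ^ 2 * p_6 / 36 - p_5 ^ 2 / 4 - 13 * p_2 ^ 4 / 108 + 13 * p_8 / 2
          - 13 * p_2 * p_6 / 24 - 19 * p_2 ^ 3 / 54 - 3 * p_6 - 11 * p_2 ^ 2 / 12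
          + 11 * p_2 / 8 - 11 / 16"

definition x_1 :: complex where "x_1 = 6 * a_5 + 2 * a_9"
definition x_2 :: complex where "x_2 = - 2 * a_6 - 2 * a_8"
definition x_3 :: complex where "x_3 = 6 * a_2 + a_6"
definition x_4 :: complex where "x_4 = - a_5"
definition x_5 :: complex where "x_5 = 8 * a_2 - 24"
definition x_7 :: complex where "x_7 = - 2 * a_2 + 12"

end


section \<open>Complex algebras\<close>

text \<open>
  Complex algebras are \<^type>\<open>module\<close> records, whose ring part is the ring structure and whose
  \<^const>\<open>smult\<close> is the multiplication by complex scalars. Homomorphisms are unital, since
  \<^const>\<open>ring_hom\<close> is.
\<close>

definition complex_alg_hom ::
    "(complex, 'a) module \<Rightarrow> (complex, 'b) module \<Rightarrow> ('a \<Rightarrow> 'b) set" where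
  "complex_alg_hom R S =
     {h \<in> ring_hom R S. \<forall>c. \<forall>a \<in> carrier R. h (c \<odot>\<^bsub>R\<^esub> a) = c \<odot>\<^bsub>S\<^esub> h a}"

definition quotient_alg :: "(complex, 'a) module \<Rightarrow> 'a set \<Rightarrow> (complex, 'a set) module" where
  "quotient_alg R I = ring.extend (R Quot I)
     (module.fields (\<lambda>c A. \<Union>a\<in>A. I +>\<^bsub>R\<^esub> (c \<odot>\<^bsub>R\<^esub> a)))"

definition cscale :: "complex \<Rightarrow> ('a \<Rightarrow>\<^sub>0 complex) \<Rightarrow> 'a \<Rightarrow>\<^sub>0 complex"  (infixr \<open>*\<^sub>C\<close> 75) where
  "c *\<^sub>C v = Poly_Mapping.map (\<lambda>x. c * x) v"


section \<open>The algebra presented by generators and relations\<close>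

text \<open>
  The free algebra on two letters is the monoid algebra of the free monoid of words, that is, the
  type \<open>nc_word \<Rightarrow>\<^sub>0 complex\<close> with the convolution product of \<^theory>\<open>HOL-Library.Poly_Mapping\<close>. Since
  that product is based on an additive monoid of exponents, the concatenation of words is written
  as a (non-commutative) addition.
\<close>

datatype letter = LX | LY

datatype nc_word = NC_Word "letter list"

instantiation nc_word :: monoid_add
begin

definition zero_nc_word :: nc_word where
  "0 = NC_Word []"

fun plus_nc_word :: "nc_word \<Rightarrow> nc_word \<Rightarrow> nc_word" where
  "NC_Word u + NC_Word v = NC_Word (u @ v)"

instance
proof
  fix a b c :: nc_word
  show "a + b + c = a + (b + c)" by (cases a; cases b; cases c) simp
  show "0 + a = a" "a + 0 = a" by (cases a; simp add: zero_nc_word_def)+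
qed

end

type_synonym free_alg = "nc_word \<Rightarrow>\<^sub>0 complex"

definition free_algebra :: "(complex, free_alg) module" where
  "free_algebra = \<lparr>carrier = UNIV, mult = (*), one = 1, zero = 0, add = (+), smult = (*\<^sub>C)\<rparr>"

definition gen_X :: free_alg where
  "gen_X = Poly_Mapping.single (NC_Word [LX]) 1"

definition gen_Y :: free_alg where
  "gen_Y = Poly_Mapping.single (NC_Word [LY]) 1"

definition gen_Z :: free_alg where
  "gen_Z = gen_X * gen_Y - gen_Y * gen_X"

text \<open>Each relation \<open>l = r\<close> enters as the element \<open>l - r\<close> of the free algebra.\<close>

definition Z2_relations :: "(param \<Rightarrow> complex) \<Rightarrow> free_alg set" where
  "Z2_relations m = (let X = gen_X; Y = gen_Y; Z = gen_Z in
     { (X * Z - Z * X) - (- 6 * Y ^ 2 + a_2 m *\<^sub>C X ^ 2 + a_5 m *\<^sub>C X + a_8 m *\<^sub>C 1),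
       (Y * Z - Z * Y) - (- 2 * X ^ 3 - a_2 m *\<^sub>C (X * Y + Y * X) - a_5 m *\<^sub>C Y
                            + a_6 m *\<^sub>C X + a_9 m *\<^sub>C 1),
       (x_1 m *\<^sub>C X + x_2 m *\<^sub>C Y + x_3 m *\<^sub>C X ^ 2 + x_4 m *\<^sub>C (X * Y + Y * X) + x_5 m *\<^sub>C Y ^ 2
          + x_7 m *\<^sub>C (X * Y * X) - X ^ 4 + 4 * Y ^ 3 + Z ^ 2) - a_12 m *\<^sub>C 1 })"

definition Z2_ideal :: "(param \<Rightarrow> complex) \<Rightarrow> free_alg set" where
  "Z2_ideal m = genideal free_algebra (Z2_relations m)"

definition Z2_su3 :: "(param \<Rightarrow> complex) \<Rightarrow> (complex, free_alg set) module" where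
  "Z2_su3 m = quotient_alg free_algebra (Z2_ideal m)"

definition Z2_X :: "(param \<Rightarrow> complex) \<Rightarrow> free_alg set" where
  "Z2_X m = Z2_ideal m +>\<^bsub>free_algebra\<^esub> gen_X"

definition Z2_Y :: "(param \<Rightarrow> complex) \<Rightarrow> free_alg set" where
  "Z2_Y m = Z2_ideal m +>\<^bsub>free_algebra\<^esub> gen_Y"


section \<open>The faces\<close>

definition highest_root :: "real ^ 6" where
  "highest_root = \<alpha> 1 + 2 *\<^sub>R \<alpha> 2 + 3 *\<^sub>R \<alpha> 3 + 2 *\<^sub>R \<alpha> 4 + \<alpha> 5 + 2 *\<^sub>R \<alpha> 6"

text \<open>
  The element of minimal length taking the highest root to \<open>\<Lambda>\<close> is unique, so the choice in
  \<^const>\<open>arg_min_on\<close> is immaterial.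
\<close>

definition minimal_weyl :: "real ^ 6 \<Rightarrow> real ^ 6 \<Rightarrow> real ^ 6" where
  "minimal_weyl \<Lambda> = arg_min_on weyl_length {w \<in> weyl_group. w highest_root = \<Lambda>}"

definition highest_face :: "(real ^ 6) list" where
  "highest_face =
     [\<alpha> 1 + \<alpha> 2 + \<alpha> 3 + \<alpha> 4 + \<alpha> 5, \<alpha> 1 + \<alpha> 2 + \<alpha> 3 + \<alpha> 4, \<alpha> 1 + \<alpha> 2 + \<alpha> 3, \<alpha> 1 + \<alpha> 2, \<alpha> 1]"

text \<open>\<open>\<xi>\<^sub>i\<close> is indexed by \<open>i \<in> {1..5}\<close>, whereas list positions start at 0.\<close>

definition face_vertex :: "real ^ 6 \<Rightarrow> nat \<Rightarrow> real ^ 6" where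
  "face_vertex \<Lambda> i = minimal_weyl \<Lambda> (highest_face ! (i - 1))"

definition Xi_face :: "real ^ 6 \<Rightarrow> nat \<Rightarrow> (real ^ 6) set" where
  "Xi_face \<Lambda> k =
     (if k = 0 then face_vertex \<Lambda> ` {1..5}
      else {- face_vertex \<Lambda> k} \<union> {face_vertex \<Lambda> j - face_vertex \<Lambda> k |j. j \<in> {1..5} \<and> j \<noteq> k})"

definition signed_face :: "int \<Rightarrow> real ^ 6 \<Rightarrow> nat \<Rightarrow> (real ^ 6) set" where
  "signed_face \<epsilon> \<Lambda> k = (\<lambda>\<xi>. of_int \<epsilon> *\<^sub>R \<xi>) ` Xi_face \<Lambda> k"


section \<open>The tridiagonal matrices\<close>

text \<open>
  In the following, \<open>F\<close> is a 4-face belonging to the positive root \<open>\<Lambda>\<close>. Its elements are distinct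
  and nonzero vectors, so sums over \<open>insert 0 F\<close> run over \<open>\<xi>\<^sub>1, \<dots>, \<xi>\<^sub>5\<close> and \<open>\<xi>\<^sub>6 = 0\<close>, even if some of
  their complex values coincide.
\<close>

context
  fixes m :: "param \<Rightarrow> complex" and \<Lambda> :: "real ^ 6" and F :: "(real ^ 6) set"
begin

definition lambda_plus :: complex where
  "lambda_plus = 1 / 2 * root_value m \<Lambda> + 1 / 6 * (\<Sum>\<xi>\<in>F. root_value m \<xi>)"

definition lambda_minus :: complex where
  "lambda_minus = - 1 / 2 * root_value m \<Lambda> + 1 / 6 * (\<Sum>\<xi>\<in>F. root_value m \<xi>)"

definition power_sum :: "int \<Rightarrow> nat \<Rightarrow> complex" where
  "power_sum j k = (\<Sum>\<xi>\<in>insert 0 F. (root_value m \<xi> - of_int j + 1 / 2) ^ k)"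

definition diag_A :: "int \<Rightarrow> complex" where
  "diag_A j = (let E = power_sum j; L = root_value m \<Lambda> in
     - 1 / 108 * (7 / 2 * E 1 ^ 3 - 18 * E 1 * E 2 + 18 * E 3) - 1 / 24 * E 1 * (L ^ 2 + 2))"

definition diag_B :: "int \<Rightarrow> complex" where
  "diag_B j = (let E = power_sum j; L = root_value m \<Lambda> in
     1 / 288 * (5 / 2 * E 1 ^ 4 + 32 * E 1 * E 3 + 6 * (E 2 ^ 2 - 3 * E 1 ^ 2 * E 2 - 4 * E 4)
       + 6 * E 2 * (L ^ 2 + 2) - 3 * E 1 ^ 2 * (L ^ 2 - 2) - 3 / 2 * L ^ 4 + 6 * L ^ 2 - 36))"

text \<open>The first argument is the row index, the second one the column index.\<close>

definition matrix_A :: "int \<Rightarrow> int \<Rightarrow> complex" where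
  "matrix_A i j =
     (if i = j + 1 then 1
      else if i = j then diag_A j
      else if j = i + 1 then of_int i * (\<Prod>\<xi>\<in>F. of_int i - root_value m \<xi>)
      else 0)"

definition matrix_B :: "int \<Rightarrow> int \<Rightarrow> complex" where
  "matrix_B i j =
     (if i = j + 1 then of_int j - lambda_plus
      else if i = j then diag_B j
      else if j = i + 1 then
        of_int i * (of_int i - lambda_minus) * (\<Prod>\<xi>\<in>F. of_int i - root_value m \<xi>)
      else 0)"

end


section \<open>Operators on the space with basis indexed by the integers\<close>

text \<open>
  The space with basis \<open>(v\<^sub>j)\<close> is \<open>int \<Rightarrow>\<^sub>0 complex\<close> with \<open>v\<^sub>j = Poly_Mapping.single j 1\<close>. A matrix
  with finitely many nonzero entries in each column acts by \<open>v\<^sub>j \<mapsto> \<Sum>\<^sub>i M i j v\<^sub>i\<close>, so that matrix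
  products correspond to compositions.
\<close>

type_synonym zspace = "int \<Rightarrow>\<^sub>0 complex"

definition matrix_operator :: "(int \<Rightarrow> int \<Rightarrow> complex) \<Rightarrow> zspace \<Rightarrow> zspace" where
  "matrix_operator M v =
     (\<Sum>j\<in>Poly_Mapping.keys v. \<Sum>i | M i j \<noteq> 0.
        Poly_Mapping.single i (M i j * Poly_Mapping.lookup v j))"

definition End_zspace :: "(complex, zspace \<Rightarrow> zspace) module" where
  "End_zspace =
     \<lparr>carrier = {T. Vector_Spaces.linear (*\<^sub>C) (*\<^sub>C) T},
      mult = (\<circ>), one = id, zero = (\<lambda>v. 0), add = (\<lambda>S T v. S v + T v),
      smult = (\<lambda>c T v. c *\<^sub>C T v)\<rparr>"

end

theory Submission
  imports Defs
begin

text \<open>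
  Since the polynomials \<open>p\<^sub>k\<close> are invariant, translating the parameters by an element of the Weyl group
  that maps the highest root to \<open>\<Lambda>\<close> reduces everything to \<open>\<Lambda> = \<Theta>\<close>. In the coordinates \<open>l = \<Theta> / 2\<close> and
  \<open>x\<^sub>0, \<dots>, x\<^sub>5\<close> (with sum zero) given by the subsystem of type \<open>A\<^sub>1 \<times> A\<^sub>5\<close>, the elements of a face have the
  values \<open>\<plusminus>(x\<^sub>i - x\<^sub>c)\<close>. With \<open>t = j \<plusminus> x\<^sub>c\<close> the entries of the matrices are polynomials in \<open>t\<close>, \<open>l\<close> and the
  elementary symmetric functions of the \<open>\<plusminus>x\<^sub>i\<close>, and each relation becomes one polynomial identity for
  every diagonal, provided that the \<open>p\<^sub>k\<close> are known in terms of \<open>l\<close> and these functions.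

  To find the \<open>p\<^sub>k\<close>, note that averaging over the stabilizer of the subsystem of type \<open>3 A\<^sub>2\<close> spanned by
  the parameters turns \<open>p\<^sub>k\<close> into a sum over the 40 subsystems of this type. The latter is compared with a
  polynomial in the power sums of the 27 weights, which are easily expressed by \<open>l\<close> and the elementary
  symmetric functions. The difference is an invariant polynomial of degree at most 12, and such a
  polynomial is zero as soon as it vanishes for \<open>l = 0\<close>, \<open>x\<^sub>0 = x\<^sub>1\<close>: being symmetric in the \<open>x\<^sub>i\<close>, it has 15
  zeros on suitable lines and therefore vanishes for \<open>l = 0\<close>; hence it vanishes on all root hyperplanes, and,
  by the same argument, everywhere.
\<close>

section \<open>Words in the Weyl group\<close>

text \<open>The averages have 51840 terms of degree up to 12 in six variables and cannot be
  expanded; every reduction serves to leave ring identities in few variables. The order of the group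
  needs a proof, since it enters the averages only as a numeral. The sums over subsystems are
  computed only on a subspace of codimension two, whereas the power sums of the weights are explicit
  everywhere; comparing both transports the values from the subspace to the whole space.

  The bound on the degree comes from the 15 positive roots of \<open>A_5\<close>: a symmetric
  polynomial that vanishes where two coordinates agree is divisible by all 15 differences.
  Restriction to a line replaces this divisibility by counting roots in one variable.

  Only one sign has to be treated for the relations. Negating the \<open>x_i\<close> changes the
  sign of the invariants of odd degree, hence of \<open>a_5\<close>, \<open>a_9\<close>,
  \<open>x_1\<close> and \<open>x_4\<close>, and this is exactly compensated by replacing
  \<open>X\<close>, \<open>Y\<close>, \<open>Z\<close> by \<open>- X\<close>, \<open>Y\<close>,
  \<open>- Z\<close>.\<close>

lemma exhaust_6: "x = 1 \<or> x = 2 \<or> x = 3 \<or> x = 4 \<or> x = 5 \<or> x = 6" for x :: 6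
proof (induct x)
  case (of_int z)
  then have "z = 0 \<or> z = 1 \<or> z = 2 \<or> z = 3 \<or> z = 4 \<or> z = 5" by fastforce
  then show ?case by auto
qed

lemma UNIV_6: "UNIV = {1, 2, 3, 4, 5, 6 :: 6}"
  using exhaust_6 by auto

lemma sum_6: "sum f (UNIV :: 6 set) = f 1 + f 2 + f 3 + f 4 + f 5 + f 6"
  unfolding UNIV_6 by (simp add: ac_simps)

lemma forall_6: "(\<forall>i :: 6. P i) \<longleftrightarrow> P 1 \<and> P 2 \<and> P 3 \<and> P 4 \<and> P 5 \<and> P 6"
  by (metis exhaust_6)

lemma simple_reflection_nth:
  "simple_reflection i x $ j = (if j = i then x $ i - (\<Sum>k\<in>UNIV. x $ k * e6_cartan k i) else x $ j)"
proof -
  have "e6_form x (\<alpha> i) = (\<Sum>k\<in>UNIV. x $ k * e6_cartan k i)"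
    unfolding e6_form_def
    by (intro sum.cong refl, subst sum.remove[of _ i]) (auto simp: axis_def intro!: sum.neutral)
  then show ?thesis
    by (simp add: simple_reflection_def axis_def)
qed

lemma linear_simple_reflection: "linear (simple_reflection i)"
  by (rule linearI)
    (simp_all add: vec_eq_iff simple_reflection_nth algebra_simps sum.distrib sum_distrib_left)

lemma simple_reflection_involution [simp]: "simple_reflection i (simple_reflection i x) = x"
proof -
  have "(\<Sum>k\<in>UNIV. simple_reflection i x $ k * e6_cartan k i) = - (\<Sum>k\<in>UNIV. x $ k * e6_cartan k i)"
    by (subst (1 2) sum.remove[of _ i])
      (auto simp: simple_reflection_nth sum.remove[of UNIV i] e6_cartan_def[of i i] intro!: sum.cong)
  then show ?thesis
    by (simp add: vec_eq_iff simple_reflection_nth)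
qed

lemma weyl_word_Nil [simp]: "weyl_word [] = id"
  and weyl_word_Cons: "weyl_word (i # u) = simple_reflection i \<circ> weyl_word u"
  by (simp_all add: weyl_word_def)

lemma weyl_word_append: "weyl_word (u @ u') = weyl_word u \<circ> weyl_word u'"
  by (induction u) (simp_all add: weyl_word_Cons o_assoc)

lemma linear_weyl_word: "linear (weyl_word u)"
proof (induction u)
  case Nil
  show ?case by (simp add: linear_id[unfolded id_def] id_def)
next
  case (Cons i u)
  show ?case
    unfolding weyl_word_Cons by (rule linear_compose[OF Cons linear_simple_reflection])
qed

lemma weyl_word_rev: "weyl_word u \<circ> weyl_word (rev u) = id"
  by (induction u) (auto simp: weyl_word_Cons weyl_word_append fun_eq_iff)

lemma weyl_word_fixes_coordinate: "n \<notin> set u \<Longrightarrow> weyl_word u x $ n = x $ n"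
  by (induction u) (auto simp: weyl_word_Cons simple_reflection_nth)

lemma e6_form_bilinear:
  "e6_form (x + y) z = e6_form x z + e6_form y z" "e6_form x (y + z) = e6_form x y + e6_form x z"
  "e6_form (c *\<^sub>R x) z = c * e6_form x z" "e6_form x (c *\<^sub>R z) = c * e6_form x z"
  "e6_form (x - y) z = e6_form x z - e6_form y z" "e6_form x (y - z) = e6_form x y - e6_form x z"
  by (simp_all add: e6_form_def algebra_simps sum.distrib sum_distrib_left sum_subtractf)

lemma e6_form_commute: "e6_form x y = e6_form y x"
proof -
  have "e6_cartan i j = e6_cartan j i" for i j
    by (auto simp: e6_cartan_def)
  then show ?thesis
    unfolding e6_form_def by (subst sum.swap) (simp add: mult_ac)
qed

lemma e6_form_simple_root: "e6_form (\<alpha> i) (\<alpha> j) = e6_cartan i j"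
  unfolding e6_form_def
  by (subst sum.remove[of _ i], simp, simp, subst sum.remove[of _ j]) (auto simp: axis_def intro!: sum.neutral)

lemma e6_form_simple_reflection: "e6_form (simple_reflection i x) (simple_reflection i y) = e6_form x y"
  by (simp add: simple_reflection_def e6_form_bilinear e6_form_simple_root e6_cartan_def e6_form_commute[of _ y]
      e6_form_commute[of "\<alpha> i" x] algebra_simps)

lemma e6_form_weyl_word: "e6_form (weyl_word u x) (weyl_word u y) = e6_form x y"
  by (induction u) (simp_all add: weyl_word_Cons e6_form_simple_reflection)

text \<open>Conjugating a reflection by \<open>w\<close> gives the reflection in the image of its
  root. In the coset count this shows that multiplying a representative on the right by a generator
  may leave its coset unchanged.\<close>

lemma weyl_word_conjugate:
  assumes "weyl_word u (\<alpha> i) = \<alpha> j"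
  shows "weyl_word (u @ [i]) = weyl_word (j # u)"
proof
  fix x
  have "weyl_word u (simple_reflection i x) = weyl_word u x - e6_form x (\<alpha> i) *\<^sub>R \<alpha> j"
    using linear_weyl_word[of u]
    by (simp add: simple_reflection_def linear_diff linear_scale assms)
  also have "e6_form x (\<alpha> i) = e6_form (weyl_word u x) (\<alpha> j)"
    using e6_form_weyl_word[of u x "\<alpha> i"] by (simp add: assms)
  finally show "weyl_word (u @ [i]) x = weyl_word (j # u) x"
    by (simp add: weyl_word_append weyl_word_Cons simple_reflection_def)
qed

section \<open>The order of the Weyl group\<close>

definition parabolic :: "6 set \<Rightarrow> (real ^ 6 \<Rightarrow> real ^ 6) set" where
  "parabolic J = weyl_word ` lists J"

text \<open>
  The words \<open>r\<close> represent the right cosets of a parabolic subgroup generated by \<open>J\<close>; they are told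
  apart by the \<open>n\<close>-th coordinate, which the generators in \<open>J\<close> do not change.
\<close>

lemma card_parabolic_insert:
  assumes n: "n \<notin> J" and R: "[] \<in> set R" "set R \<subseteq> lists (insert n J)"
    and closed: "\<And>r i. r \<in> set R \<Longrightarrow> i \<in> insert n J \<Longrightarrow>
      (\<exists>r'\<in>set R. weyl_word (r @ [i]) = weyl_word r') \<or>
      (\<exists>j\<in>J. weyl_word (r @ [i]) = weyl_word (j # r))"
    and distinct: "distinct (map (\<lambda>r x. weyl_word r x $ n) R)"
    and fin: "finite (parabolic J)"
  shows "finite (parabolic (insert n J)) \<and> card (parabolic (insert n J)) = card (parabolic J) * length R"
proof -
  let ?f = "\<lambda>(h, r). h \<circ> weyl_word r"
  \<comment> \<open>The products of \<open>parabolic J\<close> with the representatives are closed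
    under right multiplication by generators, hence the induction from the right end of the
    word.\<close>
  have "weyl_word u \<in> ?f ` (parabolic J \<times> set R)" if "u \<in> lists (insert n J)" for u
    using that
  proof (induction u rule: rev_induct)
    case Nil
    have "weyl_word [] \<in> parabolic J" unfolding parabolic_def by (rule imageI) simp
    with R(1) show ?case by (force intro!: rev_image_eqI)
  next
    case (snoc i u)
    then obtain w r where w: "w \<in> lists J" and r: "r \<in> set R" and u: "weyl_word u = weyl_word w \<circ> weyl_word r"
      unfolding parabolic_def by (auto simp del: o_apply)
    have ui: "weyl_word (u @ [i]) = weyl_word w \<circ> weyl_word (r @ [i])"
      by (simp add: weyl_word_append u o_assoc)
    have "i \<in> insert n J" using snoc.prems by simp
    from closed[OF r this] show ?case
    proof (elim disjE bexE)
      fix r' assume "r' \<in> set R" "weyl_word (r @ [i]) = weyl_word r'"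
      then show ?thesis
        using w ui by (intro rev_image_eqI[of "(weyl_word w, r')"]) (auto simp: parabolic_def)
    next
      fix j assume "j \<in> J" "weyl_word (r @ [i]) = weyl_word (j # r)"
      moreover from this have "weyl_word (w @ [j]) \<in> parabolic J"
        using w unfolding parabolic_def by (intro imageI) auto
      ultimately show ?thesis
        using w ui r
        by (intro rev_image_eqI[of "(weyl_word (w @ [j]), r)"])
          (auto simp: weyl_word_append weyl_word_Cons o_assoc)
    qed
  qed
  moreover have "?f (h, r) \<in> parabolic (insert n J)" if h: "h \<in> parabolic J" and r: "r \<in> set R" for h r
  proof -
    obtain w where "w \<in> lists J" "h = weyl_word w" using h by (auto simp: parabolic_def)
    moreover have "r \<in> lists (insert n J)" using r R(2) by blast
    ultimately show ?thesis
      unfolding parabolic_def by (intro rev_image_eqI[of "w @ r"]) (auto simp: weyl_word_append)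
  qed
  ultimately have eq: "parabolic (insert n J) = ?f ` (parabolic J \<times> set R)"
    by (intro equalityI subsetI) (auto simp only: parabolic_def[of "insert n J"] mem_Sigma_iff)
  have coord: "h x $ n = x $ n" if "h \<in> parabolic J" for h x
    using that n by (auto simp: parabolic_def intro!: weyl_word_fixes_coordinate)
  have inj: "inj_on ?f (parabolic J \<times> set R)"
  proof (rule inj_onI, clarify)
    fix h r h' r'
    assume h: "h \<in> parabolic J" "h' \<in> parabolic J" and r: "r \<in> set R" "r' \<in> set R"
      and eq: "h \<circ> weyl_word r = h' \<circ> weyl_word r'"
    have "weyl_word r x $ n = weyl_word r' x $ n" for x
      using coord[OF h(1), of "weyl_word r x"] coord[OF h(2), of "weyl_word r' x"] fun_cong[OF eq, of x]
      by simp
    then have "r = r'"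
      using distinct r by (auto simp: distinct_map dest: inj_onD)
    moreover have "h = h \<circ> weyl_word r \<circ> weyl_word (rev r)"
      using weyl_word_rev[of r] by (simp add: comp_assoc)
    moreover have "h' = h' \<circ> weyl_word r' \<circ> weyl_word (rev r')"
      using weyl_word_rev[of r'] by (simp add: comp_assoc)
    ultimately show "h = h' \<and> r = r'"
      using eq by auto
  qed
  have "distinct R" using distinct by (simp add: distinct_map)
  with inj show ?thesis
    unfolding eq using fin by (simp add: card_image card_cartesian_product distinct_card)
qed

section \<open>Integer model of the root lattice, suited to evaluation\<close>

type_synonym lattice = "int \<times> int \<times> int \<times> int \<times> int \<times> int"

definition lattice_vec :: "lattice \<Rightarrow> real ^ 6" where
  "lattice_vec = (\<lambda>(a, b, c, d, e, f). of_int a *\<^sub>R \<alpha> 1 + of_int b *\<^sub>R \<alpha> 2 + of_int c *\<^sub>R \<alpha> 3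
     + of_int d *\<^sub>R \<alpha> 4 + of_int e *\<^sub>R \<alpha> 5 + of_int f *\<^sub>R \<alpha> 6)"

text \<open>Only the \<open>i\<close>-th coordinate changes: it becomes the sum of its neighbours in
  the Dynkin diagram minus itself. Every index outside 1..5 acts as 6.\<close>

fun reflect :: "nat \<Rightarrow> lattice \<Rightarrow> lattice" where
  "reflect i (a, b, c, d, e, f) =
     (if i = 1 then (b - a, b, c, d, e, f)
      else if i = 2 then (a, a + c - b, c, d, e, f)
      else if i = 3 then (a, b, b + d + f - c, d, e, f)
      else if i = 4 then (a, b, c, c + e - d, e, f)
      else if i = 5 then (a, b, c, d, d - e, f)
      else (a, b, c, d, e, c - f))"

lemma lattice_vec_nth:
  "lattice_vec (a, b, c, d, e, f) $ 1 = of_int a" "lattice_vec (a, b, c, d, e, f) $ 2 = of_int b"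
  "lattice_vec (a, b, c, d, e, f) $ 3 = of_int c" "lattice_vec (a, b, c, d, e, f) $ 4 = of_int d"
  "lattice_vec (a, b, c, d, e, f) $ 5 = of_int e" "lattice_vec (a, b, c, d, e, f) $ 6 = of_int f"
  by (simp_all add: lattice_vec_def axis_def)

definition indices :: "nat list" where
  "indices = [1, 2, 3, 4, 5, 6]"

lemma reflect: "i \<in> set indices \<Longrightarrow> simple_reflection (of_nat i) (lattice_vec t) = lattice_vec (reflect i t)"
  by (cases t)
    (auto simp: indices_def vec_eq_iff forall_6 simple_reflection_nth sum_6 lattice_vec_nth
      e6_cartan_def e6_edges_def)

lemma foldr_reflect:
  "set u \<subseteq> set indices \<Longrightarrow> lattice_vec (foldr reflect u t) = weyl_word (map of_nat u) (lattice_vec t)"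
  by (induction u) (simp_all add: weyl_word_Cons flip: reflect)

definition unit_vec :: "nat \<Rightarrow> lattice" where
  "unit_vec i = (if i = 1 then (1, 0, 0, 0, 0, 0) else if i = 2 then (0, 1, 0, 0, 0, 0)
     else if i = 3 then (0, 0, 1, 0, 0, 0) else if i = 4 then (0, 0, 0, 1, 0, 0)
     else if i = 5 then (0, 0, 0, 0, 1, 0) else (0, 0, 0, 0, 0, 1))"

lemma lattice_vec_unit_vec: "i \<in> set indices \<Longrightarrow> lattice_vec (unit_vec i) = \<alpha> (of_nat i)"
  by (auto simp: indices_def lattice_vec_def unit_vec_def)

lemma linear_eq_on_simple_roots:
  assumes "linear f" "linear g" "\<And>i. f (\<alpha> i) = g (\<alpha> i)"
  shows "f = g"
proof (rule linear_eq_stdbasis[OF assms(1,2)])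
  show "f b = g b" if "b \<in> Basis" for b
    using that assms(3) by (auto simp: Basis_vec_def)
qed

lemma weyl_word_eqI:
  assumes "set u \<subseteq> set indices" "set u' \<subseteq> set indices"
    and "\<forall>i\<in>set indices. foldr reflect u (unit_vec i) = foldr reflect u' (unit_vec i)"
  shows "weyl_word (map of_nat u) = weyl_word (map of_nat u')"
proof (rule linear_eq_on_simple_roots[OF linear_weyl_word linear_weyl_word])
  fix k :: 6
  obtain i where i: "i \<in> set indices" "k = of_nat i"
    using exhaust_6[of k] by (force simp: indices_def)
  then show "weyl_word (map of_nat u) (\<alpha> k) = weyl_word (map of_nat u') (\<alpha> k)"
    using foldr_reflect[OF assms(1), of "unit_vec i"] foldr_reflect[OF assms(2), of "unit_vec i"] assms(3)
    by (simp add: lattice_vec_unit_vec)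
qed

fun coordinate :: "nat \<Rightarrow> lattice \<Rightarrow> int" where
  "coordinate i (a, b, c, d, e, f) =
     (if i = 1 then a else if i = 2 then b else if i = 3 then c else if i = 4 then d
      else if i = 5 then e else f)"

lemma lattice_vec_coordinate:
  "n \<in> set indices \<Longrightarrow> lattice_vec t $ of_nat n = of_int (coordinate n t)"
  by (cases t) (auto simp: indices_def lattice_vec_nth)

text \<open>Executable form of the hypotheses of \<open>card_parabolic_insert\<close>. A generator
  appended to a listed word extends it to a listed word, cancels its last letter, passes to the left
  as a generator from \<open>J\<close>, or gives the same map as another listed word. Multiplication
  by a reflection changes the length by one, which limits the candidates in the last case. The words
  are told apart by row \<open>n\<close> of their matrices.\<close>

definition coset_representatives :: "nat list \<Rightarrow> nat \<Rightarrow> nat list list \<Rightarrow> bool" where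
  "coset_representatives J n R \<longleftrightarrow>
     n \<in> set indices \<and> n \<notin> set J \<and> set J \<subseteq> set indices \<and> [] \<in> set R \<and>
     (\<forall>r\<in>set R. set r \<subseteq> insert n (set J)) \<and>
     (\<forall>r\<in>set R. \<forall>i\<in>set (n # J).
        r @ [i] \<in> set R \<or> (r \<noteq> [] \<and> last r = i \<and> butlast r \<in> set R) \<or>
        (\<exists>j\<in>set J. foldr reflect r (unit_vec i) = unit_vec j) \<or>
        (\<exists>r'\<in>set R. (length r' = Suc (length r) \<or> length r = Suc (length r')) \<and>
           (\<forall>k\<in>set indices. foldr reflect (r @ [i]) (unit_vec k) = foldr reflect r' (unit_vec k)))) \<and>
     distinct (map (\<lambda>r. map (\<lambda>k. coordinate n (foldr reflect r (unit_vec k))) indices) R)"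

lemma of_nat_index_inj: "inj_on (of_nat :: nat \<Rightarrow> 6) (set indices)"
  by (auto simp: inj_on_def indices_def)

lemma card_parabolic_representatives:
  assumes "coset_representatives J n R" and "finite (parabolic (of_nat ` set J))"
  shows "finite (parabolic (of_nat ` set (n # J))) \<and>
    card (parabolic (of_nat ` set (n # J))) = card (parabolic (of_nat ` set J)) * length R"
proof -
  note R = assms(1)[unfolded coset_representatives_def]
  let ?w = "map of_nat :: nat list \<Rightarrow> 6 list"
  have n: "n \<in> set indices" "n \<notin> set J" and J: "set J \<subseteq> set indices" and Nil: "[] \<in> set R"
    and words: "\<forall>r\<in>set R. set r \<subseteq> insert n (set J)"
    using conjunct1[OF R] R[THEN conjunct2, THEN conjunct1] R[THEN conjunct2, THEN conjunct2, THEN conjunct1]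
      R[THEN conjunct2, THEN conjunct2, THEN conjunct2, THEN conjunct1]
      R[THEN conjunct2, THEN conjunct2, THEN conjunct2, THEN conjunct2, THEN conjunct1]
    by blast+
  have sub: "set r \<subseteq> set indices" if "r \<in> set R" for r
    using n J words that by blast
  have dist: "distinct (map (\<lambda>r x. weyl_word r x $ of_nat n) (map ?w R))"
  proof -
    \<comment> \<open>The lists contain the values of the \<open>n\<close>-th coordinate functions
      at the simple roots, so distinct lists force distinct functions.\<close>
    have "distinct (map (map real_of_int) (map (\<lambda>r. map (\<lambda>k. coordinate n (foldr reflect r (unit_vec k))) indices) R))"
      unfolding distinct_map[of "map real_of_int"]
      using R[THEN conjunct2, THEN conjunct2, THEN conjunct2, THEN conjunct2, THEN conjunct2, THEN conjunct2]
      by (auto simp: inj_on_def intro: map_injective)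
    also have "map (map real_of_int) (map (\<lambda>r. map (\<lambda>k. coordinate n (foldr reflect r (unit_vec k))) indices) R)
      = map (\<lambda>g. map (\<lambda>k. g (lattice_vec (unit_vec k))) indices) (map (\<lambda>r x. weyl_word r x $ of_nat n) (map ?w R))"
      using sub n by (auto simp: foldr_reflect[symmetric] lattice_vec_coordinate)
    finally show ?thesis by (simp only: distinct_map)
  qed
  have closed: "(\<exists>r'\<in>set (map ?w R). weyl_word (r @ [i]) = weyl_word r') \<or>
      (\<exists>j\<in>of_nat ` set J. weyl_word (r @ [i]) = weyl_word (j # r))"
    if r: "r \<in> set (map ?w R)" and i: "i \<in> insert (of_nat n) (of_nat ` set J)" for r i
  proof -
    obtain s where s: "s \<in> set R" "r = ?w s" using r by auto
    obtain k where k: "k \<in> set (n # J)" "i = of_nat k" using i by auto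
    have ind: "set s \<subseteq> set indices" "k \<in> set indices" using sub s k n J by auto
    note closure = R[THEN conjunct2, THEN conjunct2, THEN conjunct2, THEN conjunct2, THEN conjunct2, THEN conjunct1]
    from bspec[OF bspec[OF closure s(1)] k(1)] consider
        "s @ [k] \<in> set R" | "s \<noteq> []" "last s = k" "butlast s \<in> set R"
      | j where "j \<in> set J" "foldr reflect s (unit_vec k) = unit_vec j"
      | r' where "r' \<in> set R" "\<forall>l\<in>set indices. foldr reflect (s @ [k]) (unit_vec l) = foldr reflect r' (unit_vec l)"
      by (elim disjE conjE bexE)
    then show ?thesis
    proof cases
      case 1
      then have "?w (s @ [k]) \<in> set (map ?w R)" by (metis imageI set_map)
      then show ?thesis using s k by (intro disjI1 bexI[of _ "?w (s @ [k])"]) auto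
    next
      case 2
      then have "s = butlast s @ [k]" by (metis append_butlast_last_id)
      then have "r = ?w (butlast s) @ [i]" using s k by (metis list.simps(8,9) map_append)
      then have "weyl_word (r @ [i]) = weyl_word (?w (butlast s))"
        by (auto simp: weyl_word_append weyl_word_Cons fun_eq_iff)
      moreover have "?w (butlast s) \<in> set (map ?w R)" using 2(3) by (metis imageI set_map)
      ultimately show ?thesis by blast
    next
      case (3 j)
      have "weyl_word r (\<alpha> i) = \<alpha> (of_nat j)"
        using foldr_reflect[OF ind(1), of "unit_vec k"] 3 J ind(2) s k
        by (auto simp: lattice_vec_unit_vec)
      then show ?thesis
        using 3(1) weyl_word_conjugate by blast
    next
      case (4 r')
      have "weyl_word (?w (s @ [k])) = weyl_word (?w r')"
        using 4 ind sub by (intro weyl_word_eqI) auto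
      moreover have "?w r' \<in> set (map ?w R)" using 4(1) by (metis imageI set_map)
      ultimately show ?thesis using s k by auto
    qed
  qed
  have "of_nat n \<notin> (of_nat :: nat \<Rightarrow> 6) ` set J"
    using J n inj_on_image_mem_iff[OF of_nat_index_inj] by blast
  moreover have "[] \<in> set (map ?w R)" using Nil by (auto intro!: rev_image_eqI[of "[]"])
  moreover have "set (map ?w R) \<subseteq> lists (insert (of_nat n) (of_nat ` set J))"
    using words by (fastforce simp: lists_eq_set)
  ultimately show ?thesis
    using card_parabolic_insert[OF _ _ _ closed dist assms(2)] by simp
qed

section \<open>Cosets along the chain A1 < A2 < A3 < A4 < D5 < E6\<close>

definition a1_cosets :: "nat list list" where
  "a1_cosets =
     [[], [1]]"

definition a2_cosets :: "nat list list" where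
  "a2_cosets =
     [[], [2], [2, 1]]"

definition a3_cosets :: "nat list list" where
  "a3_cosets =
     [[], [3], [3, 2], [3, 2, 1]]"

definition a4_cosets :: "nat list list" where
  "a4_cosets =
     [[], [4], [4, 3], [4, 3, 2], [4, 3, 2, 1]]"

definition d5_cosets :: "nat list list" where
  "d5_cosets =
     [[], [6], [6, 3], [6, 3, 2], [6, 3, 4], [6, 3, 2, 1], [6, 3, 2, 4], [6, 3, 2, 1, 4], [6,
      3, 2, 4, 3], [6, 3, 2, 1, 4, 3], [6, 3, 2, 4, 3, 6], [6, 3, 2, 1, 4, 3, 2], [6, 3, 2, 1,
      4, 3, 6], [6, 3, 2, 1, 4, 3, 2, 6], [6, 3, 2, 1, 4, 3, 2, 6, 3], [6, 3, 2, 1, 4, 3, 2, 6,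
      3, 4]]"

definition e6_cosets :: "nat list list" where
  "e6_cosets =
     [[], [5], [5, 4], [5, 4, 3], [5, 4, 3, 2], [5, 4, 3, 6], [5, 4, 3, 2, 1], [5, 4, 3, 2, 6],
      [5, 4, 3, 2, 1, 6], [5, 4, 3, 2, 6, 3], [5, 4, 3, 2, 1, 6, 3], [5, 4, 3, 2, 6, 3, 4], [5,
      4, 3, 2, 1, 6, 3, 2], [5, 4, 3, 2, 1, 6, 3, 4], [5, 4, 3, 2, 6, 3, 4, 5], [5, 4, 3, 2, 1,
      6, 3, 2, 4], [5, 4, 3, 2, 1, 6, 3, 4, 5], [5, 4, 3, 2, 1, 6, 3, 2, 4, 3], [5, 4, 3, 2, 1,
      6, 3, 2, 4, 5], [5, 4, 3, 2, 1, 6, 3, 2, 4, 3, 5], [5, 4, 3, 2, 1, 6, 3, 2, 4, 3, 6], [5,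
      4, 3, 2, 1, 6, 3, 2, 4, 3, 5, 4], [5, 4, 3, 2, 1, 6, 3, 2, 4, 3, 5, 6], [5, 4, 3, 2, 1,
      6, 3, 2, 4, 3, 5, 4, 6], [5, 4, 3, 2, 1, 6, 3, 2, 4, 3, 5, 4, 6, 3], [5, 4, 3, 2, 1, 6,
      3, 2, 4, 3, 5, 4, 6, 3, 2], [5, 4, 3, 2, 1, 6, 3, 2, 4, 3, 5, 4, 6, 3, 2, 1]]"

lemma a1_cosets: "coset_representatives [] 1 a1_cosets"
  by code_simp

lemma a2_cosets: "coset_representatives [1] 2 a2_cosets"
  by code_simp

lemma a3_cosets: "coset_representatives [2, 1] 3 a3_cosets"
  by code_simp

lemma a4_cosets: "coset_representatives [3, 2, 1] 4 a4_cosets"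
  by code_simp

lemma d5_cosets: "coset_representatives [4, 3, 2, 1] 6 d5_cosets"
  by code_simp

lemma e6_cosets: "coset_representatives [6, 4, 3, 2, 1] 5 e6_cosets"
  by code_simp

text \<open>The order is the product of the indices along the chain, 2 * 3 * 4 * 5 * 16 *
  27.\<close>

theorem card_weyl_group: "finite weyl_group" "card weyl_group = 51840"
proof -
  have "parabolic (of_nat ` set []) = {id}"
    by (auto simp: parabolic_def)
  then have "finite (parabolic (of_nat ` set []))" "card (parabolic (of_nat ` set [])) = 1"
    by auto
  note c1 = this
  note c2 = card_parabolic_representatives[OF a1_cosets c1(1), unfolded c1(2)]
  note c3 = card_parabolic_representatives[OF a2_cosets conjunct1[OF c2], unfolded conjunct2[OF c2]]
  note c4 = card_parabolic_representatives[OF a3_cosets conjunct1[OF c3], unfolded conjunct2[OF c3]]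
  note c5 = card_parabolic_representatives[OF a4_cosets conjunct1[OF c4], unfolded conjunct2[OF c4]]
  note c6 = card_parabolic_representatives[OF d5_cosets conjunct1[OF c5], unfolded conjunct2[OF c5]]
  note c7 = card_parabolic_representatives[OF e6_cosets conjunct1[OF c6], unfolded conjunct2[OF c6]]
  have "of_nat ` set [5, 6, 4, 3, 2, 1] = (UNIV :: 6 set)"
    unfolding UNIV_6 by auto
  then have W: "parabolic (of_nat ` set [5, 6, 4, 3, 2, 1]) = weyl_group"
    by (simp only: parabolic_def weyl_group_def lists_UNIV)
  show "finite weyl_group"
    using conjunct1[OF c7] unfolding W .
  have "length a1_cosets = 2" "length a2_cosets = 3" "length a3_cosets = 4" "length a4_cosets = 5"
    "length d5_cosets = 16" "length e6_cosets = 27"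
    by (simp_all add: a1_cosets_def a2_cosets_def a3_cosets_def a4_cosets_def d5_cosets_def e6_cosets_def)
  then show "card weyl_group = 51840"
    using conjunct2[OF c7] unfolding W by simp
qed

section \<open>Averages over the Weyl group\<close>

text \<open>The parameter roots span a sublattice of index 3 (the discriminants of 3 A2 and E6 are
  27 and 3), so three times each simple root is an integral combination of them. The number
  \<open>c i\<close> is the resulting value of three times the \<open>i\<close>-th simple
  root.\<close>

lemma root_value_unique: "\<exists>!v. linear v \<and> (\<forall>p. v (param_root p) = (m p :: complex))"
proof -
  define c where "c = (\<lambda>i :: 6.
    if i = 1 then m M1 + 2 * m M2 + m M1' - m M2' - m M1'' - 2 * m M2''
    else if i = 2 then - 2 * m M1 - m M2 + m M1' + 2 * m M2' - m M1'' + m M2''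
    else if i = 3 then m M1 - m M2 + m M1' - m M2' + 2 * m M1'' + m M2''
    else if i = 4 then m M1 + 2 * m M2 - 2 * m M1' - m M2' - m M1'' + m M2''
    else if i = 5 then m M1 - m M2 + m M1' + 2 * m M2' - m M1'' - 2 * m M2''
    else - m M1 + m M2 - m M1' + m M2' + m M1'' - m M2'')"
  define v where "v x = (\<Sum>i\<in>UNIV. of_real (x $ i) * c i) / 3" for x :: "real ^ 6"
  have v: "linear v" "v (param_root p) = m p" for p
  proof -
    show "linear v"
      by (rule linearI)
        (simp_all add: v_def algebra_simps sum.distrib scaleR_conv_of_real[where 'a = complex]
          sum_distrib_left flip: add_divide_distrib)
    show "v (param_root p) = m p"
      by (cases p) (simp_all add: v_def sum_6 axis_def c_def algebra_simps)
  qed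
  have "v' = v" if "linear v' \<and> (\<forall>p. v' (param_root p) = m p)" for v'
  proof (rule linear_eq_on_simple_roots)
    show lin: "linear v'" "linear v" using that v by auto
    have eq: "v' (param_root p) = v (param_root p)" for p using that v by simp
    have *: "3 *\<^sub>R \<alpha> 1 = param_root M1 + 2 *\<^sub>R param_root M2 + param_root M1' - param_root M2' - param_root M1'' - 2 *\<^sub>R param_root M2''"
      "3 *\<^sub>R \<alpha> 2 = param_root M1' - 2 *\<^sub>R param_root M1 - param_root M2 + 2 *\<^sub>R param_root M2' - param_root M1'' + param_root M2''"
      "3 *\<^sub>R \<alpha> 3 = param_root M1 - param_root M2 + param_root M1' - param_root M2' + 2 *\<^sub>R param_root M1'' + param_root M2''"
      "3 *\<^sub>R \<alpha> 4 = param_root M1 + 2 *\<^sub>R param_root M2 - 2 *\<^sub>R param_root M1' - param_root M2' - param_root M1'' + param_root M2''"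
      "3 *\<^sub>R \<alpha> 5 = param_root M1 - param_root M2 + param_root M1' + 2 *\<^sub>R param_root M2' - param_root M1'' - 2 *\<^sub>R param_root M2''"
      "3 *\<^sub>R \<alpha> 6 = param_root M2 - param_root M1 - param_root M1' + param_root M2' + param_root M1'' - param_root M2''"
      by (simp_all add: vec_eq_iff forall_6 axis_def)
    show "v' (\<alpha> i) = v (\<alpha> i)" for i
    proof -
      have "v' (3 *\<^sub>R \<alpha> i) = v (3 *\<^sub>R \<alpha> i)"
        using exhaust_6[of i]
        by (elim disjE; hypsubst; subst (1 2) *; simp only: linear_add linear_diff linear_scale lin eq)
      then show ?thesis
        by (simp add: linear_scale lin)
    qed
  qed
  with v show ?thesis by blast
qed

lemma root_value: "linear (root_value m)" "root_value m (param_root p) = m p"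
  using theI'[OF root_value_unique[of m]] unfolding root_value_def by auto

lemma root_value_eqI: "linear v \<Longrightarrow> (\<And>p. v (param_root p) = m p) \<Longrightarrow> root_value m = v"
  unfolding root_value_def using root_value_unique[of m] by (intro the1_equality) auto

lemma weyl_group_comp: "s \<in> weyl_group \<Longrightarrow> t \<in> weyl_group \<Longrightarrow> s \<circ> t \<in> weyl_group"
  unfolding weyl_group_def by (auto simp: weyl_word_append[symmetric])

lemma linear_weyl_group: "s \<in> weyl_group \<Longrightarrow> linear s"
  unfolding weyl_group_def using linear_weyl_word by auto

lemma weyl_group_inverse:
  assumes "t \<in> weyl_group"
  obtains t' where "t' \<in> weyl_group" "t \<circ> t' = id" "t' \<circ> t = id"
proof -
  obtain u where "t = weyl_word u" using assms by (auto simp: weyl_group_def)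
  then show ?thesis
    using that[of "weyl_word (rev u)"] weyl_word_rev[of u] weyl_word_rev[of "rev u"]
    by (auto simp: weyl_group_def)
qed

lemma sum_weyl_group_translate:
  assumes "t \<in> weyl_group"
  shows "(\<Sum>s\<in>weyl_group. g (s \<circ> t)) = (\<Sum>s\<in>weyl_group. g s)"
    and "(\<Sum>s\<in>weyl_group. g (t \<circ> s)) = (\<Sum>s\<in>weyl_group. g s)"
proof -
  obtain t' where t': "t' \<in> weyl_group" "t \<circ> t' = id" "t' \<circ> t = id"
    using weyl_group_inverse[OF assms] .
  show "(\<Sum>s\<in>weyl_group. g (s \<circ> t)) = (\<Sum>s\<in>weyl_group. g s)"
    by (rule sum.reindex_bij_witness[of _ "\<lambda>s. s \<circ> t'" "\<lambda>s. s \<circ> t"])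
      (use t' assms in \<open>auto simp: comp_assoc weyl_group_comp\<close>)
  show "(\<Sum>s\<in>weyl_group. g (t \<circ> s)) = (\<Sum>s\<in>weyl_group. g s)"
    by (rule sum.reindex_bij_witness[of _ "\<lambda>s. t' \<circ> s" "\<lambda>s. t \<circ> s"])
      (use t' assms in \<open>auto simp: comp_assoc[symmetric] weyl_group_comp\<close>)
qed

lemma weyl_act_eq: "weyl_act s m p = root_value m (s (param_root p))"
  by (simp add: weyl_act_def)

lemma root_value_weyl_act:
  assumes "t \<in> weyl_group"
  shows "root_value (weyl_act t m) = root_value m \<circ> t"
  using root_value(1) linear_weyl_group[OF assms]
  by (intro root_value_eqI linear_compose) (auto simp: weyl_act_eq)

text \<open>Acting by \<open>t\<close> and then by \<open>s\<close> amounts to acting by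
  \<open>t \<circ> s\<close>, so the sum over the group is merely reindexed. This allows the
  parameters to be moved so that \<Lambda> becomes the highest root.\<close>

lemma weyl_average_weyl_act:
  assumes "t \<in> weyl_group"
  shows "weyl_average f (weyl_act t m) = weyl_average f m"
proof -
  have "weyl_act s (weyl_act t m) = weyl_act (t \<circ> s) m" for s
    using assms by (simp add: weyl_act_def[of s] weyl_act_def[of "t \<circ> s"] root_value_weyl_act)
  then show ?thesis
    using sum_weyl_group_translate(2)[OF assms, of "\<lambda>s. f (weyl_act s m)"]
    by (simp add: weyl_average_def)
qed

subsection \<open>Subsystems of type \<open>3 A\<^sub>2\<close>\<close>

text \<open>
  The six parameters are simple roots of a root subsystem of type \<open>A\<^sub>2 \<times> A\<^sub>2 \<times> A\<^sub>2\<close>, of which there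
  are 40. Listing \<open>m\<^sub>2''\<close> before \<open>m\<^sub>1''\<close> makes the stabilizer of the subsystem act by the following
  symmetries.
\<close>

type_synonym 'a sextuple = "'a \<times> 'a \<times> 'a \<times> 'a \<times> 'a \<times> 'a"

fun map_sextuple :: "('a \<Rightarrow> 'b) \<Rightarrow> 'a sextuple \<Rightarrow> 'b sextuple" where
  "map_sextuple g (a, b, c, d, e, f) = (g a, g b, g c, g d, g e, g f)"

text \<open>Numbers 0 and 1 are the simple reflections of the first A2, number 2 rotates the three
  factors, and number 3 exchanges the first two factors while reversing the two simple roots in
  every factor. The reversal is what makes signs appear in the forms that are odd in
  \<open>cub\<close>.\<close>

fun symmetry :: "nat \<Rightarrow> 'a :: ab_group_add sextuple \<Rightarrow> 'a sextuple" where
  "symmetry n (a, b, c, d, e, f) =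
     (if n = 0 then (- a, a + b, c, d, e, f)
      else if n = 1 then (a + b, - b, c, d, e, f)
      else if n = 2 then (c, d, e, f, a, b)
      else (d, c, b, a, f, e))"

definition param_sextuple :: "lattice sextuple" where
  "param_sextuple =
     ((0, 0, 1, 1, 1, 0), (1, 1, 1, 1, 0, 1), (1, 1, 1, 0, 0, 0), (0, 1, 1, 1, 1, 1),
      (0, 1, 1, 1, 0, 0), (0, 0, 1, 0, 0, 1))"

definition symmetry_word :: "nat \<Rightarrow> nat list" where
  "symmetry_word n =
     (if n = 0 then [3, 4, 5, 4, 3] else if n = 1 then [4, 1, 2, 3, 6, 3, 4, 2, 1]
      else if n = 2 then [4, 5, 1, 2] else [6, 4, 2])"

text \<open>One group element for each subsystem, carrying the basic one to it. The stabilizer has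
  order 6^3 * 6 = 1296: three Weyl groups of type A2 and the permutations of the factors, the odd
  ones combined with reversals. Indeed 40 * 1296 = 51840.\<close>

definition subsystem_words :: "nat list list" where
  "subsystem_words =
     [[], [1], [2], [3], [4], [5], [6], [2, 1], [3, 1], [4, 1], [5, 1], [6, 1], [1, 2], [3, 2],
      [2, 3], [4, 3], [5, 3], [3, 4], [6, 5], [4, 3, 1], [5, 3, 1], [3, 4, 1], [3, 1, 2], [2,
      3, 2], [6, 3, 2], [4, 2, 3], [5, 2, 3], [3, 4, 3], [6, 3, 4], [3, 4, 3, 1], [2, 3, 4, 1],
      [6, 3, 4, 1], [6, 3, 1, 2], [6, 2, 3, 2], [6, 3, 4, 3], [2, 3, 4, 3, 1], [6, 3, 4, 3, 1],
      [6, 2, 3, 4, 1], [6, 2, 3, 4, 3, 1], [3, 6, 2, 3, 4, 3, 1]]"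

definition subsystem_table :: "(nat \<times> nat list) list list" where
  "subsystem_table =
     [[(1, []), (0, []), (12, []), (8, []), (9, []), (10, []), (11, []), (18, [2, 3]), (3, []),
      (4, []), (5, []), (6, []), (2, []), (22, []), (14, [3, 1, 3]), (19, []), (20, []), (21,
      []), (7, [2, 3]), (15, []), (16, []), (17, []), (13, []), (23, [3, 1, 3]), (32, []), (25,
      [3, 1, 3]), (26, [3, 1, 3]), (29, []), (31, []), (27, []), (30, [2, 0, 2, 2]), (28, []),
      (24, []), (33, [3, 1, 3]), (36, []), (35, [2, 0, 2, 2]), (34, []), (37, [2, 0, 2, 2]),
      (38, [2, 0, 2, 2]), (39, [2, 0, 2, 2])], [(2, []), (7, []), (0, []), (14, []), (6, [3]),
      (9, [2]), (4, [3]), (1, []), (8, [3, 1, 3]), (5, [2, 2]), (11, [2, 3]), (10, [2, 3]),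
      (18, [2, 3]), (23, []), (3, []), (25, []), (26, []), (17, [2, 0, 2, 2]), (12, [2, 3]),
      (19, [3, 1, 3]), (20, [3, 1, 3]), (30, []), (22, [3, 1, 3]), (13, []), (33, []), (15,
      []), (16, []), (27, [2, 0, 2, 2]), (28, [2, 0, 2, 2]), (35, []), (21, []), (37, []), (32,
      [3, 1, 3]), (24, []), (34, [2, 0, 2, 2]), (29, []), (38, []), (31, []), (36, []), (39,
      [2, 1, 2, 2])], [(3, []), (8, []), (13, []), (0, []), (17, []), (16, []), (6, [2, 1, 2,
      2]), (7, [3, 1, 3]), (1, []), (21, []), (20, []), (11, [2, 1, 2, 2]), (22, []), (2, []),
      (23, []), (27, []), (5, []), (4, []), (18, [2, 1, 2, 2]), (29, []), (10, []), (9, []),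
      (12, []), (14, []), (28, [3]), (25, [2, 0, 2, 2]), (30, [2]), (15, []), (24, [3]), (19,
      []), (26, [2, 2]), (32, [3]), (31, [3]), (33, [2, 1, 2, 2]), (34, [2, 1, 2, 2]), (35, [3,
      1, 3]), (36, [2, 1, 2, 2]), (37, [1]), (39, []), (38, [])], [(4, []), (9, []), (6, [3]),
      (15, []), (0, []), (7, [2]), (2, [3]), (5, [2, 2]), (19, []), (1, []), (18, [3, 2]), (12,
      [3]), (11, [3]), (13, [2, 0, 2, 2]), (25, []), (3, []), (16, [0]), (27, []), (10, [3,
      2]), (8, []), (20, [0]), (29, []), (22, [2, 0, 2, 2]), (23, [2, 0, 2, 2]), (24, [2, 0, 2,
      2]), (14, []), (26, [0]), (17, []), (34, []), (21, []), (35, []), (36, []), (32, [2, 0,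
      2, 2]), (33, [2, 0, 2, 2]), (28, []), (30, []), (31, []), (38, []), (37, []), (39, [1])],
      [(5, []), (10, []), (9, [2]), (16, []), (12, [2, 2]), (0, []), (18, []), (11, [2, 3]),
      (20, []), (2, [2, 2]), (1, []), (7, [2, 3]), (4, [2]), (21, [2]), (26, []), (15, [0]),
      (3, []), (22, [2, 2]), (6, []), (19, [0]), (8, []), (13, [2, 2]), (17, [2]), (30, [2]),
      (31, [2]), (25, [0]), (14, []), (27, [0]), (32, [2, 2]), (29, [0]), (23, [2, 2]), (24,
      [2, 2]), (28, [2]), (37, [2]), (34, [0]), (35, [0]), (36, [0]), (33, [2, 2]), (38, [0]),
      (39, [0])], [(6, []), (11, []), (4, [3]), (3, [2, 1, 2, 2]), (2, [3]), (18, []), (0, []),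
      (10, [2, 3]), (8, [2, 1, 2, 2]), (12, [3]), (7, [2, 3]), (1, []), (9, [3]), (24, []),
      (14, [2, 1, 2, 2]), (15, [2, 1, 2, 2]), (16, [2, 1, 2, 2]), (28, []), (5, []), (19, [2,
      1, 2, 2]), (20, [2, 1, 2, 2]), (31, []), (32, []), (33, []), (13, []), (25, [2, 1, 2,
      2]), (26, [2, 1, 2, 2]), (34, []), (17, []), (36, []), (37, []), (21, []), (22, []), (23,
      []), (27, []), (38, []), (29, []), (30, []), (35, []), (39, [3, 1, 3])]]"

definition act_sextuple :: "nat list \<Rightarrow> lattice sextuple" where
  "act_sextuple u = map_sextuple (foldr reflect u) param_sextuple"

lemma symmetry_word:
  "\<forall>n\<in>set [0, 1, 2, 3]. act_sextuple (symmetry_word n) = symmetry n param_sextuple \<and>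
     set (symmetry_word n) \<subseteq> set indices"
  by code_simp

text \<open>
  The simple reflections permute the subsystems: entry \<open>j\<close> of row \<open>i\<close> of the table contains the
  number of the \<open>i\<close>-th reflection of the \<open>j\<close>-th subsystem and the symmetries relating the bases.
\<close>

lemma subsystem_table:
  "\<forall>(i, row)\<in>set (zip indices subsystem_table).
     list_all2 (\<lambda>u (k, g). act_sextuple (i # u) = foldr symmetry g (act_sextuple (subsystem_words ! k)) \<and>
       set g \<subseteq> {0, 1, 2, 3})
     subsystem_words row \<and> mset (map fst row) = mset [0..<40]"
  by code_simp

lemma subsystem_words: "\<forall>u\<in>set subsystem_words. set u \<subseteq> set indices" "length subsystem_words = 40"
  by code_simp+

lemma lattice_vec_add: "lattice_vec (s + t) = lattice_vec s + lattice_vec t"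
  by (cases s; cases t) (simp add: lattice_vec_def algebra_simps)

lemma lattice_vec_minus: "lattice_vec (- s) = - lattice_vec s"
  by (cases s) (simp add: lattice_vec_def algebra_simps)

abbreviation lattice_values :: "(real ^ 6 \<Rightarrow> complex) \<Rightarrow> lattice sextuple \<Rightarrow> complex sextuple" where
  "lattice_values v \<equiv> map_sextuple (\<lambda>x. v (lattice_vec x))"

lemma lattice_values_symmetry:
  "linear v \<Longrightarrow> lattice_values v (symmetry n t) = symmetry n (lattice_values v t)"
  by (cases t) (auto simp: lattice_vec_add lattice_vec_minus linear_add linear_neg)

lemma lattice_values_act_sextuple:
  "set u \<subseteq> set indices \<Longrightarrow>
     lattice_values v (act_sextuple u) = lattice_values (v \<circ> weyl_word (map of_nat u)) param_sextuple"
  by (simp add: act_sextuple_def param_sextuple_def foldr_reflect)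

definition symmetric_form :: "(complex sextuple \<Rightarrow> complex) \<Rightarrow> bool" where
  "symmetric_form P \<longleftrightarrow> (\<forall>n\<in>{0, 1, 2, 3}. \<forall>t. P (symmetry n t) = P t)"

lemma symmetric_formD: "symmetric_form P \<Longrightarrow> n \<in> {0, 1, 2, 3} \<Longrightarrow> P (symmetry n t) = P t"
  unfolding symmetric_form_def by blast

definition subsystem_sum :: "(complex sextuple \<Rightarrow> complex) \<Rightarrow> (real ^ 6 \<Rightarrow> complex) \<Rightarrow> complex" where
  "subsystem_sum P v = (\<Sum>u\<leftarrow>subsystem_words. P (lattice_values v (act_sextuple u)))"

definition weyl_sum :: "(real ^ 6 \<Rightarrow> complex) \<Rightarrow> (complex sextuple \<Rightarrow> complex) \<Rightarrow> complex" where
  "weyl_sum v P = (\<Sum>s\<in>weyl_group. P (lattice_values (v \<circ> s) param_sextuple))"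

lemma weyl_sum_symmetry:
  assumes "linear v" "n \<in> {0, 1, 2, 3}"
  shows "weyl_sum v (\<lambda>t. P (symmetry n t)) = weyl_sum v P"
proof -
  have n: "act_sextuple (symmetry_word n) = symmetry n param_sextuple" "set (symmetry_word n) \<subseteq> set indices"
    using symmetry_word assms(2) by auto
  let ?w = "weyl_word (map of_nat (symmetry_word n))"
  have "symmetry n (lattice_values (v \<circ> s) param_sextuple) = lattice_values (v \<circ> (s \<circ> ?w)) param_sextuple"
    if "s \<in> weyl_group" for s
  proof -
    have "linear (v \<circ> s)" using assms(1) linear_weyl_group[OF that] by (rule linear_compose[rotated])
    then have "symmetry n (lattice_values (v \<circ> s) param_sextuple) = lattice_values (v \<circ> s) (act_sextuple (symmetry_word n))"
      by (simp only: n(1) lattice_values_symmetry)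
    then show ?thesis
      using lattice_values_act_sextuple[OF n(2), of "v \<circ> s"] by (simp only: o_apply)
  qed
  then have "weyl_sum v (\<lambda>t. P (symmetry n t)) = (\<Sum>s\<in>weyl_group. P (lattice_values (v \<circ> (s \<circ> ?w)) param_sextuple))"
    by (simp add: weyl_sum_def)
  also have "\<dots> = weyl_sum v P"
    unfolding weyl_sum_def
    by (rule sum_weyl_group_translate(1)) (simp add: weyl_group_def)
  finally show ?thesis .
qed

lemma sum_list_mset_eq:
  fixes f :: "'b \<Rightarrow> 'a :: comm_monoid_add"
  assumes "mset xs = mset ys"
  shows "(\<Sum>x\<leftarrow>xs. f x) = (\<Sum>y\<leftarrow>ys. f y)"
  using arg_cong[OF assms, of "\<lambda>M. sum_mset (image_mset f M)"]
  by (simp only: sum_mset_sum_list flip: mset_map)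

lemma list_all2_map_eq:
  assumes "list_all2 R xs ys" "\<And>x y. R x y \<Longrightarrow> f x = g (fst y)"
  shows "map f xs = map g (map fst ys)"
  using assms(1) by (induction xs ys rule: list_all2_induct) (auto simp: assms(2))

text \<open>The first components of each table row are a permutation of the 40 numbers, so the
  reflection permutes the summands; the symmetries that relate the bases do not affect
  \<open>P\<close>.\<close>

lemma subsystem_sum_simple_reflection:
  assumes "linear v" "symmetric_form P"
  shows "subsystem_sum P (v \<circ> simple_reflection i) = subsystem_sum P v"
proof -
  obtain k where k: "k < 6" "i = of_nat (indices ! k)"
  proof -
    have "i \<in> of_nat ` set indices" using exhaust_6[of i] by (auto simp: indices_def)
    moreover have "length indices = 6" by (simp add: indices_def)
    ultimately show ?thesis using that by (metis imageE in_set_conv_nth)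
  qed
  define row where "row = subsystem_table ! k"
  have "length subsystem_table = 6" by (simp add: subsystem_table_def)
  then have "(indices ! k, row) \<in> set (zip indices subsystem_table)"
    using k(1) by (auto simp: in_set_conv_nth row_def indices_def intro!: exI[of _ k])
  with subsystem_table have row: "list_all2 (\<lambda>u (l, g). act_sextuple (indices ! k # u) = foldr symmetry g (act_sextuple (subsystem_words ! l)) \<and>
       set g \<subseteq> {0, 1, 2, 3}) subsystem_words row" "mset (map fst row) = mset [0..<40]"
    by auto
  let ?f = "\<lambda>u. P (lattice_values v (act_sextuple u))"
  have inv: "P (lattice_values v (foldr symmetry g t)) = P (lattice_values v t)"
    if "set g \<subseteq> {0, 1, 2, 3}" for g t
    using that
  proof (induction g)
    case (Cons n g)
    then have "n \<in> {0, 1, 2, 3}" by simp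
    with Cons symmetric_formD[OF assms(2)] show ?case by (simp del: symmetry.simps add: lattice_values_symmetry[OF assms(1)])
  qed simp
  have ik: "indices ! k \<in> set indices" using k(1) by (intro nth_mem) (simp add: indices_def)
  have "P (lattice_values (v \<circ> simple_reflection i) (act_sextuple u)) = ?f (indices ! k # u)"
    if "u \<in> set subsystem_words" for u
    using that subsystem_words(1) k(2) ik lattice_values_act_sextuple[of u "v \<circ> simple_reflection i"]
      lattice_values_act_sextuple[of "indices ! k # u" v]
    by (simp add: weyl_word_Cons o_def)
  then have "subsystem_sum P (v \<circ> simple_reflection i) = (\<Sum>u\<leftarrow>subsystem_words. ?f (indices ! k # u))"
    unfolding subsystem_sum_def by (intro arg_cong[of _ _ sum_list] map_cong) auto
  also have "map (\<lambda>u. ?f (indices ! k # u)) subsystem_words = map (\<lambda>l. ?f (subsystem_words ! l)) (map fst row)"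
    using row(1) by (rule list_all2_map_eq) (auto simp: inv)
  also have "sum_list \<dots> = sum_list (map (\<lambda>l. ?f (subsystem_words ! l)) [0..<40])"
    using row(2) by (rule sum_list_mset_eq)
  also have "map (\<lambda>l. ?f (subsystem_words ! l)) [0..<40] = map ?f subsystem_words"
    using map_nth[of subsystem_words] by (metis (no_types, lifting) map_map comp_apply subsystem_words(2) map_cong)
  finally show ?thesis by (simp add: subsystem_sum_def)
qed

lemma subsystem_sum_weyl:
  assumes "linear v" "symmetric_form P" "s \<in> weyl_group"
  shows "subsystem_sum P (v \<circ> s) = subsystem_sum P v"
proof -
  obtain u where "s = weyl_word u" using assms(3) by (auto simp: weyl_group_def)
  moreover have "subsystem_sum P (v \<circ> weyl_word u) = subsystem_sum P v"
    using assms(1)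
  proof (induction u arbitrary: v)
    case (Cons i u)
    have "linear (v \<circ> simple_reflection i)"
      using linear_simple_reflection Cons.prems by (rule linear_compose)
    from Cons.IH[OF this] show ?case
      unfolding weyl_word_Cons o_assoc subsystem_sum_simple_reflection[OF Cons.prems assms(2)] .
  qed simp
  ultimately show ?thesis by simp
qed

lemma sum_sum_list_swap:
  "(\<Sum>s\<in>S. \<Sum>u\<leftarrow>us. f s u) = (\<Sum>u\<leftarrow>us. \<Sum>s\<in>S. f s u :: 'a :: comm_monoid_add)"
  by (induction us) (simp_all add: sum.distrib)

text \<open>The invariant sum is averaged over the group. After exchanging the summations, each of
  the 40 terms runs through a translate of the group and contributes one full
  \<open>weyl_sum\<close>.\<close>

lemma subsystem_sum_eq_weyl_sum:
  assumes "linear v" "symmetric_form P"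
  shows "51840 * subsystem_sum P v = 40 * weyl_sum v P"
proof -
  have "51840 * subsystem_sum P v = (\<Sum>s\<in>weyl_group. subsystem_sum P (v \<circ> s))"
    using subsystem_sum_weyl[OF assms] by (simp add: card_weyl_group)
  also have "\<dots> = (\<Sum>u\<leftarrow>subsystem_words. \<Sum>s\<in>weyl_group. P (lattice_values (v \<circ> s) (act_sextuple u)))"
    unfolding subsystem_sum_def by (rule sum_sum_list_swap)
  also have "\<dots> = (\<Sum>u\<leftarrow>subsystem_words. weyl_sum v P)"
  proof (intro arg_cong[of _ _ sum_list] map_cong refl)
    fix u assume "u \<in> set subsystem_words"
    then have "(\<Sum>s\<in>weyl_group. P (lattice_values (v \<circ> s) (act_sextuple u))) =
        (\<Sum>s\<in>weyl_group. P (lattice_values (v \<circ> (s \<circ> weyl_word (map of_nat u))) param_sextuple))"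
      using subsystem_words(1) lattice_values_act_sextuple[of u "v \<circ> s" for s]
      by (intro sum.cong) (simp_all add: o_def)
    also have "\<dots> = weyl_sum v P"
      unfolding weyl_sum_def by (rule sum_weyl_group_translate(1)) (simp add: weyl_group_def)
    finally show "(\<Sum>s\<in>weyl_group. P (lattice_values (v \<circ> s) (act_sextuple u))) = weyl_sum v P" .
  qed
  also have "\<dots> = 40 * weyl_sum v P"
    by (simp add: sum_list_triv subsystem_words(2))
  finally show ?thesis .
qed

subsection \<open>The polynomials \<open>p\<^sub>k\<close> as sums over the subsystems\<close>

text \<open>The basic invariants of the Weyl group of type \<open>A\<^sub>2\<close> with simple roots \<open>a\<close> and \<open>b\<close>.\<close>

definition quad :: "'a :: comm_ring_1 \<Rightarrow> 'a \<Rightarrow> 'a" where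
  "quad a b = a ^ 2 + a * b + b ^ 2"

definition cub :: "'a :: comm_ring_1 \<Rightarrow> 'a \<Rightarrow> 'a" where
  "cub a b = (a - b) * (2 * a + b) * (a + 2 * b)"

lemma quad_symmetry: "quad (- a) (a + b) = quad a b" "quad (a + b) (- b) = quad a b" "quad b a = quad a b"
  by (simp_all add: quad_def power2_eq_square algebra_simps)

lemma cub_symmetry: "cub (- a) (a + b) = cub a b" "cub (a + b) (- b) = cub a b" "cub b a = - cub a b"
  by (simp_all add: cub_def algebra_simps)

text \<open>Up to constants, these are the averages over the stabilizer of the monomials that define
  the \<open>p_k\<close>. Symmetry 3 negates every \<open>cub\<close> while transposing two factors;
  the forms of degree 5 and 9, being odd in \<open>cub\<close>, must therefore alternate under
  transpositions of the factors, whereas the others are symmetric.\<close>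

definition form_2 :: "complex sextuple \<Rightarrow> complex" where
  "form_2 = (\<lambda>(a, b, c, d, e, f). quad a b + quad c d + quad e f)"

definition form_5 :: "complex sextuple \<Rightarrow> complex" where
  "form_5 = (\<lambda>(a, b, c, d, e, f). cub a b * (quad e f - quad c d) + cub c d * (quad a b - quad e f)
     + cub e f * (quad c d - quad a b))"

definition form_6 :: "complex sextuple \<Rightarrow> complex" where
  "form_6 = (\<lambda>(a, b, c, d, e, f). quad a b * quad c d * quad e f)"

definition form_8 :: "complex sextuple \<Rightarrow> complex" where
  "form_8 = (\<lambda>(a, b, c, d, e, f). cub a b * cub c d * quad e f + cub c d * cub e f * quad a b
     + cub e f * cub a b * quad c d)"

definition form_9 :: "complex sextuple \<Rightarrow> complex" where
  "form_9 = (\<lambda>(a, b, c, d, e, f). quad a b ^ 2 * (cub c d * quad e f - cub e f * quad c d)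
     + quad c d ^ 2 * (cub e f * quad a b - cub a b * quad e f)
     + quad e f ^ 2 * (cub a b * quad c d - cub c d * quad a b))"

definition form_12 :: "complex sextuple \<Rightarrow> complex" where
  "form_12 = (\<lambda>(a, b, c, d, e, f). (quad a b * quad c d * quad e f) ^ 2)"

lemmas form_defs = form_2_def form_5_def form_6_def form_8_def form_9_def form_12_def

lemma symmetric_forms:
  "symmetric_form form_2" "symmetric_form form_5" "symmetric_form form_6"
  "symmetric_form form_8" "symmetric_form form_9" "symmetric_form form_12"
proof -
  have *: "P (- a, a + b, c, d, e, f) = P (a, b, c, d, e, f)"
    "P (a + b, - b, c, d, e, f) = P (a, b, c, d, e, f)"
    "P (c, d, e, f, a, b) = P (a, b, c, d, e, f)" "P (d, c, b, a, f, e) = P (a, b, c, d, e, f)"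
    if "P \<in> {form_2, form_5, form_6, form_8, form_9, form_12}" for P a b c d e f
    using that
    by (auto simp: form_defs quad_symmetry(1,2) cub_symmetry(1,2) quad_symmetry(3)[of c d]
        quad_symmetry(3)[of a b] quad_symmetry(3)[of e f] cub_symmetry(3)[of c d] cub_symmetry(3)[of a b]
        cub_symmetry(3)[of e f] algebra_simps)
  have "symmetric_form P" if "P \<in> {form_2, form_5, form_6, form_8, form_9, form_12}" for P
    unfolding symmetric_form_def
  proof (intro ballI allI)
    fix n and t :: "complex sextuple"
    assume n: "n \<in> {0, 1, 2, 3 :: nat}"
    obtain a b c d e f where t: "t = (a, b, c, d, e, f)" by (cases t)
    show "P (symmetry n t) = P t"
      using n *[OF that, where a = a and b = b and c = c and d = d and e = e and f = f] by (auto simp: t)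
  qed
  then show "symmetric_form form_2" "symmetric_form form_5" "symmetric_form form_6"
    "symmetric_form form_8" "symmetric_form form_9" "symmetric_form form_12" by auto
qed

section \<open>Averaging monomials over the stabilizer of the subsystem\<close>

context
  fixes v :: "real ^ 6 \<Rightarrow> complex"
  assumes v: "linear v"
begin

definition param_sum ::
    "(complex \<Rightarrow> complex \<Rightarrow> complex \<Rightarrow> complex \<Rightarrow> complex \<Rightarrow> complex \<Rightarrow> complex) \<Rightarrow> complex" where
  "param_sum P = weyl_sum v (\<lambda>(a, b, c, d, e, f). P a b c d e f)"

lemma param_sum_linear:
  "param_sum (\<lambda>a b c d e f. P a b c d e f + R a b c d e f) = param_sum P + param_sum R"
  "param_sum (\<lambda>a b c d e f. P a b c d e f - R a b c d e f) = param_sum P - param_sum R"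
  "param_sum (\<lambda>a b c d e f. - P a b c d e f) = - param_sum P"
  "param_sum (\<lambda>a b c d e f. z * P a b c d e f) = z * param_sum P"
  by (simp_all add: param_sum_def weyl_sum_def case_prod_beta sum.distrib sum_subtractf sum_negf sum_distrib_left)

lemma param_sum_symmetry:
  "param_sum (\<lambda>a b. P (- a) (a + b)) = param_sum P"
  "param_sum (\<lambda>a b. P (a + b) (- b)) = param_sum P"
  "param_sum (\<lambda>a b c d e f. P c d e f a b) = param_sum P"
  "param_sum (\<lambda>a b c d e f. P d c b a f e) = param_sum P"
proof -
  let ?P = "\<lambda>(a, b, c, d, e, f). P a b c d e f"
  have "(\<lambda>t. ?P (symmetry 0 t)) = (\<lambda>(a, b, c, d, e, f). P (- a) (a + b) c d e f)"
    "(\<lambda>t. ?P (symmetry 1 t)) = (\<lambda>(a, b, c, d, e, f). P (a + b) (- b) c d e f)"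
    "(\<lambda>t. ?P (symmetry 2 t)) = (\<lambda>(a, b, c, d, e, f). P c d e f a b)"
    "(\<lambda>t. ?P (symmetry 3 t)) = (\<lambda>(a, b, c, d, e, f). P d c b a f e)"
    by (auto simp: fun_eq_iff)
  then show "param_sum (\<lambda>a b. P (- a) (a + b)) = param_sum P"
    "param_sum (\<lambda>a b. P (a + b) (- b)) = param_sum P"
    "param_sum (\<lambda>a b c d e f. P c d e f a b) = param_sum P"
    "param_sum (\<lambda>a b c d e f. P d c b a f e) = param_sum P"
    using weyl_sum_symmetry[OF v, of 0 ?P] weyl_sum_symmetry[OF v, of 1 ?P]
      weyl_sum_symmetry[OF v, of 2 ?P] weyl_sum_symmetry[OF v, of 3 ?P]
    unfolding param_sum_def by simp_all
qed

text \<open>The six pairs form the orbit of \<open>(a, b)\<close> under the Weyl group of the first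
  A2, all of whose elements are products of symmetries 0 and 1.\<close>

lemma param_sum_first_pair:
  "6 * param_sum P = param_sum (\<lambda>a b c d e f. P a b c d e f + P (- a) (a + b) c d e f
     + P (a + b) (- b) c d e f + P b (- a - b) c d e f + P (- a - b) a c d e f + P (- b) (- a) c d e f)"
proof -
  note s = param_sum_symmetry
  have "param_sum (\<lambda>a b. P b (- a - b)) = param_sum P"
    using s(1)[of "\<lambda>a b. P (a + b) (- b)"] s(2)[of P] by simp
  moreover have "param_sum (\<lambda>a b. P (- a - b) a) = param_sum P"
    using s(2)[of "\<lambda>a b. P (- a) (a + b)"] s(1)[of P] by simp
  moreover have "param_sum (\<lambda>a b. P (- b) (- a)) = param_sum P"
    using s(2)[of "\<lambda>a b. P b (- a - b)"] calculation(1) by simp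
  ultimately show ?thesis
    using s(1,2)[of P] by (simp add: param_sum_linear)
qed

text \<open>Averaging over this orbit sends \<open>a^2\<close>, \<open>a * b\<close>,
  \<open>a^2 * b\<close> and \<open>(a * b)^2\<close> to \<open>2/3 quad\<close>,
  \<open>- 1/3 quad\<close>, \<open>1/6 cub\<close> and \<open>1/3 quad^2\<close>, which explains
  the constants.\<close>

lemma param_sum_monomials:
  "6 * param_sum (\<lambda>a b c d e f. a ^ 2 * R c d e f) = 4 * param_sum (\<lambda>a b c d e f. quad a b * R c d e f)"
  "3 * param_sum (\<lambda>a b c d e f. a * b * R c d e f) = - param_sum (\<lambda>a b c d e f. quad a b * R c d e f)"
  "6 * param_sum (\<lambda>a b c d e f. a ^ 2 * b * R c d e f) = param_sum (\<lambda>a b c d e f. cub a b * R c d e f)"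
  "3 * param_sum (\<lambda>a b c d e f. (a * b) ^ 2 * R c d e f) = param_sum (\<lambda>a b c d e f. quad a b ^ 2 * R c d e f)"
proof -
  have eq: "P = P' \<Longrightarrow> param_sum P = param_sum P'" for P P' by simp
  have "6 * param_sum (\<lambda>a b c d e f. a ^ 2 * R c d e f) = param_sum (\<lambda>a b c d e f. 4 * (quad a b * R c d e f))"
    unfolding param_sum_first_pair
    by (rule eq) (simp add: fun_eq_iff quad_def power2_eq_square algebra_simps)
  then show "6 * param_sum (\<lambda>a b c d e f. a ^ 2 * R c d e f) = 4 * param_sum (\<lambda>a b c d e f. quad a b * R c d e f)"
    by (simp add: param_sum_linear)
  have "6 * param_sum (\<lambda>a b c d e f. a * b * R c d e f) = param_sum (\<lambda>a b c d e f. - 2 * (quad a b * R c d e f))"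
    unfolding param_sum_first_pair
    by (rule eq) (simp add: fun_eq_iff quad_def power2_eq_square algebra_simps)
  then show "3 * param_sum (\<lambda>a b c d e f. a * b * R c d e f) = - param_sum (\<lambda>a b c d e f. quad a b * R c d e f)"
    unfolding param_sum_linear(4) by simp
  show "6 * param_sum (\<lambda>a b c d e f. a ^ 2 * b * R c d e f) = param_sum (\<lambda>a b c d e f. cub a b * R c d e f)"
    unfolding param_sum_first_pair
    by (rule eq) (simp add: fun_eq_iff cub_def power2_eq_square algebra_simps)
  have "6 * param_sum (\<lambda>a b c d e f. (a * b) ^ 2 * R c d e f) = param_sum (\<lambda>a b c d e f. 2 * (quad a b ^ 2 * R c d e f))"
    unfolding param_sum_first_pair
    by (rule eq) (simp add: fun_eq_iff quad_def power2_eq_square algebra_simps)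
  then show "3 * param_sum (\<lambda>a b c d e f. (a * b) ^ 2 * R c d e f) = param_sum (\<lambda>a b c d e f. quad a b ^ 2 * R c d e f)"
    by (simp add: param_sum_linear)
qed

text \<open>Averaging over the first factor, followed by a cyclic shift of the three factors.\<close>

lemma param_sum_average:
  "3 * param_sum (\<lambda>a b c d e f. a * b * R c d e f) = - param_sum (\<lambda>a b c d e f. R a b c d * quad e f)"
  "6 * param_sum (\<lambda>a b c d e f. a ^ 2 * b * R c d e f) = param_sum (\<lambda>a b c d e f. R a b c d * cub e f)"
  "3 * param_sum (\<lambda>a b c d e f. (a * b) ^ 2 * R c d e f) = param_sum (\<lambda>a b c d e f. R a b c d * quad e f ^ 2)"
  unfolding param_sum_monomials
  using param_sum_symmetry(3)[of "\<lambda>a b c d e f. R a b c d * quad e f"]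
    param_sum_symmetry(3)[of "\<lambda>a b c d e f. R a b c d * cub e f"]
    param_sum_symmetry(3)[of "\<lambda>a b c d e f. R a b c d * quad e f ^ 2"]
  by (simp_all add: mult.commute)

definition invariant_sum ::
    "(complex \<Rightarrow> complex \<Rightarrow> complex \<Rightarrow> complex \<Rightarrow> complex \<Rightarrow> complex \<Rightarrow> complex) \<Rightarrow> complex" where
  "invariant_sum R =
     param_sum (\<lambda>a b c d e f. R (quad a b) (quad c d) (quad e f) (cub a b) (cub c d) (cub e f))"

lemma invariant_sum_linear:
  "invariant_sum (\<lambda>q q' q'' k k' k''. P q q' q'' k k' k'' + R q q' q'' k k' k'') = invariant_sum P + invariant_sum R"
  "invariant_sum (\<lambda>q q' q'' k k' k''. P q q' q'' k k' k'' - R q q' q'' k k' k'') = invariant_sum P - invariant_sum R"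
  "invariant_sum (\<lambda>q q' q'' k k' k''. - P q q' q'' k k' k'') = - invariant_sum P"
  by (simp_all add: invariant_sum_def param_sum_linear)

lemma invariant_sum_symmetry:
  "invariant_sum (\<lambda>q q' q'' k k' k''. R q' q'' q k' k'' k) = invariant_sum R"
  "invariant_sum (\<lambda>q q' q'' k k' k''. R q' q q'' (- k') (- k) (- k'')) = invariant_sum R"
proof -
  show "invariant_sum (\<lambda>q q' q'' k k' k''. R q' q'' q k' k'' k) = invariant_sum R"
    unfolding invariant_sum_def by (rule param_sum_symmetry(3))
  have "(\<lambda>a b c d e f :: complex. R (quad c d) (quad a b) (quad e f) (- cub c d) (- cub a b) (- cub e f)) =
      (\<lambda>a b c d e f. R (quad d c) (quad b a) (quad f e) (cub d c) (cub b a) (cub f e))"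
  proof (intro ext)
    fix a b c d e f :: complex
    show "R (quad c d) (quad a b) (quad e f) (- cub c d) (- cub a b) (- cub e f) =
        R (quad d c) (quad b a) (quad f e) (cub d c) (cub b a) (cub f e)"
      by (simp only: quad_symmetry(3)[of a b] quad_symmetry(3)[of c d] quad_symmetry(3)[of e f]
          cub_symmetry(3)[of a b] cub_symmetry(3)[of c d] cub_symmetry(3)[of e f] minus_minus)
  qed
  then show "invariant_sum (\<lambda>q q' q'' k k' k''. R q' q q'' (- k') (- k) (- k'')) = invariant_sum R"
    unfolding invariant_sum_def
    using param_sum_symmetry(4)[of "\<lambda>a b c d e f. R (quad a b) (quad c d) (quad e f) (cub a b) (cub c d) (cub e f)"]
    by simp
qed

text \<open>Symmetry 3 transposes two factors and negates all cubics; for \<open>R\<close> odd in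
  the cubics the signs combine into a single minus. Hence the six terms of \<open>form_5\<close>,
  and likewise of \<open>form_9\<close>, contribute equally.\<close>

lemma invariant_sum_swap:
  assumes "\<And>q q' q'' k k' k''. R q q' q'' (- k) (- k') (- k'') = - R q q' q'' k k' k''"
  shows "invariant_sum (\<lambda>q q' q'' k k' k''. R q' q q'' k' k k'') = - invariant_sum R"
proof -
  have "- invariant_sum (\<lambda>q q' q'' k k' k''. R q' q q'' k' k k'') = invariant_sum R"
    using invariant_sum_symmetry(2)[of R] by (simp add: assms invariant_sum_linear)
  then show ?thesis by (metis minus_minus)
qed

text \<open>The constant here and in the next five lemmas is the number of terms of the form that
  contribute equally, times one factor 3/2, -3, 6 or 3 for each averaged pair; in degree 5, for
  instance, (-6) * (-3) * 6 = 108. The product \<open>f * e\<close> reflects the order of the last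
  pair, in which the parameter \<open>M2''\<close> precedes \<open>M1''\<close>.\<close>

lemma weyl_sum_form_2: "weyl_sum v form_2 = 9 / 2 * param_sum (\<lambda>a b c d e f. a ^ 2)"
proof -
  have "weyl_sum v form_2 = invariant_sum (\<lambda>q q' q'' k k' k''. q + q' + q'')"
    by (simp add: invariant_sum_def param_sum_def form_2_def)
  also have "\<dots> = 3 * invariant_sum (\<lambda>q q' q'' k k' k''. q)"
    using invariant_sum_symmetry(1)[of "\<lambda>q q' q'' k k' k''. q"] invariant_sum_symmetry(1)[of "\<lambda>q q' q'' k k' k''. q'"]
    by (simp add: invariant_sum_linear)
  finally show ?thesis
    using param_sum_monomials(1)[of "\<lambda>_ _ _ _. 1"] by (simp add: invariant_sum_def)
qed

lemma weyl_sum_form_5: "weyl_sum v form_5 = 108 * param_sum (\<lambda>a b c d e f. c ^ 2 * d * f * e)"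
proof -
  let ?x = "invariant_sum (\<lambda>q q' q'' k k' k''. q * k'')"
  have "weyl_sum v form_5 = invariant_sum (\<lambda>q q' q'' k k' k''. q'' * k - q' * k + q * k' - q'' * k' + q' * k'' - q * k'')"
    by (simp add: invariant_sum_def param_sum_def form_5_def algebra_simps)
  also have "\<dots> = - 6 * ?x"
    using invariant_sum_symmetry(1)[of "\<lambda>q q' q'' k k' k''. q * k''"]
      invariant_sum_symmetry(1)[of "\<lambda>q q' q'' k k' k''. q' * k"]
      invariant_sum_swap[of "\<lambda>q q' q'' k k' k''. q * k''"]
      invariant_sum_swap[of "\<lambda>q q' q'' k k' k''. q' * k"]
      invariant_sum_swap[of "\<lambda>q q' q'' k k' k''. q'' * k'"]
    by (simp add: invariant_sum_linear)
  also have "?x = param_sum (\<lambda>a b c d e f. cub c d * quad e f)"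
    using param_sum_symmetry(3)[of "\<lambda>a b c d e f. cub c d * quad e f"]
    by (simp add: invariant_sum_def mult_ac)
  finally have "weyl_sum v form_5 = - 6 * param_sum (\<lambda>a b c d e f. cub c d * quad e f)" .
  moreover have "param_sum (\<lambda>a b c d e f. cub c d * quad e f) = - 3 * param_sum (\<lambda>a b c d e f. a * b * cub e f)"
    using param_sum_average(1)[of "\<lambda>c d e f. cub e f"] by simp
  moreover have "param_sum (\<lambda>a b c d e f. a * b * cub e f) = 6 * param_sum (\<lambda>a b c d e f. a ^ 2 * b * (c * d))"
    using param_sum_average(2)[of "\<lambda>c d e f. c * d"] by simp
  moreover have "param_sum (\<lambda>a b c d e f. c ^ 2 * d * f * e) = param_sum (\<lambda>a b c d e f. a ^ 2 * b * (c * d))"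
    using param_sum_symmetry(3)[of "\<lambda>a b c d e f. a ^ 2 * b * (c * d)"] by (simp add: mult_ac)
  ultimately show ?thesis by simp
qed

lemma weyl_sum_form_6: "weyl_sum v form_6 = - 27 * param_sum (\<lambda>a b c d e f. a * b * c * d * f * e)"
proof -
  have "weyl_sum v form_6 = param_sum (\<lambda>a b c d e f. quad a b * (quad c d * quad e f))"
    by (simp add: param_sum_def form_6_def mult_ac)
  moreover have "param_sum (\<lambda>a b c d e f. a * b * (c * d * quad e f)) = - 3 * param_sum (\<lambda>a b c d e f. a * b * c * d * f * e)"
    using param_sum_average(1)[of "\<lambda>c d e f. c * d * (e * f)"] by (simp add: mult_ac)
  moreover have "param_sum (\<lambda>a b c d e f. a * b * (quad c d * quad e f)) = - 3 * param_sum (\<lambda>a b c d e f. a * b * (c * d * quad e f))"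
    using param_sum_average(1)[of "\<lambda>c d e f. c * d * quad e f"] by (simp add: mult_ac)
  moreover have "param_sum (\<lambda>a b c d e f. quad a b * (quad c d * quad e f)) = - 3 * param_sum (\<lambda>a b c d e f. a * b * (quad c d * quad e f))"
    using param_sum_average(1)[of "\<lambda>c d e f. quad c d * quad e f"] by (simp add: mult_ac)
  ultimately show ?thesis by simp
qed

lemma weyl_sum_form_8: "weyl_sum v form_8 = - 324 * param_sum (\<lambda>a b c d e f. a ^ 2 * b * c ^ 2 * d * f * e)"
proof -
  let ?x = "invariant_sum (\<lambda>q q' q'' k k' k''. k * k' * q'')"
  have "weyl_sum v form_8 = invariant_sum (\<lambda>q q' q'' k k' k''. k * k' * q'' + k' * k'' * q + k'' * k * q')"
    by (simp add: invariant_sum_def param_sum_def form_8_def)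
  also have "\<dots> = 3 * ?x"
    using invariant_sum_symmetry(1)[of "\<lambda>q q' q'' k k' k''. k * k' * q''"]
      invariant_sum_symmetry(1)[of "\<lambda>q q' q'' k k' k''. k' * k'' * q"]
    by (simp add: invariant_sum_linear)
  finally have "weyl_sum v form_8 = 3 * param_sum (\<lambda>a b c d e f. cub a b * (cub c d * quad e f))"
    by (simp add: invariant_sum_def mult_ac)
  moreover have "param_sum (\<lambda>a b c d e f. a ^ 2 * b * (c * d * cub e f)) = 6 * param_sum (\<lambda>a b c d e f. a ^ 2 * b * c ^ 2 * d * f * e)"
    using param_sum_average(2)[of "\<lambda>c d e f. c ^ 2 * d * (e * f)"] by (simp add: mult_ac)
  moreover have "param_sum (\<lambda>a b c d e f. a * b * (cub c d * cub e f)) = 6 * param_sum (\<lambda>a b c d e f. a ^ 2 * b * (c * d * cub e f))"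
    using param_sum_average(2)[of "\<lambda>c d e f. c * d * cub e f"] by (simp add: mult_ac)
  moreover have "param_sum (\<lambda>a b c d e f. cub a b * (cub c d * quad e f)) = - 3 * param_sum (\<lambda>a b c d e f. a * b * (cub c d * cub e f))"
    using param_sum_average(1)[of "\<lambda>c d e f. cub c d * cub e f"] by (simp add: mult_ac)
  ultimately show ?thesis by simp
qed

lemma weyl_sum_form_9: "weyl_sum v form_9 = - 324 * param_sum (\<lambda>a b c d e f. (a * b * c) ^ 2 * d * f * e)"
proof -
  let ?y = "invariant_sum (\<lambda>q q' q'' k k' k''. q ^ 2 * (k' * q''))"
  have "weyl_sum v form_9 = invariant_sum (\<lambda>q q' q'' k k' k''. q ^ 2 * (k' * q'') - q ^ 2 * (k'' * q')
      + q' ^ 2 * (k'' * q) - q' ^ 2 * (k * q'') + q'' ^ 2 * (k * q') - q'' ^ 2 * (k' * q))"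
    by (simp add: invariant_sum_def param_sum_def form_9_def algebra_simps)
  also have "\<dots> = 6 * ?y"
    using invariant_sum_symmetry(1)[of "\<lambda>q q' q'' k k' k''. q ^ 2 * (k' * q'')"]
      invariant_sum_symmetry(1)[of "\<lambda>q q' q'' k k' k''. q' ^ 2 * (k'' * q)"]
      invariant_sum_swap[of "\<lambda>q q' q'' k k' k''. q ^ 2 * (k' * q'')"]
      invariant_sum_swap[of "\<lambda>q q' q'' k k' k''. q' ^ 2 * (k'' * q)"]
      invariant_sum_swap[of "\<lambda>q q' q'' k k' k''. q'' ^ 2 * (k * q')"]
    by (simp add: invariant_sum_linear)
  finally have "weyl_sum v form_9 = 6 * param_sum (\<lambda>a b c d e f. quad a b ^ 2 * (cub c d * quad e f))"
    by (simp add: invariant_sum_def)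
  also have "param_sum (\<lambda>a b c d e f. quad a b ^ 2 * (cub c d * quad e f)) = param_sum (\<lambda>a b c d e f. quad c d ^ 2 * cub e f * quad a b)"
    using param_sum_symmetry(3)[of "\<lambda>a b c d e f. quad a b ^ 2 * (cub c d * quad e f)"] by (simp add: mult_ac)
  finally have "weyl_sum v form_9 = 6 * param_sum (\<lambda>a b c d e f. quad a b * (quad c d ^ 2 * cub e f))"
    by (simp add: mult_ac)
  moreover have "param_sum (\<lambda>a b c d e f. a ^ 2 * b * (c * d * quad e f ^ 2)) = 3 * param_sum (\<lambda>a b c d e f. (a * b * c) ^ 2 * d * f * e)"
    using param_sum_average(3)[of "\<lambda>c d e f. c ^ 2 * d * (e * f)"] by (simp add: mult_ac power_mult_distrib)
  moreover have "param_sum (\<lambda>a b c d e f. a * b * (quad c d ^ 2 * cub e f)) = 6 * param_sum (\<lambda>a b c d e f. a ^ 2 * b * (c * d * quad e f ^ 2))"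
    using param_sum_average(2)[of "\<lambda>c d e f. c * d * quad e f ^ 2"] by (simp add: mult_ac)
  moreover have "param_sum (\<lambda>a b c d e f. quad a b * (quad c d ^ 2 * cub e f)) = - 3 * param_sum (\<lambda>a b c d e f. a * b * (quad c d ^ 2 * cub e f))"
    using param_sum_monomials(2)[of "\<lambda>c d e f. quad c d ^ 2 * cub e f"] by simp
  ultimately show ?thesis by simp
qed

lemma weyl_sum_form_12: "weyl_sum v form_12 = 27 * param_sum (\<lambda>a b c d e f. (a * b * c * d * f * e) ^ 2)"
proof -
  have "weyl_sum v form_12 = param_sum (\<lambda>a b c d e f. quad a b ^ 2 * (quad c d ^ 2 * quad e f ^ 2))"
    by (simp add: param_sum_def form_12_def mult_ac power_mult_distrib)
  moreover have "param_sum (\<lambda>a b c d e f. (a * b) ^ 2 * ((c * d) ^ 2 * quad e f ^ 2)) = 3 * param_sum (\<lambda>a b c d e f. (a * b * c * d * f * e) ^ 2)"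
    using param_sum_average(3)[of "\<lambda>c d e f. (c * d) ^ 2 * (e * f) ^ 2"] by (simp add: mult_ac power_mult_distrib)
  moreover have "param_sum (\<lambda>a b c d e f. (a * b) ^ 2 * (quad c d ^ 2 * quad e f ^ 2)) = 3 * param_sum (\<lambda>a b c d e f. (a * b) ^ 2 * ((c * d) ^ 2 * quad e f ^ 2))"
    using param_sum_average(3)[of "\<lambda>c d e f. (c * d) ^ 2 * quad e f ^ 2"] by (simp add: mult_ac power_mult_distrib)
  moreover have "param_sum (\<lambda>a b c d e f. quad a b ^ 2 * (quad c d ^ 2 * quad e f ^ 2)) = 3 * param_sum (\<lambda>a b c d e f. (a * b) ^ 2 * (quad c d ^ 2 * quad e f ^ 2))"
    using param_sum_monomials(4)[of "\<lambda>c d e f. quad c d ^ 2 * quad e f ^ 2"] by simp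
  ultimately show ?thesis by simp
qed

end

lemma param_sum_weyl_average:
  "weyl_average (\<lambda>n. P (n M1) (n M2) (n M1') (n M2') (n M2'') (n M1'')) m = param_sum (root_value m) P / 51840"
proof -
  have "lattice_vec (0, 0, 1, 1, 1, 0) = param_root M1" "lattice_vec (1, 1, 1, 1, 0, 1) = param_root M2"
    "lattice_vec (1, 1, 1, 0, 0, 0) = param_root M1'" "lattice_vec (0, 1, 1, 1, 1, 1) = param_root M2'"
    "lattice_vec (0, 1, 1, 1, 0, 0) = param_root M2''" "lattice_vec (0, 0, 1, 0, 0, 1) = param_root M1''"
    by (simp_all add: lattice_vec_def)
  then show ?thesis
    by (simp add: weyl_average_def param_sum_def[OF root_value(1)] weyl_sum_def param_sextuple_def weyl_act_eq)
qed

text \<open>Each constant is that of the corresponding \<open>weyl_sum_form\<close> lemma, times 40,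
  divided by the normalizing factor in the definition of \<open>p_k\<close>; for \<open>p_2\<close>
  it is (9/2) * 40 / (3/2) = 120.\<close>

theorem subsystem_sums:
  "subsystem_sum form_2 (root_value m) = 120 * p_2 m"
  "subsystem_sum form_5 (root_value m) = 1620 * p_5 m"
  "subsystem_sum form_6 (root_value m) = - 108 * p_6 m"
  "subsystem_sum form_8 (root_value m) = - 7776 * p_8 m"
  "subsystem_sum form_9 (root_value m) = - 8748 * p_9 m"
  "subsystem_sum form_12 (root_value m) = 162 * p_12 m"
proof -
  note v = root_value(1)[of m]
  have J: "subsystem_sum P (root_value m) = weyl_sum (root_value m) P / 1296" if "symmetric_form P" for P
    using subsystem_sum_eq_weyl_sum[OF v that] by (simp add: field_simps)
  show "subsystem_sum form_2 (root_value m) = 120 * p_2 m"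
    by (simp only: p_2_def J[OF symmetric_forms(1)] weyl_sum_form_2[OF v]
        param_sum_weyl_average[of "\<lambda>a b c d e f. a ^ 2" m]) simp
  show "subsystem_sum form_5 (root_value m) = 1620 * p_5 m"
    by (simp only: p_5_def J[OF symmetric_forms(2)] weyl_sum_form_5[OF v]
        param_sum_weyl_average[of "\<lambda>a b c d e f. c ^ 2 * d * f * e" m]) simp
  show "subsystem_sum form_6 (root_value m) = - 108 * p_6 m"
    by (simp only: p_6_def J[OF symmetric_forms(3)] weyl_sum_form_6[OF v]
        param_sum_weyl_average[of "\<lambda>a b c d e f. a * b * c * d * f * e" m]) simp
  show "subsystem_sum form_8 (root_value m) = - 7776 * p_8 m"
    by (simp only: p_8_def J[OF symmetric_forms(4)] weyl_sum_form_8[OF v]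
        param_sum_weyl_average[of "\<lambda>a b c d e f. a ^ 2 * b * c ^ 2 * d * f * e" m]) simp
  show "subsystem_sum form_9 (root_value m) = - 8748 * p_9 m"
    by (simp only: p_9_def J[OF symmetric_forms(5)] weyl_sum_form_9[OF v]
        param_sum_weyl_average[of "\<lambda>a b c d e f. (a * b * c) ^ 2 * d * f * e" m]) simp
  show "subsystem_sum form_12 (root_value m) = 162 * p_12 m"
    by (simp only: p_12_def J[OF symmetric_forms(6)] weyl_sum_form_12[OF v]
        param_sum_weyl_average[of "\<lambda>a b c d e f. (a * b * c * d * f * e) ^ 2" m]) simp
qed

section \<open>Symmetric functions of low degree vanishing on the diagonals\<close>

text \<open>Two different pairs \<open>(a, b)\<close> take the same value of
  \<open>a + s * b\<close> for at most one \<open>s\<close>, so only finitely many \<open>s\<close>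
  are excluded. Nonvanishing is the comparison with the pair (0, 0).\<close>

lemma exists_injective_linear_form:
  fixes A B :: "'i \<Rightarrow> complex"
  assumes "finite I" "inj_on (\<lambda>i. (A i, B i)) I" "\<And>i. i \<in> I \<Longrightarrow> (A i, B i) \<noteq> (0, 0)"
  obtains s where "inj_on (\<lambda>i. A i + s * B i) I" "\<And>i. i \<in> I \<Longrightarrow> A i + s * B i \<noteq> 0"
proof -
  have fin: "finite {s :: complex. a + s * b = a' + s * b'}" if "(a, b) \<noteq> (a', b')" for a b a' b' :: complex
  proof (rule finite_subset)
    show "{s. a + s * b = a' + s * b'} \<subseteq> {(a' - a) / (b - b')}"
    proof
      fix s assume "s \<in> {s. a + s * b = a' + s * b'}"
      then have eq: "a + s * b = a' + s * b'" by simp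
      then have "b \<noteq> b'" using that by auto
      moreover have "s * (b - b') = a' - a" using eq by (simp add: algebra_simps)
      ultimately show "s \<in> {(a' - a) / (b - b')}" by (simp add: eq_divide_eq)
    qed
  qed simp
  have "finite (\<Union>i\<in>I. \<Union>j\<in>I - {i}. {s. A i + s * B i = A j + s * B j})"
    using assms(1,2) by (intro finite_UN_I fin) (auto dest: inj_onD)
  moreover have "finite (\<Union>i\<in>I. {s. A i + s * B i = 0 + s * 0})"
    using assms(1,3) by (intro finite_UN_I fin) auto
  ultimately have "finite ((\<Union>i\<in>I. \<Union>j\<in>I - {i}. {s. A i + s * B i = A j + s * B j}) \<union>
      (\<Union>i\<in>I. {s. A i + s * B i = 0 + s * 0}))"
    by simp
  then obtain s where s: "s \<notin> (\<Union>i\<in>I. \<Union>j\<in>I - {i}. {s. A i + s * B i = A j + s * B j}) \<union>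
      (\<Union>i\<in>I. {s. A i + s * B i = 0 + s * 0})"
    using ex_new_if_finite[OF infinite_UNIV_char_0] by blast
  show ?thesis
    by (rule that[of s]) (use s in \<open>auto simp: inj_on_def\<close>)
qed

text \<open>Adjacent transpositions move the two equal coordinates to positions 0 and 1; each of
  them lowers \<open>i + j\<close>.\<close>

lemma zero_if_two_equal:
  fixes F :: "(nat \<Rightarrow> 'a :: zero) \<Rightarrow> 'b :: zero"
  assumes swap: "\<And>x i. Suc i < n \<Longrightarrow> S x \<Longrightarrow> S (x \<circ> Transposition.transpose i (Suc i)) \<and> F (x \<circ> Transposition.transpose i (Suc i)) = F x"
    and diag: "\<And>x. S x \<Longrightarrow> x 0 = x 1 \<Longrightarrow> F x = 0"
    and "S x" "i < j" "j < n" "x i = x j"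
  shows "F x = 0"
  using assms(3-)
proof (induction "i + j" arbitrary: i j x rule: less_induct)
  case less
  consider "i = 0" "j = 1" | "Suc i < j" | "j = Suc i" "0 < i"
    using less.prems by linarith
  then show ?case
  proof cases
    case 1
    then show ?thesis using diag less.prems by simp
  next
    case 2
    let ?y = "x \<circ> Transposition.transpose (j - 1) (Suc (j - 1))"
    have "F ?y = 0"
      using less.prems 2 swap[of "j - 1" x] by (intro less.hyps[of i "j - 1"]) auto
    then show ?thesis using less.prems 2 swap[of "j - 1" x] by simp
  next
    case 3
    let ?y = "x \<circ> Transposition.transpose (i - 1) (Suc (i - 1))"
    have "F ?y = 0"
      using less.prems 3 swap[of "i - 1" x] by (intro less.hyps[of "i - 1" j]) auto
    then show ?thesis using less.prems 3 swap[of "i - 1" x] by simp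
  qed
qed

text \<open>
  The line \<open>x + t d\<close> with \<open>d\<^sub>i = x\<^sub>i\<^sup>2 + s x\<^sub>i\<^sup>3 - c\<close> meets the 15 diagonals \<open>x\<^sub>i = x\<^sub>j\<close> at 15 distinct
  parameters \<open>t\<close> when the \<open>x\<^sub>i\<close> are distinct and \<open>s\<close> is generic.
\<close>

lemma zero_if_zero_on_diagonals:
  fixes F :: "(nat \<Rightarrow> complex) \<Rightarrow> complex"
  assumes swap: "\<And>x i. Suc i < 6 \<Longrightarrow> F (x \<circ> Transposition.transpose i (Suc i)) = F x"
    and diag: "\<And>x. (\<Sum>i<6. x i) = 0 \<Longrightarrow> x 0 = x 1 \<Longrightarrow> F x = 0"
    and polynomial: "\<And>x d. \<exists>p. degree p \<le> 14 \<and> (\<forall>t. F (\<lambda>i. x i + t * d i) = poly p t)"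
    and x: "(\<Sum>i<6. x i) = 0"
  shows "F x = 0"
proof -
  let ?S = "\<lambda>x :: nat \<Rightarrow> complex. (\<Sum>i<6. x i) = 0"
  have S: "?S (y \<circ> Transposition.transpose i (Suc i))" if "Suc i < 6" "?S y" for y i
  proof -
    have "(\<Sum>k<6. (y \<circ> Transposition.transpose i (Suc i)) k) = (\<Sum>k<6. y k)"
      by (rule sum.reindex_bij_witness[of _ "Transposition.transpose i (Suc i)" "Transposition.transpose i (Suc i)"])
        (use that in \<open>auto simp: Transposition.transpose_def\<close>)
    with that show ?thesis by simp
  qed
  have two: "F y = 0" if "?S y" "i < j" "j < 6" "y i = y j" for y i j
  proof (rule zero_if_two_equal[where S = ?S and n = 6 and x = y and i = i and j = j])
    fix x i assume "Suc i < 6" "?S x"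
    then show "?S (x \<circ> Transposition.transpose i (Suc i)) \<and> F (x \<circ> Transposition.transpose i (Suc i)) = F x"
      using S swap by blast
  qed (use that diag in auto)
  show ?thesis
  proof (cases "inj_on x {..<6}")
    case False
    then obtain i j where "i < 6" "j < 6" "i \<noteq> j" "x i = x j" by (auto simp: inj_on_def)
    then show ?thesis using two[of x i j] two[of x j i] x by (cases "i < j") auto
  next
    case True
    then have inj: "i = j" if "x i = x j" "i < 6" "j < 6" for i j using that by (auto dest: inj_onD)
    define I where "I = {(i, j). i < j \<and> j < (6 :: nat)}"
    have I: "I \<subseteq> {..<6} \<times> {..<6}" by (auto simp: I_def)
    then have "finite I" by (rule finite_subset) simp
    \<comment> \<open>\<open>A\<close> and \<open>B\<close> are the difference quotients of the
      square and the cube, so that \<open>d i - d j = (x i - x j) * (A + s * B)\<close> on the line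
      chosen below.\<close>
    define A where "A = (\<lambda>(i, j). x i + x j)"
    define B where "B = (\<lambda>(i, j). x i ^ 2 + x i * x j + x j ^ 2)"
    have AB: "inj_on (\<lambda>P. (A P, B P)) I"
    proof (rule inj_onI, clarify)
      fix i j k l
      assume ij: "(i, j) \<in> I" and kl: "(k, l) \<in> I" and "A (i, j) = A (k, l)" "B (i, j) = B (k, l)"
      then have s: "x i + x j = x k + x l" "x i ^ 2 + x i * x j + x j ^ 2 = x k ^ 2 + x k * x l + x l ^ 2"
        by (auto simp: A_def B_def)
      \<comment> \<open>\<open>A\<close> is the sum of the two coordinates and
        \<open>A^2 - B\<close> is their product, so \<open>(A, B)\<close> determines the unordered
        pair.\<close>
      have "(x i - x k) * (x i - x l) = 0"
        using s by Groebner_Basis.algebra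
      then have "x i = x k \<and> x j = x l \<or> x i = x l \<and> x j = x k"
        using s(1) by auto
      then show "i = k \<and> j = l"
        using inj ij kl by (auto simp: I_def) (metis less_trans nat_neq_iff)+
    qed
    have AB0: "(A P, B P) \<noteq> (0, 0)" if "P \<in> I" for P
    proof
      obtain i j where P: "P = (i, j)" by (cases P)
      assume "(A P, B P) = (0, 0)"
      then have s: "x i + x j = 0" "x i ^ 2 + x i * x j + x j ^ 2 = 0" by (auto simp: A_def B_def P)
      have "x i ^ 2 = 0" using s by Groebner_Basis.algebra
      then have "x i = x j" using s(1) by simp
      then show False using inj[of i j] that by (auto simp: P I_def)
    qed
    obtain s where s: "inj_on (\<lambda>P. A P + s * B P) I" "\<And>P. P \<in> I \<Longrightarrow> A P + s * B P \<noteq> 0"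
      using exists_injective_linear_form[OF \<open>finite I\<close> AB AB0] by blast
    \<comment> \<open>Subtracting this mean value keeps the whole line inside the hyperplane of sum
      zero, where the hypothesis on diagonals applies.\<close>
    define c where "c = (\<Sum>i<6. x i ^ 2 + s * x i ^ 3) / 6"
    define d where "d = (\<lambda>i. x i ^ 2 + s * x i ^ 3 - c)"
    have d: "(\<Sum>i<6. d i) = 0"
      by (simp add: d_def c_def sum_subtractf)
    obtain p where p: "degree p \<le> 14" "\<And>t. F (\<lambda>i. x i + t * d i) = poly p t"
      using polynomial[of x d] by blast
    let ?t = "\<lambda>P. - 1 / (A P + s * B P)"
    have root: "poly p (?t P) = 0" if "P \<in> I" for P
    proof -
      obtain i j where P: "P = (i, j)" by (cases P)
      have "x i + ?t P * d i = x j + ?t P * d j"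
      proof -
        have "d i - d j = (x i - x j) * (A P + s * B P)"
          by (simp add: d_def A_def B_def P power2_eq_square power3_eq_cube algebra_simps)
        then have "?t P * (d i - d j) = x j - x i" using s(2)[OF that] by simp
        then show ?thesis unfolding right_diff_distrib by (simp add: diff_eq_eq add.commute add_diff_eq)
      qed
      moreover have "(\<Sum>k<6. x k + ?t P * d k) = 0"
        using x d by (simp only: sum.distrib sum_distrib_left[symmetric] mult_zero_right add_0_left)
      ultimately have "F (\<lambda>k. x k + ?t P * d k) = 0"
        using that by (intro two[of _ i j]) (auto simp: P I_def)
      then show ?thesis by (simp only: p(2))
    qed
    have "inj_on ?t I"
      using s by (auto simp: inj_on_def field_simps)
    then have "card (?t ` I) = card I" by (rule card_image)
    moreover have I': "I = prod.swap ` (SIGMA j:{..<6}. {..<j})" by (auto simp: I_def image_iff)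
    have "card I = (\<Sum>j<6. j)" unfolding I' by (simp add: card_image)
    moreover have "(\<Sum>j<6. j) = (15 :: nat)" by (simp add: numeral_eq_Suc)
    ultimately have "card (?t ` I) = 15" by simp
    moreover have "card (?t ` I) \<le> degree p" if "p \<noteq> 0"
    proof -
      have "?t ` I \<subseteq> {z. poly p z = 0}" using root by (auto simp del: minus_divide_left)
      then have "card (?t ` I) \<le> card {z. poly p z = 0}"
        by (rule card_mono[OF poly_roots_finite[OF that]])
      then show ?thesis using card_poly_roots_bound[OF that] by simp
    qed
    ultimately have "p = 0" using p(1) by fastforce
    then show ?thesis using p(2)[of 0] by simp
  qed
qed

section \<open>Coordinates adapted to a subsystem of type \<open>A\<^sub>1 \<times> A\<^sub>5\<close>\<close>

text \<open>
  A linear functional is described by half its value \<open>l\<close> at the highest root and by numbers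
  \<open>x\<^sub>0, \<dots>, x\<^sub>5\<close> with sum zero, on which \<open>s\<^sub>5, s\<^sub>4, \<dots>, s\<^sub>1\<close> act as adjacent transpositions.
\<close>

definition functional :: "complex \<Rightarrow> (nat \<Rightarrow> complex) \<Rightarrow> real ^ 6 \<Rightarrow> complex" where
  "functional l x r = of_real (r $ 1) * (x 4 - x 5) + of_real (r $ 2) * (x 3 - x 4)
     + of_real (r $ 3) * (x 2 - x 3) + of_real (r $ 4) * (x 1 - x 2) + of_real (r $ 5) * (x 0 - x 1)
     + of_real (r $ 6) * (l + x 3 + x 4 + x 5)"

lemma linear_functional: "linear (functional l x)"
  by (rule linearI) (simp_all add: functional_def algebra_simps scaleR_conv_of_real[where 'a = complex])

lemma functional_lattice_vec:
  "functional l x (lattice_vec (a, b, c, d, e, f)) = of_int a * (x 4 - x 5) + of_int b * (x 3 - x 4)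
     + of_int c * (x 2 - x 3) + of_int d * (x 1 - x 2) + of_int e * (x 0 - x 1)
     + of_int f * (l + x 3 + x 4 + x 5)"
  by (simp add: functional_def lattice_vec_nth)

lemma functional_simple_root:
  "functional l x (\<alpha> 1) = x 4 - x 5" "functional l x (\<alpha> 2) = x 3 - x 4"
  "functional l x (\<alpha> 3) = x 2 - x 3" "functional l x (\<alpha> 4) = x 1 - x 2"
  "functional l x (\<alpha> 5) = x 0 - x 1" "functional l x (\<alpha> 6) = l + x 3 + x 4 + x 5"
  by (simp_all add: functional_def axis_def)

lemma functional_line:
  "functional l (\<lambda>i. x i + t * d i) r = functional l x r + t * functional 0 d r"
  by (simp add: functional_def algebra_simps)

lemma functional_exists:
  assumes "linear v"
  obtains x where "v = functional (v highest_root / 2) x" "(\<Sum>i<6. x i) = 0"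
proof -
  \<comment> \<open>The values at the simple roots 5, 4, 3, 2, 1 are the consecutive differences of
    the \<open>x_i\<close>; together with sum zero they determine the \<open>x_i\<close>, with
    denominator 6. The sixth simple root then fits because the highest root takes the value
    \<open>2 * l\<close> plus the sum of the \<open>x_i\<close>.\<close>
  define x where "x = (\<lambda>i :: nat. (if i = 0 then v (\<alpha> 1) + 2 * v (\<alpha> 2) + 3 * v (\<alpha> 3) + 4 * v (\<alpha> 4) + 5 * v (\<alpha> 5)
    else if i = 1 then v (\<alpha> 1) + 2 * v (\<alpha> 2) + 3 * v (\<alpha> 3) + 4 * v (\<alpha> 4) - v (\<alpha> 5)
    else if i = 2 then v (\<alpha> 1) + 2 * v (\<alpha> 2) + 3 * v (\<alpha> 3) - 2 * v (\<alpha> 4) - v (\<alpha> 5)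
    else if i = 3 then v (\<alpha> 1) + 2 * v (\<alpha> 2) - 3 * v (\<alpha> 3) - 2 * v (\<alpha> 4) - v (\<alpha> 5)
    else if i = 4 then v (\<alpha> 1) - 4 * v (\<alpha> 2) - 3 * v (\<alpha> 3) - 2 * v (\<alpha> 4) - v (\<alpha> 5)
    else - 5 * v (\<alpha> 1) - 4 * v (\<alpha> 2) - 3 * v (\<alpha> 3) - 2 * v (\<alpha> 4) - v (\<alpha> 5)) / 6)"
  have h: "v highest_root = v (\<alpha> 1) + 2 * v (\<alpha> 2) + 3 * v (\<alpha> 3) + 2 * v (\<alpha> 4) + v (\<alpha> 5) + 2 * v (\<alpha> 6)"
    unfolding highest_root_def linear_add[OF assms] linear_scale[OF assms]
    by (simp add: scaleR_conv_of_real)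
  have "v = functional (v highest_root / 2) x"
  proof (rule linear_eq_on_simple_roots[OF assms linear_functional])
    show "v (\<alpha> i) = functional (v highest_root / 2) x (\<alpha> i)" for i
      using exhaust_6[of i]
      by (elim disjE) (simp_all add: functional_simple_root x_def h field_simps)
  qed
  moreover have "(\<Sum>i<6. x i) = 0"
    by (simp add: x_def numeral_eq_Suc lessThan_Suc field_simps)
  ultimately show ?thesis using that by blast
qed

lemma e6_cartan_values:
  "e6_cartan 1 1 = 2" "e6_cartan 1 2 = - 1" "e6_cartan 1 3 = 0" "e6_cartan 1 4 = 0" "e6_cartan 1 5 = 0" "e6_cartan 1 6 = 0"
  "e6_cartan 2 1 = - 1" "e6_cartan 2 2 = 2" "e6_cartan 2 3 = - 1" "e6_cartan 2 4 = 0" "e6_cartan 2 5 = 0" "e6_cartan 2 6 = 0"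
  "e6_cartan 3 1 = 0" "e6_cartan 3 2 = - 1" "e6_cartan 3 3 = 2" "e6_cartan 3 4 = - 1" "e6_cartan 3 5 = 0" "e6_cartan 3 6 = - 1"
  "e6_cartan 4 1 = 0" "e6_cartan 4 2 = 0" "e6_cartan 4 3 = - 1" "e6_cartan 4 4 = 2" "e6_cartan 4 5 = - 1" "e6_cartan 4 6 = 0"
  "e6_cartan 5 1 = 0" "e6_cartan 5 2 = 0" "e6_cartan 5 3 = 0" "e6_cartan 5 4 = - 1" "e6_cartan 5 5 = 2" "e6_cartan 5 6 = 0"
  "e6_cartan 6 1 = 0" "e6_cartan 6 2 = 0" "e6_cartan 6 3 = - 1" "e6_cartan 6 4 = 0" "e6_cartan 6 5 = 0" "e6_cartan 6 6 = 2"
  by (simp_all add: e6_cartan_def e6_edges_def)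

lemma functional_swap:
  assumes "i < 5"
  shows "functional l (x \<circ> Transposition.transpose i (Suc i)) = functional l x \<circ> simple_reflection (of_nat (5 - i))"
proof (rule linear_eq_on_simple_roots)
  show "linear (functional l x \<circ> simple_reflection (of_nat (5 - i)))"
    by (rule linear_compose[OF linear_simple_reflection linear_functional])
  have reflection: "functional l x (simple_reflection j (\<alpha> k)) =
      functional l x (\<alpha> k) - of_real (e6_cartan k j) * functional l x (\<alpha> j)" for j k
    by (simp add: simple_reflection_def e6_form_simple_root linear_diff[OF linear_functional]
        linear_scale[OF linear_functional] scaleR_conv_of_real[where 'a = complex])
  have "i = 0 \<or> i = 1 \<or> i = 2 \<or> i = 3 \<or> i = 4" using assms by linarith
  then show "functional l (x \<circ> Transposition.transpose i (Suc i)) (\<alpha> k) =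
      (functional l x \<circ> simple_reflection (of_nat (5 - i))) (\<alpha> k)" for k
    using exhaust_6[of k]
    by (elim disjE) (simp_all add: reflection functional_simple_root e6_cartan_values
        Transposition.transpose_def flip: numeral_2_eq_2)
qed (rule linear_functional)

text \<open>The fifth simple root has the value \<open>x 0 - x 1\<close>. Composition with this word
  therefore turns a functional with \<open>x 0 = x 1\<close> into one that vanishes at the highest
  root.\<close>

lemma highest_root_word: "weyl_word (map of_nat [4, 3, 6, 2, 3, 4, 1, 2, 3, 6]) highest_root = \<alpha> 5"
proof -
  have "foldr reflect [4, 3, 6, 2, 3, 4, 1, 2, 3, 6] (1, 2, 3, 2, 1, 2) = unit_vec 5" by code_simp
  moreover have "highest_root = lattice_vec (1, 2, 3, 2, 1, 2)"
    by (simp add: highest_root_def lattice_vec_def)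
  ultimately show ?thesis
    using foldr_reflect[of "[4, 3, 6, 2, 3, 4, 1, 2, 3, 6]" "(1, 2, 3, 2, 1, 2)"] lattice_vec_unit_vec[of 5]
    by (simp add: indices_def)
qed

text \<open>
  The previous section is applied twice: it shows that \<open>G\<close> vanishes when \<open>l = 0\<close>, hence, all roots
  being conjugate, when \<open>x\<^sub>0 = x\<^sub>1\<close>, and then everywhere.
\<close>

lemma weyl_invariant_eq_0:
  fixes G :: "(real ^ 6 \<Rightarrow> complex) \<Rightarrow> complex"
  assumes invariant: "\<And>v i. linear v \<Longrightarrow> G (v \<circ> simple_reflection i) = G v"
    and polynomial: "\<And>v d. linear v \<Longrightarrow> linear d \<Longrightarrow>
      \<exists>p. degree p \<le> 14 \<and> (\<forall>t. G (\<lambda>r. v r + t * d r) = poly p t)"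
    and zero: "\<And>x. (\<Sum>i<6. x i) = 0 \<Longrightarrow> x 0 = x 1 \<Longrightarrow> G (functional 0 x) = 0"
    and v: "linear v"
  shows "G v = 0"
proof -
  have step: "G (functional l x) = 0"
    if "\<And>x. (\<Sum>i<6. x i) = 0 \<Longrightarrow> x 0 = x 1 \<Longrightarrow> G (functional l x) = 0" "(\<Sum>i<6. x i) = 0" for l x
  proof (rule zero_if_zero_on_diagonals[where F = "\<lambda>x. G (functional l x)"])
    show "G (functional l (x \<circ> Transposition.transpose i (Suc i))) = G (functional l x)" if "Suc i < 6" for x i
      using that invariant[OF linear_functional] by (simp only: functional_swap Suc_less_eq numeral_eq_Suc pred_numeral_simps BitM.simps)
    show "\<exists>p. degree p \<le> 14 \<and> (\<forall>t. G (functional l (\<lambda>i. x i + t * d i)) = poly p t)" for x d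
      using polynomial[OF linear_functional linear_functional, of l x 0 d]
      by (simp only: functional_line[abs_def])
  qed (use that in auto)
  have 0: "G v = 0" if "linear v" "v highest_root = 0" for v
  proof -
    obtain x where x: "v = functional (v highest_root / 2) x" "(\<Sum>i<6. x i) = 0"
      using functional_exists[OF \<open>linear v\<close>] .
    then have "v = functional 0 x" using that(2) by simp
    then show ?thesis using step[OF zero x(2)] by simp
  qed
  have word: "G (v \<circ> weyl_word u) = G v" if "linear v" for u v
    using that
  proof (induction u arbitrary: v)
    case (Cons i u)
    have "linear (v \<circ> simple_reflection i)"
      using linear_simple_reflection Cons.prems by (rule linear_compose)
    from Cons.IH[OF this] show ?case
      unfolding weyl_word_Cons o_assoc invariant[OF Cons.prems] .
  qed simp
  have "G (functional l x) = 0" if "x 0 = x 1" for l x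
  proof -
    let ?w = "weyl_word (map of_nat [4, 3, 6, 2, 3, 4, 1, 2, 3, 6])"
    have "G (functional l x \<circ> ?w) = 0"
    proof (rule 0)
      show "linear (functional l x \<circ> ?w)"
        by (rule linear_compose[OF linear_weyl_word linear_functional])
      show "(functional l x \<circ> ?w) highest_root = 0"
        using that by (simp only: o_apply highest_root_word functional_simple_root) simp
    qed
    then show ?thesis by (simp only: word[OF linear_functional])
  qed
  then have "G (functional l x) = 0" if "(\<Sum>i<6. x i) = 0" for l x
    using step that by blast
  then show ?thesis using functional_exists[OF v] by metis
qed

section \<open>Polynomial dependence along lines\<close>

text \<open>A bound on the degree of a plain function, derived by rules that follow the syntax of
  the term; no polynomial has to be exhibited for the large expressions.\<close>

definition polynomial_le :: "nat \<Rightarrow> (complex \<Rightarrow> complex) \<Rightarrow> bool" where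
  "polynomial_le n f \<longleftrightarrow> (\<exists>p. degree p \<le> n \<and> (\<forall>t. f t = poly p t))"

lemma polynomial_le_const: "polynomial_le 0 (\<lambda>t. c)"
  unfolding polynomial_le_def by (rule exI[of _ "[:c:]"]) simp

lemma polynomial_le_linear: "polynomial_le 1 (\<lambda>t. a + t * b)"
  unfolding polynomial_le_def by (rule exI[of _ "[:a, b:]"]) (simp add: degree_pCons_le)

lemma polynomial_le_add: "polynomial_le m f \<Longrightarrow> polynomial_le n g \<Longrightarrow> polynomial_le (max m n) (\<lambda>t. f t + g t)"
  unfolding polynomial_le_def by (metis degree_add_le_max max.mono order_trans poly_add)

lemma polynomial_le_mult: "polynomial_le m f \<Longrightarrow> polynomial_le n g \<Longrightarrow> polynomial_le (m + n) (\<lambda>t. f t * g t)"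
  unfolding polynomial_le_def by (metis add_mono degree_mult_le order_trans poly_mult)

lemma polynomial_le_minus: "polynomial_le m f \<Longrightarrow> polynomial_le m (\<lambda>t. - f t)"
  unfolding polynomial_le_def by (metis degree_minus poly_minus)

lemma polynomial_le_diff: "polynomial_le m f \<Longrightarrow> polynomial_le n g \<Longrightarrow> polynomial_le (max m n) (\<lambda>t. f t - g t)"
  using polynomial_le_add[OF _ polynomial_le_minus] by simp

lemma polynomial_le_power: "polynomial_le m f \<Longrightarrow> polynomial_le (m * k) (\<lambda>t. f t ^ k)"
proof (induction k)
  case 0
  show ?case using polynomial_le_const[of 1] by simp
next
  case (Suc k)
  from polynomial_le_mult[OF Suc.prems Suc.IH[OF Suc.prems]] show ?case by simp
qed

lemma polynomial_le_mono: "polynomial_le m f \<Longrightarrow> m \<le> n \<Longrightarrow> polynomial_le n f"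
  unfolding polynomial_le_def by (meson order_trans)

lemma polynomial_le_sum_list:
  "(\<And>u. u \<in> set us \<Longrightarrow> polynomial_le n (f u)) \<Longrightarrow> polynomial_le n (\<lambda>t. \<Sum>u\<leftarrow>us. f u t)"
proof (induction us)
  case Nil
  show ?case using polynomial_le_const[of 0] polynomial_le_mono by fastforce
next
  case (Cons u us)
  then show ?case using polynomial_le_add[of n "f u" n] by simp
qed

lemma polynomial_le_quad:
  assumes "polynomial_le 1 f" "polynomial_le 1 g"
  shows "polynomial_le 2 (\<lambda>t. quad (f t) (g t))"
proof -
  have "polynomial_le (max (max (1 * 2) (1 + 1)) (1 * 2)) (\<lambda>t. quad (f t) (g t))"
    unfolding quad_def by (intro polynomial_le_add polynomial_le_mult polynomial_le_power assms)
  then show ?thesis by (rule polynomial_le_mono) simp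
qed

lemma polynomial_le_cub:
  assumes "polynomial_le 1 f" "polynomial_le 1 g"
  shows "polynomial_le 3 (\<lambda>t. cub (f t) (g t))"
proof -
  have "polynomial_le ((max 1 1 + max (0 + 1) 1) + max 1 (0 + 1)) (\<lambda>t. cub (f t) (g t))"
    unfolding cub_def
    by (intro polynomial_le_add polynomial_le_diff polynomial_le_mult polynomial_le_const assms)
  then show ?thesis by (rule polynomial_le_mono) simp
qed

lemma polynomial_le_forms:
  "polynomial_le 12 (\<lambda>t. subsystem_sum form_2 (\<lambda>r. v r + t * d r))"
  "polynomial_le 12 (\<lambda>t. subsystem_sum form_5 (\<lambda>r. v r + t * d r))"
  "polynomial_le 12 (\<lambda>t. subsystem_sum form_6 (\<lambda>r. v r + t * d r))"
  "polynomial_le 12 (\<lambda>t. subsystem_sum form_8 (\<lambda>r. v r + t * d r))"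
  "polynomial_le 12 (\<lambda>t. subsystem_sum form_9 (\<lambda>r. v r + t * d r))"
  "polynomial_le 12 (\<lambda>t. subsystem_sum form_12 (\<lambda>r. v r + t * d r))"
proof -
  have *: "polynomial_le 12 (\<lambda>t. subsystem_sum P (\<lambda>r. v r + t * d r))"
    if "\<And>a b c d' e f. polynomial_le 12 (\<lambda>t. P (v a + t * d a, v b + t * d b, v c + t * d c,
      v d' + t * d d', v e + t * d e, v f + t * d f))" for P
    unfolding subsystem_sum_def
  proof (rule polynomial_le_sum_list)
    fix u
    obtain a b c d' e f where "act_sextuple u = (a, b, c, d', e, f)" by (cases "act_sextuple u")
    then show "polynomial_le 12 (\<lambda>t. P (map_sextuple (\<lambda>x. v (lattice_vec x) + t * d (lattice_vec x)) (act_sextuple u)))"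
      using that[of "lattice_vec a" "lattice_vec b" "lattice_vec c" "lattice_vec d'" "lattice_vec e" "lattice_vec f"]
      by simp
  qed
  note intros = polynomial_le_add polynomial_le_diff polynomial_le_mult polynomial_le_power
    polynomial_le_quad[OF polynomial_le_linear polynomial_le_linear]
    polynomial_le_cub[OF polynomial_le_linear polynomial_le_linear]
  show "polynomial_le 12 (\<lambda>t. subsystem_sum form_2 (\<lambda>r. v r + t * d r))"
    by (rule *, unfold form_2_def prod.case, rule polynomial_le_mono, (rule intros)+) simp
  show "polynomial_le 12 (\<lambda>t. subsystem_sum form_5 (\<lambda>r. v r + t * d r))"
    by (rule *, unfold form_5_def prod.case, rule polynomial_le_mono, (rule intros)+) simp
  show "polynomial_le 12 (\<lambda>t. subsystem_sum form_6 (\<lambda>r. v r + t * d r))"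
    by (rule *, unfold form_6_def prod.case, rule polynomial_le_mono, (rule intros)+) simp
  show "polynomial_le 12 (\<lambda>t. subsystem_sum form_8 (\<lambda>r. v r + t * d r))"
    by (rule *, unfold form_8_def prod.case, rule polynomial_le_mono, (rule intros)+) simp
  show "polynomial_le 12 (\<lambda>t. subsystem_sum form_9 (\<lambda>r. v r + t * d r))"
    by (rule *, unfold form_9_def prod.case, rule polynomial_le_mono, (rule intros)+) simp
  show "polynomial_le 12 (\<lambda>t. subsystem_sum form_12 (\<lambda>r. v r + t * d r))"
    by (rule *, unfold form_12_def prod.case, rule polynomial_le_mono, (rule intros)+) simp
qed

section \<open>Power sums of the weights of the 27-dimensional representation\<close>

definition weights :: "lattice list" where
  "weights =
     [(4, 5, 6, 4, 2, 3), (1, 5, 6, 4, 2, 3), (1, 2, 6, 4, 2, 3), (1, 2, 3, 4, 2, 3), (1, 2, 3,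
      1, 2, 3), (1, 2, 3, 4, 2, 0), (1, 2, 3, 1, -1, 3), (1, 2, 3, 1, 2, 0), (1, 2, 3, 1, -1,
      0), (1, 2, 0, 1, 2, 0), (1, 2, 0, 1, -1, 0), (1, -1, 0, 1, 2, 0), (1, -1, 0, 1, -1, 0),
      (1, 2, 0, -2, -1, 0), (-2, -1, 0, 1, 2, 0), (-2, -1, 0, 1, -1, 0), (1, -1, 0, -2, -1, 0),
      (-2, -1, 0, -2, -1, 0), (1, -1, -3, -2, -1, 0), (-2, -1, -3, -2, -1, 0), (1, -1, -3, -2,
      -1, -3), (-2, -4, -3, -2, -1, 0), (-2, -1, -3, -2, -1, -3), (-2, -4, -3, -2, -1, -3),
      (-2, -4, -6, -2, -1, -3), (-2, -4, -6, -5, -1, -3), (-2, -4, -6, -5, -4, -3)]"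

text \<open>The list contains the weights multiplied by 3, so that they are integral.\<close>

definition weight_sum :: "nat \<Rightarrow> (real ^ 6 \<Rightarrow> complex) \<Rightarrow> complex" where
  "weight_sum k v = (\<Sum>w\<leftarrow>weights. (v (lattice_vec w) / 3) ^ k)"

lemma weights_reflect: "\<forall>i\<in>set indices. mset (map (reflect i) weights) = mset weights"
  by code_simp

lemma weight_sum_simple_reflection: "weight_sum k (v \<circ> simple_reflection i) = weight_sum k v"
proof -
  obtain j where j: "j \<in> set indices" "i = of_nat j"
    using exhaust_6[of i] by (force simp: indices_def)
  have "weight_sum k (v \<circ> simple_reflection i) = (\<Sum>w\<leftarrow>map (reflect j) weights. (v (lattice_vec w) / 3) ^ k)"
    unfolding weight_sum_def using j by (simp add: reflect o_def)
  also have "\<dots> = weight_sum k v"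
    unfolding weight_sum_def using weights_reflect j(1) by (intro sum_list_mset_eq) blast
  finally show ?thesis .
qed

lemma polynomial_le_weight_sum: "polynomial_le k (\<lambda>t. weight_sum k (\<lambda>r. v r + t * d r))"
  unfolding weight_sum_def
proof (rule polynomial_le_sum_list)
  fix w
  have "polynomial_le (1 * k) (\<lambda>t. (v (lattice_vec w) / 3 + t * (d (lattice_vec w) / 3)) ^ k)"
    by (intro polynomial_le_power polynomial_le_linear)
  then show "polynomial_le k (\<lambda>t. ((v (lattice_vec w) + t * d (lattice_vec w)) / 3) ^ k)"
    by (simp add: add_divide_distrib)
qed

section \<open>Evaluation of the invariants\<close>

text \<open>The elementary symmetric functions of the six numbers, assembled from those of two
  triples, which keeps the terms short. The first one is left out because the numbers have sum zero;
  every index outside 2..5 yields the sixth.\<close>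

definition elementary :: "(nat \<Rightarrow> complex) \<Rightarrow> nat \<Rightarrow> complex" where
  "elementary x k =
     (let a = x 0 + x 1 + x 2; b = x 0 * x 1 + x 0 * x 2 + x 1 * x 2; c = x 0 * x 1 * x 2;
          a' = x 3 + x 4 + x 5; b' = x 3 * x 4 + x 3 * x 5 + x 4 * x 5; c' = x 3 * x 4 * x 5
      in if k = 2 then b + a * a' + b' else if k = 3 then c + b * a' + a * b' + c'
         else if k = 4 then c * a' + b * b' + a * c' else if k = 5 then c * b' + b * c'
         else c * c')"

lemma sum_lessThan_6: "(\<Sum>i<6. f i) = f 0 + f 1 + f 2 + f 3 + f 4 + f (5 :: nat)"
  by (simp add: eval_nat_numeral)

lemma prod_lessThan_6: "(\<Prod>i<6. f i) = f 0 * f 1 * f 2 * f 3 * f 4 * f (5 :: nat)"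
  by (simp add: eval_nat_numeral)

context
  fixes x :: "nat \<Rightarrow> complex"
  assumes sum_zero: "(\<Sum>i<6. x i) = 0"
begin

lemma last_coordinate: "x 5 = - x 0 - x 1 - x 2 - x 3 - x 4"
  using sum_zero unfolding sum_lessThan_6 by Groebner_Basis.algebra

lemma prod_elementary:
  "(\<Prod>i<6. t - x i) = t ^ 6 + elementary x 2 * t ^ 4 - elementary x 3 * t ^ 3
     + elementary x 4 * t ^ 2 - elementary x 5 * t + elementary x 6"
  unfolding prod_lessThan_6 elementary_def Let_def last_coordinate
  by simp Groebner_Basis.algebra

definition psum :: "nat \<Rightarrow> complex" where
  "psum k = (\<Sum>i<6. x i ^ k)"

text \<open>Each \<open>x i\<close> is a root of the polynomial in \<open>prod_elementary\<close>;
  multiply this equation by \<open>x i ^ k\<close> and sum. It gives all power sums from the first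
  six.\<close>

lemma psum_rec:
  "psum (k + 6) = - elementary x 2 * psum (k + 4) + elementary x 3 * psum (k + 3)
     - elementary x 4 * psum (k + 2) + elementary x 5 * psum (k + 1) - elementary x 6 * psum k"
proof -
  have "x i ^ (k + 6) = - elementary x 2 * x i ^ (k + 4) + elementary x 3 * x i ^ (k + 3)
     - elementary x 4 * x i ^ (k + 2) + elementary x 5 * x i ^ (k + 1) - elementary x 6 * x i ^ k"
    if "i < 6" for i
  proof -
    have "(\<Prod>j<6. x i - x j) = 0" using that by (intro prod_zero) auto
    then have root: "x i ^ 6 = - elementary x 2 * x i ^ 4 + elementary x 3 * x i ^ 3
       - elementary x 4 * x i ^ 2 + elementary x 5 * x i - elementary x 6"
      unfolding prod_elementary by Groebner_Basis.algebra
    show ?thesis by (simp add: power_add root power2_eq_square algebra_simps)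
  qed
  then have "psum (k + 6) = (\<Sum>i<6. - elementary x 2 * x i ^ (k + 4) + elementary x 3 * x i ^ (k + 3)
     - elementary x 4 * x i ^ (k + 2) + elementary x 5 * x i ^ (k + 1) - elementary x 6 * x i ^ k)"
    unfolding psum_def by (intro sum.cong) auto
  then show ?thesis
    unfolding sum.distrib sum_subtractf sum_distrib_left[symmetric] psum_def .
qed

lemma psum_small:
  "psum 0 = 6" "psum 1 = 0" "psum 2 = - 2 * elementary x 2" "psum 3 = 3 * elementary x 3"
  "psum 4 = 2 * elementary x 2 ^ 2 - 4 * elementary x 4"
  "psum 5 = 5 * elementary x 5 - 5 * elementary x 2 * elementary x 3"
  unfolding psum_def sum_lessThan_6 elementary_def Let_def last_coordinate
  by (simp, simp, (simp, Groebner_Basis.algebra)+)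

lemma psum_6:
  "psum 6 = - 2 * elementary x 2 ^ 3 + 6 * elementary x 2 * elementary x 4 + 3 * elementary x 3 ^ 2 -
      6 * elementary x 6"
proof -
  have rec: "psum 6 = - elementary x 2 * psum 4 + elementary x 3 * psum 3 - elementary x 4 * psum 2 + elementary x 5 * psum 1 - elementary x 6 * psum 0"
    using psum_rec[of 0] by (simp del: add_2_eq_Suc add_2_eq_Suc' One_nat_def)
  show ?thesis unfolding rec psum_small  by Groebner_Basis.algebra
qed

lemma psum_7:
  "psum 7 = 7 * elementary x 2 ^ 2 * elementary x 3 - 7 * elementary x 2 * elementary x 5 - 7 *
      elementary x 3 * elementary x 4"
proof -
  have rec: "psum 7 = - elementary x 2 * psum 5 + elementary x 3 * psum 4 - elementary x 4 * psum 3 + elementary x 5 * psum 2 - elementary x 6 * psum 1"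
    using psum_rec[of 1] by (simp del: add_2_eq_Suc add_2_eq_Suc' One_nat_def)
  show ?thesis unfolding rec psum_small  by Groebner_Basis.algebra
qed

lemma psum_8:
  "psum 8 = 2 * elementary x 2 ^ 4 - 8 * elementary x 2 ^ 2 * elementary x 4 - 8 * elementary x 2 *
      elementary x 3 ^ 2 + 8 * elementary x 2 * elementary x 6 + 8 * elementary x 3 * elementary
      x 5 + 4 * elementary x 4 ^ 2"
proof -
  have rec: "psum 8 = - elementary x 2 * psum 6 + elementary x 3 * psum 5 - elementary x 4 * psum 4 + elementary x 5 * psum 3 - elementary x 6 * psum 2"
    using psum_rec[of 2] by (simp del: add_2_eq_Suc add_2_eq_Suc' One_nat_def)
  show ?thesis unfolding rec psum_small psum_6 by Groebner_Basis.algebra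
qed

lemma psum_9:
  "psum 9 = - 9 * elementary x 2 ^ 3 * elementary x 3 + 9 * elementary x 2 ^ 2 * elementary x 5 + 18 *
      elementary x 2 * elementary x 3 * elementary x 4 + 3 * elementary x 3 ^ 3 - 9 * elementary
      x 3 * elementary x 6 - 9 * elementary x 4 * elementary x 5"
proof -
  have rec: "psum 9 = - elementary x 2 * psum 7 + elementary x 3 * psum 6 - elementary x 4 * psum 5 + elementary x 5 * psum 4 - elementary x 6 * psum 3"
    using psum_rec[of 3] by (simp del: add_2_eq_Suc add_2_eq_Suc' One_nat_def)
  show ?thesis unfolding rec psum_small psum_6 psum_7 by Groebner_Basis.algebra
qed

lemma psum_10:
  "psum 10 = - 2 * elementary x 2 ^ 5 + 10 * elementary x 2 ^ 3 * elementary x 4 + 15 * elementary x 2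
      ^ 2 * elementary x 3 ^ 2 - 10 * elementary x 2 ^ 2 * elementary x 6 - 20 * elementary x 2
      * elementary x 3 * elementary x 5 - 10 * elementary x 2 * elementary x 4 ^ 2 - 10 *
      elementary x 3 ^ 2 * elementary x 4 + 10 * elementary x 4 * elementary x 6 + 5 *
      elementary x 5 ^ 2"
proof -
  have rec: "psum 10 = - elementary x 2 * psum 8 + elementary x 3 * psum 7 - elementary x 4 * psum 6 + elementary x 5 * psum 5 - elementary x 6 * psum 4"
    using psum_rec[of 4] by (simp del: add_2_eq_Suc add_2_eq_Suc' One_nat_def)
  show ?thesis unfolding rec psum_small psum_6 psum_7 psum_8 by Groebner_Basis.algebra
qed

lemma psum_11:
  "psum 11 = 11 * elementary x 2 ^ 4 * elementary x 3 - 11 * elementary x 2 ^ 3 * elementary x 5 - 33 *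
      elementary x 2 ^ 2 * elementary x 3 * elementary x 4 - 11 * elementary x 2 * elementary x
      3 ^ 3 + 22 * elementary x 2 * elementary x 3 * elementary x 6 + 22 * elementary x 2 *
      elementary x 4 * elementary x 5 + 11 * elementary x 3 ^ 2 * elementary x 5 + 11 *
      elementary x 3 * elementary x 4 ^ 2 - 11 * elementary x 5 * elementary x 6"
proof -
  have rec: "psum 11 = - elementary x 2 * psum 9 + elementary x 3 * psum 8 - elementary x 4 * psum 7 + elementary x 5 * psum 6 - elementary x 6 * psum 5"
    using psum_rec[of 5] by (simp del: add_2_eq_Suc add_2_eq_Suc' One_nat_def)
  show ?thesis unfolding rec psum_small psum_6 psum_7 psum_8 psum_9 by Groebner_Basis.algebra
qed

lemma psum_12:
  "psum 12 = 2 * elementary x 2 ^ 6 - 12 * elementary x 2 ^ 4 * elementary x 4 - 24 * elementary x 2 ^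
      3 * elementary x 3 ^ 2 + 12 * elementary x 2 ^ 3 * elementary x 6 + 36 * elementary x 2 ^
      2 * elementary x 3 * elementary x 5 + 18 * elementary x 2 ^ 2 * elementary x 4 ^ 2 + 36 *
      elementary x 2 * elementary x 3 ^ 2 * elementary x 4 - 24 * elementary x 2 * elementary x
      4 * elementary x 6 - 12 * elementary x 2 * elementary x 5 ^ 2 + 3 * elementary x 3 ^ 4 -
      12 * elementary x 3 ^ 2 * elementary x 6 - 24 * elementary x 3 * elementary x 4 *
      elementary x 5 - 4 * elementary x 4 ^ 3 + 6 * elementary x 6 ^ 2"
proof -
  have rec: "psum 12 = - elementary x 2 * psum 10 + elementary x 3 * psum 9 - elementary x 4 * psum 8 + elementary x 5 * psum 7 - elementary x 6 * psum 6"
    using psum_rec[of 6] by (simp del: add_2_eq_Suc add_2_eq_Suc' One_nat_def)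
  show ?thesis unfolding rec psum_small psum_6 psum_7 psum_8 psum_9 psum_10 by Groebner_Basis.algebra
qed

lemmas psum_large = psum_6 psum_7 psum_8 psum_9 psum_10 psum_11 psum_12

lemma double_cancel: "2 * a = 2 * b \<Longrightarrow> a = (b :: complex)"
  by simp

text \<open>Restricted to A1 x A5, the representation splits into 12 + 15 dimensions: the weights
  \<open>l - x_i\<close> and \<open>- l - x_i\<close>, and the sums \<open>x_i + x_j\<close> with
  \<open>i < j\<close>.\<close>

lemma weight_values:
  "map (\<lambda>w. functional l x (lattice_vec w) / 3) weights =
     [l - x 5, l - x 4, l - x 3, l - x 2, l - x 1, x 0 + x 1, l - x 0, x 0 + x 2, x 1 + x 2, x
      0 + x 3, x 1 + x 3, x 0 + x 4, x 1 + x 4, x 2 + x 3, x 0 + x 5, x 1 + x 5, x 2 + x 4, x 2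
      + x 5, x 3 + x 4, x 3 + x 5, - l - x 5, x 4 + x 5, - l - x 4, - l - x 3, - l - x 2, - l -
      x 1, - l - x 0]"
  by (simp add: weights_def functional_lattice_vec last_coordinate field_simps)

text \<open>Doubling turns the sum over \<open>i < j\<close> into the full double sum of
  \<open>(x_i + x_j)^k\<close>, expanded binomially, minus its diagonal \<open>2^k * psum k\<close>;
  the terms with \<open>l\<close> come from \<open>(l - x_i)^k + (- l - x_i)^k\<close>. The next
  five lemmas have the same form.\<close>

lemma weight_sum_2_psum:
  "2 * weight_sum 2 (functional l x) = 4 * l ^ 2 * psum 0 + 4 * l ^ 0 * psum 2 + 1 * psum 0 * psum 2 + 2 * psum 1 * psum 1 + 1 *
    psum 2 * psum 0 - 4 * psum 2"
proof -
  have eq: "weight_sum 2 (functional l x) = (\<Sum>y\<leftarrow>map (\<lambda>w. functional l x (lattice_vec w) / 3) weights. y ^ 2)"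
    by (simp add: weight_sum_def o_def)
  show ?thesis
    unfolding eq weight_values psum_def sum_lessThan_6 list.map sum_list.Cons sum_list.Nil power_0
    by Groebner_Basis.algebra
qed

lemma weight_sum_5_psum:
  "2 * weight_sum 5 (functional l x) = - (20 * l ^ 4 * psum 1 + 40 * l ^ 2 * psum 3 + 4 * l ^ 0 * psum 5) + 1 * psum 0 * psum 5 + 5
    * psum 1 * psum 4 + 10 * psum 2 * psum 3 + 10 * psum 3 * psum 2 + 5 * psum 4 * psum 1 + 1 *
    psum 5 * psum 0 - 32 * psum 5"
proof -
  have eq: "weight_sum 5 (functional l x) = (\<Sum>y\<leftarrow>map (\<lambda>w. functional l x (lattice_vec w) / 3) weights. y ^ 5)"
    by (simp add: weight_sum_def o_def)
  show ?thesis
    unfolding eq weight_values psum_def sum_lessThan_6 list.map sum_list.Cons sum_list.Nil power_0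
    by Groebner_Basis.algebra
qed

lemma weight_sum_6_psum:
  "2 * weight_sum 6 (functional l x) = 4 * l ^ 6 * psum 0 + 60 * l ^ 4 * psum 2 + 60 * l ^ 2 * psum 4 + 4 * l ^ 0 * psum 6 + 1 *
    psum 0 * psum 6 + 6 * psum 1 * psum 5 + 15 * psum 2 * psum 4 + 20 * psum 3 * psum 3 + 15 *
    psum 4 * psum 2 + 6 * psum 5 * psum 1 + 1 * psum 6 * psum 0 - 64 * psum 6"
proof -
  have eq: "weight_sum 6 (functional l x) = (\<Sum>y\<leftarrow>map (\<lambda>w. functional l x (lattice_vec w) / 3) weights. y ^ 6)"
    by (simp add: weight_sum_def o_def)
  show ?thesis
    unfolding eq weight_values psum_def sum_lessThan_6 list.map sum_list.Cons sum_list.Nil power_0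
    by Groebner_Basis.algebra
qed

lemma weight_sum_8_psum:
  "2 * weight_sum 8 (functional l x) = 4 * l ^ 8 * psum 0 + 112 * l ^ 6 * psum 2 + 280 * l ^ 4 * psum 4 + 112 * l ^ 2 * psum 6 + 4
    * l ^ 0 * psum 8 + 1 * psum 0 * psum 8 + 8 * psum 1 * psum 7 + 28 * psum 2 * psum 6 + 56 *
    psum 3 * psum 5 + 70 * psum 4 * psum 4 + 56 * psum 5 * psum 3 + 28 * psum 6 * psum 2 + 8 *
    psum 7 * psum 1 + 1 * psum 8 * psum 0 - 256 * psum 8"
proof -
  have eq: "weight_sum 8 (functional l x) = (\<Sum>y\<leftarrow>map (\<lambda>w. functional l x (lattice_vec w) / 3) weights. y ^ 8)"
    by (simp add: weight_sum_def o_def)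
  show ?thesis
    unfolding eq weight_values psum_def sum_lessThan_6 list.map sum_list.Cons sum_list.Nil power_0
    by Groebner_Basis.algebra
qed

lemma weight_sum_9_psum:
  "2 * weight_sum 9 (functional l x) = - (36 * l ^ 8 * psum 1 + 336 * l ^ 6 * psum 3 + 504 * l ^ 4 * psum 5 + 144 * l ^ 2 * psum 7
    + 4 * l ^ 0 * psum 9) + 1 * psum 0 * psum 9 + 9 * psum 1 * psum 8 + 36 * psum 2 * psum 7 +
    84 * psum 3 * psum 6 + 126 * psum 4 * psum 5 + 126 * psum 5 * psum 4 + 84 * psum 6 * psum 3
    + 36 * psum 7 * psum 2 + 9 * psum 8 * psum 1 + 1 * psum 9 * psum 0 - 512 * psum 9"
proof -
  have eq: "weight_sum 9 (functional l x) = (\<Sum>y\<leftarrow>map (\<lambda>w. functional l x (lattice_vec w) / 3) weights. y ^ 9)"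
    by (simp add: weight_sum_def o_def)
  show ?thesis
    unfolding eq weight_values psum_def sum_lessThan_6 list.map sum_list.Cons sum_list.Nil power_0
    by Groebner_Basis.algebra
qed

lemma weight_sum_12_psum:
  "2 * weight_sum 12 (functional l x) = 4 * l ^ 12 * psum 0 + 264 * l ^ 10 * psum 2 + 1980 * l ^ 8 * psum 4 + 3696 * l ^ 6 * psum 6
    + 1980 * l ^ 4 * psum 8 + 264 * l ^ 2 * psum 10 + 4 * l ^ 0 * psum 12 + 1 * psum 0 * psum 12
    + 12 * psum 1 * psum 11 + 66 * psum 2 * psum 10 + 220 * psum 3 * psum 9 + 495 * psum 4 *
    psum 8 + 792 * psum 5 * psum 7 + 924 * psum 6 * psum 6 + 792 * psum 7 * psum 5 + 495 * psum
    8 * psum 4 + 220 * psum 9 * psum 3 + 66 * psum 10 * psum 2 + 12 * psum 11 * psum 1 + 1 *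
    psum 12 * psum 0 - 4096 * psum 12"
proof -
  have eq: "weight_sum 12 (functional l x) = (\<Sum>y\<leftarrow>map (\<lambda>w. functional l x (lattice_vec w) / 3) weights. y ^ 12)"
    by (simp add: weight_sum_def o_def)
  show ?thesis
    unfolding eq weight_values psum_def sum_lessThan_6 list.map sum_list.Cons sum_list.Nil power_0
    by Groebner_Basis.algebra
qed

lemma weight_sum_2:
  "weight_sum 2 (functional l x) = 12 * l ^ 2 - 12 * elementary x 2"
  (is "_ = ?rhs")
proof -
  have "2 * weight_sum 2 (functional l x) = 2 * ?rhs"
    unfolding weight_sum_2_psum psum_small psum_large by Groebner_Basis.algebra
  then show ?thesis by (rule double_cancel)
qed

lemma weight_sum_5:
  "weight_sum 5 (functional l x) = - 60 * l ^ 2 * elementary x 3 - 60 * elementary x 5"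
  (is "_ = ?rhs")
proof -
  have "2 * weight_sum 5 (functional l x) = 2 * ?rhs"
    unfolding weight_sum_5_psum psum_small psum_large by Groebner_Basis.algebra
  then show ?thesis by (rule double_cancel)
qed

lemma weight_sum_6:
  "weight_sum 6 (functional l x) = 12 * l ^ 6 - 60 * l ^ 4 * elementary x 2 + 60 * l ^ 2 * elementary x 2 ^ 2 - 120 * l ^ 2 *
    elementary x 4 - 12 * elementary x 2 ^ 3 - 24 * elementary x 2 * elementary x 4 + 18 *
    elementary x 3 ^ 2 + 144 * elementary x 6"
  (is "_ = ?rhs")
proof -
  have "2 * weight_sum 6 (functional l x) = 2 * ?rhs"
    unfolding weight_sum_6_psum psum_small psum_large by Groebner_Basis.algebra
  then show ?thesis by (rule double_cancel)
qed

lemma weight_sum_8: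
  "weight_sum 8 (functional l x) = 12 * l ^ 8 - 112 * l ^ 6 * elementary x 2 + 280 * l ^ 4 * elementary x 2 ^ 2 - 560 * l ^ 4 *
    elementary x 4 - 112 * l ^ 2 * elementary x 2 ^ 3 + 336 * l ^ 2 * elementary x 2 *
    elementary x 4 + 168 * l ^ 2 * elementary x 3 ^ 2 - 336 * l ^ 2 * elementary x 6 + 12 *
    elementary x 2 ^ 4 + 64 * elementary x 2 ^ 2 * elementary x 4 - 48 * elementary x 2 *
    elementary x 3 ^ 2 - 624 * elementary x 2 * elementary x 6 - 120 * elementary x 3 *
    elementary x 5 + 80 * elementary x 4 ^ 2"
  (is "_ = ?rhs")
proof -
  have "2 * weight_sum 8 (functional l x) = 2 * ?rhs"
    unfolding weight_sum_8_psum psum_small psum_large by Groebner_Basis.algebra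
  then show ?thesis by (rule double_cancel)
qed

lemma weight_sum_9:
  "weight_sum 9 (functional l x) = - 504 * l ^ 6 * elementary x 3 + 1260 * l ^ 4 * elementary x 2 * elementary x 3 - 1260 * l ^
    4 * elementary x 5 - 504 * l ^ 2 * elementary x 2 ^ 2 * elementary x 3 + 504 * l ^ 2 *
    elementary x 2 * elementary x 5 + 504 * l ^ 2 * elementary x 3 * elementary x 4 - 504 *
    elementary x 2 ^ 2 * elementary x 5 + 756 * elementary x 3 * elementary x 6 - 252 *
    elementary x 4 * elementary x 5"
  (is "_ = ?rhs")
proof -
  have "2 * weight_sum 9 (functional l x) = 2 * ?rhs"
    unfolding weight_sum_9_psum psum_small psum_large by Groebner_Basis.algebra
  then show ?thesis by (rule double_cancel)
qed

lemma weight_sum_12: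
  "weight_sum 12 (functional l x) = 12 * l ^ 12 - 264 * l ^ 10 * elementary x 2 + 1980 * l ^ 8 * elementary x 2 ^ 2 - 3960 * l ^
    8 * elementary x 4 - 3696 * l ^ 6 * elementary x 2 ^ 3 + 11088 * l ^ 6 * elementary x 2 *
    elementary x 4 + 5544 * l ^ 6 * elementary x 3 ^ 2 - 11088 * l ^ 6 * elementary x 6 + 1980 *
    l ^ 4 * elementary x 2 ^ 4 - 7920 * l ^ 4 * elementary x 2 ^ 2 * elementary x 4 - 7920 * l ^
    4 * elementary x 2 * elementary x 3 ^ 2 + 7920 * l ^ 4 * elementary x 2 * elementary x 6 +
    7920 * l ^ 4 * elementary x 3 * elementary x 5 + 3960 * l ^ 4 * elementary x 4 ^ 2 - 264 * l
    ^ 2 * elementary x 2 ^ 5 + 1320 * l ^ 2 * elementary x 2 ^ 3 * elementary x 4 + 1980 * l ^ 2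
    * elementary x 2 ^ 2 * elementary x 3 ^ 2 - 1320 * l ^ 2 * elementary x 2 ^ 2 * elementary x
    6 - 2640 * l ^ 2 * elementary x 2 * elementary x 3 * elementary x 5 - 1320 * l ^ 2 *
    elementary x 2 * elementary x 4 ^ 2 - 1320 * l ^ 2 * elementary x 3 ^ 2 * elementary x 4 +
    1320 * l ^ 2 * elementary x 4 * elementary x 6 + 660 * l ^ 2 * elementary x 5 ^ 2 + 12 *
    elementary x 2 ^ 6 + 192 * elementary x 2 ^ 4 * elementary x 4 - 144 * elementary x 2 ^ 3 *
    elementary x 3 ^ 2 - 4152 * elementary x 2 ^ 3 * elementary x 6 - 1500 * elementary x 2 ^ 2
    * elementary x 3 * elementary x 5 + 1032 * elementary x 2 ^ 2 * elementary x 4 ^ 2 - 48 *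
    elementary x 2 * elementary x 3 ^ 2 * elementary x 4 - 1464 * elementary x 2 * elementary x
    4 * elementary x 6 - 3900 * elementary x 2 * elementary x 5 ^ 2 + 18 * elementary x 3 ^ 4 +
    1908 * elementary x 3 ^ 2 * elementary x 6 - 540 * elementary x 3 * elementary x 4 *
    elementary x 5 + 240 * elementary x 4 ^ 3 + 4392 * elementary x 6 ^ 2"
  (is "_ = ?rhs")
proof -
  have "2 * weight_sum 12 (functional l x) = 2 * ?rhs"
    unfolding weight_sum_12_psum psum_small psum_large by Groebner_Basis.algebra
  then show ?thesis by (rule double_cancel)
qed

end

subsection \<open>The case \<open>l = 0\<close>, \<open>x\<^sub>0 = x\<^sub>1\<close>\<close>

text \<open>
  The reflections in \<open>\<alpha>\<^sub>5\<close> and in the highest root, whose products are the four words below, fix such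
  a functional. Modulo them, the 40 subsystems fall into 16 classes; the table maps every subsystem to
  a representative of its class.
\<close>

definition flat_words :: "nat list list" where
  "flat_words = [[], [5], [6, 3, 2, 1, 4, 3, 2, 6, 3, 4, 5, 4, 3, 6, 2, 3, 4, 1, 2, 3, 6], [5, 6, 3, 2, 1, 4, 3, 2, 6, 3, 4, 5, 4, 3, 6, 2, 3, 4, 1, 2, 3, 6]]"

definition flat_table :: "(nat \<times> nat \<times> nat list) list" where
  "flat_table =
     [(0, 0, []), (1, 0, []), (0, 3, [1, 0, 3, 0, 1, 2, 0, 1]), (3, 0, []), (1, 2, [3, 0, 1, 2,
      0, 1, 2, 0, 1]), (0, 1, []), (6, 0, []), (6, 2, [3, 0, 1, 3, 1, 0, 2, 1, 0]), (8, 0, []),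
      (0, 2, [3, 0, 1, 2, 0, 1, 2, 0, 1]), (1, 1, []), (6, 3, [2, 0, 1, 3, 1, 0, 2, 1, 0]), (1,
      3, [1, 0, 3, 0, 1, 2, 0, 1]), (3, 3, [1, 0, 3, 0, 1, 2, 0, 1]), (14, 0, []), (15, 0, []),
      (3, 1, []), (8, 2, [3, 0, 1, 2, 0, 1, 2, 0, 1]), (6, 1, []), (19, 0, []), (8, 1, []), (3,
      2, [3, 0, 1, 2, 0, 1, 2, 0, 1]), (8, 3, [1, 0, 3, 0, 1, 2, 0, 1]), (14, 3, [1, 0, 3, 0,
      1, 2, 0, 1]), (24, 0, []), (25, 0, []), (14, 1, []), (19, 2, [3, 0, 1, 2, 0, 1, 2, 0,
      1]), (28, 0, []), (15, 2, [3, 0, 1, 2, 0, 1, 2, 0, 1]), (14, 2, [3, 0, 1, 2, 0, 1, 2, 0,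
      1]), (24, 1, [2, 2]), (28, 1, [2]), (33, 0, []), (34, 0, []), (25, 2, [3, 0, 1, 2, 0, 1,
      2, 0, 1]), (36, 0, []), (33, 1, [2, 2]), (38, 0, []), (39, 0, [])]"

lemma flat_table:
  "list_all2 (\<lambda>u (k, h, g). act_sextuple ((flat_words ! h) @ u) = foldr symmetry g (act_sextuple (subsystem_words ! k)) \<and>
       set g \<subseteq> {0, 1, 2, 3} \<and> h < 4) subsystem_words flat_table"
  by code_simp

lemma flat_representatives:
  "map (\<lambda>k. act_sextuple (subsystem_words ! k)) [0, 1, 3, 6, 8, 14, 15, 19, 24, 25, 28, 33, 34, 36, 38, 39] =
     [((0, 0, 1, 1, 1, 0), (1, 1, 1, 1, 0, 1), (1, 1, 1, 0, 0, 0), (0, 1, 1, 1, 1, 1), (0, 1,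
      1, 1, 0, 0), (0, 0, 1, 0, 0, 1)), ((0, 0, 1, 1, 1, 0), (0, 1, 1, 1, 0, 1), (0, 1, 1, 0,
      0, 0), (1, 1, 1, 1, 1, 1), (1, 1, 1, 1, 0, 0), (0, 0, 1, 0, 0, 1)), ((0, 0, 0, 1, 1, 0),
      (1, 1, 2, 1, 0, 1), (1, 1, 0, 0, 0, 0), (0, 1, 2, 1, 1, 1), (0, 1, 1, 1, 0, 0), (0, 0, 0,
      0, 0, 1)), ((0, 0, 1, 1, 1, 1), (1, 1, 1, 1, 0, 0), (1, 1, 1, 0, 0, 1), (0, 1, 1, 1, 1,
      0), (0, 1, 1, 1, 0, 1), (0, 0, 1, 0, 0, 0)), ((0, 0, 0, 1, 1, 0), (0, 1, 2, 1, 0, 1), (0,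
      1, 0, 0, 0, 0), (1, 1, 2, 1, 1, 1), (1, 1, 1, 1, 0, 0), (0, 0, 0, 0, 0, 1)), ((0, 0, 0,
      1, 1, 0), (1, 2, 2, 1, 0, 1), (1, 0, 0, 0, 0, 0), (0, 1, 2, 1, 1, 1), (0, 0, 1, 1, 0, 0),
      (0, 0, 0, 0, 0, 1)), ((0, 0, 0, 0, 1, 0), (1, 1, 2, 1, 0, 1), (1, 1, 0, 0, 0, 0), (0, 1,
      2, 2, 1, 1), (0, 1, 1, 0, 0, 0), (0, 0, 0, 0, 0, 1)), ((0, 0, 0, 0, 1, 0), (0, 1, 2, 1,
      0, 1), (0, 1, 0, 0, 0, 0), (1, 1, 2, 2, 1, 1), (1, 1, 1, 0, 0, 0), (0, 0, 0, 0, 0, 1)),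
      ((0, 1, 1, 1, 1, 1), (1, 1, 2, 1, 0, 1), (1, 1, 0, 0, 0, 0), (0, 0, 1, 1, 1, 0), (0, 0,
      0, 1, 0, 0), (0, 1, 1, 0, 0, 0)), ((0, 0, 0, 0, 1, 0), (1, 2, 2, 1, 0, 1), (1, 0, 0, 0,
      0, 0), (0, 1, 2, 2, 1, 1), (0, 0, 1, 0, 0, 0), (0, 0, 0, 0, 0, 1)), ((0, 0, 0, 1, 1, 0),
      (1, 1, 1, 0, 0, 0), (1, 1, 1, 1, 0, 1), (0, 1, 2, 1, 1, 1), (0, 1, 0, 0, 0, 0), (0, 0, 1,
      1, 0, 0)), ((0, 0, 1, 1, 1, 1), (1, 2, 2, 1, 0, 1), (1, 0, 0, 0, 0, 0), (0, 1, 1, 1, 1,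
      0), (0, 0, 0, 1, 0, 0), (0, 0, 1, 0, 0, 0)), ((0, 0, 0, 0, 1, 0), (1, 1, 1, 1, 0, 0), (1,
      1, 1, 0, 0, 1), (0, 1, 2, 2, 1, 1), (0, 1, 0, 0, 0, 0), (0, 0, 1, 0, 0, 0)), ((0, 0, 0,
      0, 1, 0), (0, 1, 1, 1, 0, 0), (0, 1, 1, 0, 0, 1), (1, 1, 2, 2, 1, 1), (1, 1, 0, 0, 0, 0),
      (0, 0, 1, 0, 0, 0)), ((0, 0, 0, 0, 1, 0), (0, 0, 1, 1, 0, 0), (0, 0, 1, 0, 0, 1), (1, 2,
      2, 2, 1, 1), (1, 0, 0, 0, 0, 0), (0, 1, 1, 0, 0, 0)), ((0, 0, 0, 0, 1, 0), (0, 0, 0, 1,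
      0, 0), (0, 0, 0, 0, 0, 1), (1, 2, 3, 2, 1, 1), (1, 0, 0, 0, 0, 0), (0, 1, 0, 0, 0, 0))]"
  by code_simp

lemma foldr_symmetry:
  assumes "linear v" "symmetric_form P" "set g \<subseteq> {0, 1, 2, 3}"
  shows "P (lattice_values v (foldr symmetry g t)) = P (lattice_values v t)"
  using assms(3)
proof (induction g)
  case (Cons n g)
  then have "n \<in> {0, 1, 2, 3}" by simp
  with Cons symmetric_formD[OF assms(2)] show ?case
    by (simp del: symmetry.simps add: lattice_values_symmetry[OF assms(1)])
qed simp

lemma functional_flat:
  assumes "x 0 = x 1" "(\<Sum>i<6. x i) = 0" "h < 4"
  shows "functional 0 x \<circ> weyl_word (map of_nat (flat_words ! h)) = functional 0 x"
proof -
  let ?v = "functional 0 x"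
  have 5: "?v \<circ> weyl_word (map of_nat [5]) = ?v"
  proof (rule linear_eq_on_simple_roots)
    show "(?v \<circ> weyl_word (map of_nat [5])) (\<alpha> k) = ?v (\<alpha> k)" for k
      using assms(1) by (simp add: weyl_word_Cons simple_reflection_def linear_diff[OF linear_functional]
        linear_scale[OF linear_functional] functional_simple_root)
  qed (auto intro: linear_compose[OF linear_weyl_word linear_functional] linear_functional)
  \<comment> \<open>This is the word of \<open>highest_root_word\<close> conjugating the fifth
    reflection, that is, the reflection in the highest root. Among the simple roots only the sixth
    is not orthogonal to the highest root, and it loses one copy of it.\<close>
  define u :: "nat list" where "u = [6, 3, 2, 1, 4, 3, 2, 6, 3, 4, 5, 4, 3, 6, 2, 3, 4, 1, 2, 3, 6]"
  have u: "set u \<subseteq> set indices" "\<forall>j\<in>set indices. foldr reflect u (unit_vec j) =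
      (if j = 6 then unit_vec j - (1, 2, 3, 2, 1, 2) else unit_vec j)"
    unfolding u_def by code_simp+
  have T: "?v \<circ> weyl_word (map of_nat u) = ?v"
  proof (rule linear_eq_on_simple_roots)
    fix k :: 6
    obtain j where j: "j \<in> set indices" "k = of_nat j"
      using exhaust_6[of k] by (force simp: indices_def)
    have "weyl_word (map of_nat u) (\<alpha> k) = lattice_vec (if j = 6 then unit_vec j - (1, 2, 3, 2, 1, 2) else unit_vec j)"
      using foldr_reflect[OF u(1), of "unit_vec j"] lattice_vec_unit_vec[OF j(1)] bspec[OF u(2) j(1)]
      by (simp only: j(2))
    moreover have "?v (lattice_vec (if j = 6 then unit_vec j - (1, 2, 3, 2, 1, 2) else unit_vec j)) = ?v (\<alpha> k)"
      using j by (auto simp: unit_vec_def functional_lattice_vec functional_simple_root indices_def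
          last_coordinate[OF assms(2)])
    ultimately show "(?v \<circ> weyl_word (map of_nat u)) (\<alpha> k) = ?v (\<alpha> k)" by (simp only: o_apply)
  qed (auto intro: linear_compose[OF linear_weyl_word linear_functional] linear_functional)
  have "h = 0 \<or> h = 1 \<or> h = 2 \<or> h = 3" using assms(3) by linarith
  then show ?thesis
    using 5 T[unfolded u_def] weyl_word_append[of "map of_nat [5]" "map of_nat u", unfolded u_def]
    by (elim disjE) (simp_all only: flat_words_def nth_Cons_0 nth_Cons_numeral One_nat_def nth_Cons_Suc numeral_2_eq_2 numeral_3_eq_3
      list.map weyl_word_Nil comp_id append_Cons append_Nil o_assoc)
qed

text \<open>The pairs consist of the size of a class and its representative; there are six classes
  of size 4, six of size 2 and four of size 1.\<close>

lemma subsystem_sum_flat: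
  assumes "x 0 = x 1" "(\<Sum>i<6. x i) = 0" "symmetric_form P"
  shows "subsystem_sum P (functional 0 x) =
    (\<Sum>(n, k)\<leftarrow>[(4, 0), (4, 1), (4, 3), (4, 6), (4, 8), (4, 14), (2, 15), (2, 19), (2, 24), (2, 25), (2, 28), (2, 33), (1, 34), (1, 36), (1, 38), (1, 39)]. of_nat n * P (lattice_values (functional 0 x) (act_sextuple (subsystem_words ! k))))"
proof -
  let ?v = "functional 0 x"
  let ?f = "\<lambda>k. P (lattice_values ?v (act_sextuple (subsystem_words ! k)))"
  have "list_all2 (\<lambda>u (k, h, g). u \<in> set subsystem_words \<and>
      act_sextuple ((flat_words ! h) @ u) = foldr symmetry g (act_sextuple (subsystem_words ! k)) \<and>
      set g \<subseteq> {0, 1, 2, 3} \<and> h < 4) subsystem_words flat_table"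
    using flat_table by (simp add: list_all2_conv_all_nth split_beta)
  then have "map (\<lambda>u. P (lattice_values ?v (act_sextuple u))) subsystem_words = map ?f (map fst flat_table)"
  proof (rule list_all2_map_eq)
    fix u and y :: "nat \<times> nat \<times> nat list"
    obtain k h g where y: "y = (k, h, g)" by (cases y)
    assume "case y of (k, h, g) \<Rightarrow> u \<in> set subsystem_words \<and>
      act_sextuple ((flat_words ! h) @ u) = foldr symmetry g (act_sextuple (subsystem_words ! k)) \<and>
      set g \<subseteq> {0, 1, 2, 3} \<and> h < 4"
    then have u: "u \<in> set subsystem_words" "set g \<subseteq> {0, 1, 2, 3}" "h < 4"
      and act: "act_sextuple ((flat_words ! h) @ u) = foldr symmetry g (act_sextuple (subsystem_words ! k))"
      by (auto simp: y)
    have "set (flat_words ! h) \<subseteq> set indices"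
    proof -
      have "\<forall>h\<in>set [0, 1, 2, 3]. set (flat_words ! h) \<subseteq> set indices" by code_simp
      moreover have "h \<in> set [0, 1, 2, 3]" using u(3) by auto
      ultimately show ?thesis by blast
    qed
    moreover have "set u \<subseteq> set indices" using subsystem_words(1) u(1) by blast
    ultimately have "lattice_values ?v (act_sextuple ((flat_words ! h) @ u)) =
        lattice_values (?v \<circ> weyl_word (map of_nat (flat_words ! h)) \<circ> weyl_word (map of_nat u)) param_sextuple"
      by (subst lattice_values_act_sextuple) (auto simp: weyl_word_append o_assoc)
    also have "\<dots> = lattice_values ?v (act_sextuple u)"
      unfolding functional_flat[OF assms(1,2) u(3)]
      using lattice_values_act_sextuple[OF \<open>set u \<subseteq> set indices\<close>, of ?v] by simp
    finally show "P (lattice_values ?v (act_sextuple u)) = ?f (fst y)"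
      using foldr_symmetry[OF linear_functional assms(3) u(2), of 0 x "act_sextuple (subsystem_words ! k)"]
      by (simp add: act y)
  qed
  then show ?thesis
    unfolding subsystem_sum_def by (simp add: flat_table_def)
qed

context
  fixes x :: "nat \<Rightarrow> complex" and s t p q :: complex
  assumes x: "x 0 = - s - t" "x 1 = - s - t" "x 2 = s + p" "x 3 = s - p" "x 4 = t + q" "x 5 = t - q"
begin

text \<open>The four free coordinates are half sums and half differences of \<open>x 2, x 3\<close>
  and of \<open>x 4, x 5\<close>. The elementary symmetric functions are even in \<open>p\<close>
  and \<open>q\<close>, which keeps the expansions manageable.\<close>

lemma flat_values:
  "map (\<lambda>k. lattice_values (functional 0 x) (act_sextuple (subsystem_words ! k))) [0, 1, 3, 6, 8, 14, 15, 19, 24, 25, 28, 33, 34, 36, 38, 39] =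
     [(- 2 * s - t + p, - p + q, s - t + p + q, - p - q, - s - 2 * t - q, s + 2 * t + p), (- 2
      * s - t + p, - p - q, s - t + p - q, - p + q, - s - 2 * t + q, s + 2 * t + p), (- 2 * s -
      t - p, p + q, s - t - p + q, p - q, - s - 2 * t - q, s + 2 * t - p), (- s + t, - s - 2 *
      t + q, 2 * s + t + q, - s - 2 * t - q, - p - q, 2 * p), (- 2 * s - t - p, p - q, s - t -
      p - q, p + q, - s - 2 * t + q, s + 2 * t - p), (- 2 * s - t - p, s - t, 2 * q, p - q, - 2
      * s - t + p, s + 2 * t - p), (0, p + q, s - t - p + q, - 2 * s - t - q, s - t + p - q, s
      + 2 * t - p), (0, p - q, s - t - p - q, - 2 * s - t + q, s - t + p + q, s + 2 * t - p),
      (- p - q, p + q, s - t - p + q, - 2 * s - t + p, - 2 * s - t - p, s - t + p - q), (0, s -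
      t, 2 * q, - 2 * s - t - q, 2 * p, s + 2 * t - p), (- 2 * s - t - p, s - t + p + q, - p +
      q, p - q, s - t - p - q, - 2 * s - t + p), (- s + t, s - t, 2 * q, - s - 2 * t - q, - 2 *
      s - t - p, 2 * p), (0, - s - 2 * t + q, 2 * s + t + q, - 2 * s - t - q, s - t - p - q, 2
      * p), (0, - s - 2 * t - q, 2 * s + t - q, - 2 * s - t + q, s - t - p + q, 2 * p), (0, - 2
      * s - t + p, s + 2 * t + p, - s - 2 * t - p, 2 * q, s - t + p - q), (0, - 2 * s - t - p,
      s + 2 * t - p, - s - 2 * t + p, 2 * q, s - t - p - q)]"
proof -
  have eq: "map (\<lambda>k. lattice_values (functional 0 x) (act_sextuple (subsystem_words ! k))) ks =
      map (lattice_values (functional 0 x)) (map (\<lambda>k. act_sextuple (subsystem_words ! k)) ks)" for ks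
    by (simp only: map_map o_def)
  show ?thesis
    unfolding eq flat_representatives
    by (simp add: functional_lattice_vec x x(2)[unfolded One_nat_def] algebra_simps)
qed

lemmas values_conjuncts = flat_values[unfolded list.map list.inject, THEN conjunct1]
  flat_values[unfolded list.map list.inject, THEN conjunct2, THEN conjunct1]
  flat_values[unfolded list.map list.inject, THEN conjunct2, THEN conjunct2, THEN conjunct1]
  flat_values[unfolded list.map list.inject, THEN conjunct2, THEN conjunct2, THEN conjunct2, THEN conjunct1]
  flat_values[unfolded list.map list.inject, THEN conjunct2, THEN conjunct2, THEN conjunct2, THEN conjunct2, THEN conjunct1]
  flat_values[unfolded list.map list.inject, THEN conjunct2, THEN conjunct2, THEN conjunct2, THEN conjunct2, THEN conjunct2, THEN conjunct1]
  flat_values[unfolded list.map list.inject, THEN conjunct2, THEN conjunct2, THEN conjunct2, THEN conjunct2, THEN conjunct2, THEN conjunct2, THEN conjunct1]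
  flat_values[unfolded list.map list.inject, THEN conjunct2, THEN conjunct2, THEN conjunct2, THEN conjunct2, THEN conjunct2, THEN conjunct2, THEN conjunct2, THEN conjunct1]
  flat_values[unfolded list.map list.inject, THEN conjunct2, THEN conjunct2, THEN conjunct2, THEN conjunct2, THEN conjunct2, THEN conjunct2, THEN conjunct2, THEN conjunct2, THEN conjunct1]
  flat_values[unfolded list.map list.inject, THEN conjunct2, THEN conjunct2, THEN conjunct2, THEN conjunct2, THEN conjunct2, THEN conjunct2, THEN conjunct2, THEN conjunct2, THEN conjunct2, THEN conjunct1]
  flat_values[unfolded list.map list.inject, THEN conjunct2, THEN conjunct2, THEN conjunct2, THEN conjunct2, THEN conjunct2, THEN conjunct2, THEN conjunct2, THEN conjunct2, THEN conjunct2, THEN conjunct2, THEN conjunct1]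
  flat_values[unfolded list.map list.inject, THEN conjunct2, THEN conjunct2, THEN conjunct2, THEN conjunct2, THEN conjunct2, THEN conjunct2, THEN conjunct2, THEN conjunct2, THEN conjunct2, THEN conjunct2, THEN conjunct2, THEN conjunct1]
  flat_values[unfolded list.map list.inject, THEN conjunct2, THEN conjunct2, THEN conjunct2, THEN conjunct2, THEN conjunct2, THEN conjunct2, THEN conjunct2, THEN conjunct2, THEN conjunct2, THEN conjunct2, THEN conjunct2, THEN conjunct2, THEN conjunct1]
  flat_values[unfolded list.map list.inject, THEN conjunct2, THEN conjunct2, THEN conjunct2, THEN conjunct2, THEN conjunct2, THEN conjunct2, THEN conjunct2, THEN conjunct2, THEN conjunct2, THEN conjunct2, THEN conjunct2, THEN conjunct2, THEN conjunct2, THEN conjunct1]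
  flat_values[unfolded list.map list.inject, THEN conjunct2, THEN conjunct2, THEN conjunct2, THEN conjunct2, THEN conjunct2, THEN conjunct2, THEN conjunct2, THEN conjunct2, THEN conjunct2, THEN conjunct2, THEN conjunct2, THEN conjunct2, THEN conjunct2, THEN conjunct2, THEN conjunct1]
  flat_values[unfolded list.map list.inject, THEN conjunct2, THEN conjunct2, THEN conjunct2, THEN conjunct2, THEN conjunct2, THEN conjunct2, THEN conjunct2, THEN conjunct2, THEN conjunct2, THEN conjunct2, THEN conjunct2, THEN conjunct2, THEN conjunct2, THEN conjunct2, THEN conjunct2, THEN conjunct1]

lemma elementary_flat:
  "elementary x 2 = - 2 * s ^ 2 - 2 * s * t - 2 * t ^ 2 - p ^ 2 - q ^ 2"
  "elementary x 3 = - 2 * s ^ 2 * t - 2 * s * t ^ 2 + 2 * s * p ^ 2 + 2 * t * q ^ 2"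
  "elementary x 4 = s ^ 4 + 2 * s ^ 3 * t + 3 * s ^ 2 * t ^ 2 - s ^ 2 * p ^ 2 + 2 * s ^ 2 * q ^ 2 + 2 * s * t
      ^ 3 + 2 * s * t * p ^ 2 + 2 * s * t * q ^ 2 + t ^ 4 + 2 * t ^ 2 * p ^ 2 - t ^ 2 * q ^ 2 +
      p ^ 2 * q ^ 2"
  "elementary x 5 = 2 * s ^ 4 * t + 4 * s ^ 3 * t ^ 2 + 4 * s ^ 2 * t ^ 3 - 2 * s ^ 2 * t * p ^ 2 - 2 * s ^ 2
      * t * q ^ 2 + 2 * s * t ^ 4 - 2 * s * t ^ 2 * p ^ 2 - 2 * s * t ^ 2 * q ^ 2 - 2 * s * p ^
      2 * q ^ 2 - 2 * t * p ^ 2 * q ^ 2"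
  "elementary x 6 = s ^ 4 * t ^ 2 - s ^ 4 * q ^ 2 + 2 * s ^ 3 * t ^ 3 - 2 * s ^ 3 * t * q ^ 2 + s ^ 2 * t ^ 4
      - s ^ 2 * t ^ 2 * p ^ 2 - s ^ 2 * t ^ 2 * q ^ 2 + s ^ 2 * p ^ 2 * q ^ 2 - 2 * s * t ^ 3 *
      p ^ 2 + 2 * s * t * p ^ 2 * q ^ 2 - t ^ 4 * p ^ 2 + t ^ 2 * p ^ 2 * q ^ 2"
  unfolding elementary_def Let_def x by (simp, Groebner_Basis.algebra)+

lemma subsystem_sum_flat_2:
  "subsystem_sum form_2 (functional 0 x) = - 120 * elementary x 2"
proof -
  have "x 0 = x 1" "(\<Sum>i<6. x i) = 0"
    unfolding sum_lessThan_6 x by simp_all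
  note sum = subsystem_sum_flat[of x, OF this symmetric_forms(1)]
  show ?thesis
    unfolding sum elementary_flat list.map prod.case sum_list.Cons sum_list.Nil
    unfolding values_conjuncts
      form_2_def prod.case quad_def cub_def of_nat_numeral of_nat_1 mult_1_left
      add_0_right add_0_left mult_zero_left power_zero_numeral
    by Groebner_Basis.algebra
qed

lemma subsystem_sum_flat_5:
  "subsystem_sum form_5 (functional 0 x) = - 3240 * elementary x 5"
proof -
  have "x 0 = x 1" "(\<Sum>i<6. x i) = 0"
    unfolding sum_lessThan_6 x by simp_all
  note sum = subsystem_sum_flat[of x, OF this symmetric_forms(2)]
  show ?thesis
    unfolding sum elementary_flat list.map prod.case sum_list.Cons sum_list.Nil
    unfolding values_conjuncts
      form_5_def prod.case quad_def cub_def of_nat_numeral of_nat_1 mult_1_left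
      add_0_right add_0_left mult_zero_left power_zero_numeral
    by Groebner_Basis.algebra
qed

lemma subsystem_sum_flat_6:
  "subsystem_sum form_6 (functional 0 x) = - 30 * elementary x 2 ^ 3 + 72 * elementary x 2 * elementary x 4 - 54 * elementary x 3 ^ 2 -
    432 * elementary x 6"
proof -
  have "x 0 = x 1" "(\<Sum>i<6. x i) = 0"
    unfolding sum_lessThan_6 x by simp_all
  note sum = subsystem_sum_flat[of x, OF this symmetric_forms(3)]
  show ?thesis
    unfolding sum elementary_flat list.map prod.case sum_list.Cons sum_list.Nil
    unfolding values_conjuncts
      form_6_def prod.case quad_def cub_def of_nat_numeral of_nat_1 mult_1_left
      add_0_right add_0_left mult_zero_left power_zero_numeral
    by Groebner_Basis.algebra
qed

lemma subsystem_sum_flat_8: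
  "subsystem_sum form_8 (functional 0 x) = 360 * elementary x 2 ^ 4 - 3024 * elementary x 2 ^ 2 * elementary x 4 + 2268 * elementary x
    2 * elementary x 3 ^ 2 + 2592 * elementary x 2 * elementary x 6 - 7776 * elementary x 3 *
    elementary x 5 + 5184 * elementary x 4 ^ 2"
proof -
  have "x 0 = x 1" "(\<Sum>i<6. x i) = 0"
    unfolding sum_lessThan_6 x by simp_all
  note sum = subsystem_sum_flat[of x, OF this symmetric_forms(4)]
  show ?thesis
    unfolding sum elementary_flat list.map prod.case sum_list.Cons sum_list.Nil
    unfolding values_conjuncts
      form_8_def prod.case quad_def cub_def of_nat_numeral of_nat_1 mult_1_left
      add_0_right add_0_left mult_zero_left power_zero_numeral
    by Groebner_Basis.algebra
qed

lemma subsystem_sum_flat_9: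
  "subsystem_sum form_9 (functional 0 x) = - 2106 * elementary x 2 ^ 2 * elementary x 5 - 17496 * elementary x 3 * elementary x 6 +
    5832 * elementary x 4 * elementary x 5"
proof -
  have "x 0 = x 1" "(\<Sum>i<6. x i) = 0"
    unfolding sum_lessThan_6 x by simp_all
  note sum = subsystem_sum_flat[of x, OF this symmetric_forms(5)]
  show ?thesis
    unfolding sum elementary_flat list.map prod.case sum_list.Cons sum_list.Nil
    unfolding values_conjuncts
      form_9_def prod.case quad_def cub_def of_nat_numeral of_nat_1 mult_1_left
      add_0_right add_0_left mult_zero_left power_zero_numeral
    by Groebner_Basis.algebra
qed

lemma subsystem_sum_flat_12:
  "subsystem_sum form_12 (functional 0 x) = 30 * elementary x 2 ^ 6 - 144 * elementary x 2 ^ 4 * elementary x 4 + 108 * elementary x 2 ^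
    3 * elementary x 3 ^ 2 + 900 * elementary x 2 ^ 3 * elementary x 6 + 18 * elementary x 2 ^ 2
    * elementary x 3 * elementary x 5 + 180 * elementary x 2 ^ 2 * elementary x 4 ^ 2 - 288 *
    elementary x 2 * elementary x 3 ^ 2 * elementary x 4 - 2520 * elementary x 2 * elementary x
    4 * elementary x 6 + 252 * elementary x 2 * elementary x 5 ^ 2 + 108 * elementary x 3 ^ 4 +
    2052 * elementary x 3 ^ 2 * elementary x 6 - 108 * elementary x 3 * elementary x 4 *
    elementary x 5 + 48 * elementary x 4 ^ 3 + 7560 * elementary x 6 ^ 2"
proof -
  have "x 0 = x 1" "(\<Sum>i<6. x i) = 0"
    unfolding sum_lessThan_6 x by simp_all
  note sum = subsystem_sum_flat[of x, OF this symmetric_forms(6)]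
  show ?thesis
    unfolding sum elementary_flat list.map prod.case sum_list.Cons sum_list.Nil
    unfolding values_conjuncts
      form_12_def prod.case quad_def cub_def of_nat_numeral of_nat_1 mult_1_left
      add_0_right add_0_left mult_zero_left power_zero_numeral
    by Groebner_Basis.algebra
qed

end

subsection \<open>The general case\<close>

lemma flat_parametrization:
  assumes "(\<Sum>i<6. x i) = (0 :: complex)" "x 0 = x 1"
  obtains s t p q where "x 0 = - s - t" "x 1 = - s - t" "x 2 = s + p" "x 3 = s - p" "x 4 = t + q" "x (5 :: nat) = t - q"
proof (rule that[of "(x 2 + x 3) / 2" "(x 4 + x 5) / 2" "(x 2 - x 3) / 2" "(x 4 - x 5) / 2"])
  show "x 0 = - ((x 2 + x 3) / 2) - (x 4 + x 5) / 2" "x 1 = - ((x 2 + x 3) / 2) - (x 4 + x 5) / 2"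
  proof -
    have "2 * x 1 = - (x 2 + x 3) - (x 4 + x 5)"
      using assms unfolding sum_lessThan_6 by Groebner_Basis.algebra
    then have "x 1 = (- (x 2 + x 3) - (x 4 + x 5)) / 2"
      by (simp add: eq_divide_eq mult.commute)
    then show "x 0 = - ((x 2 + x 3) / 2) - (x 4 + x 5) / 2" "x 1 = - ((x 2 + x 3) / 2) - (x 4 + x 5) / 2"
      by (simp_all only: assms(2) diff_divide_distrib minus_divide_left)
  qed
qed (simp_all add: field_simps)

lemmas weight_sums = weight_sum_2 weight_sum_5 weight_sum_6 weight_sum_8 weight_sum_9 weight_sum_12

text \<open>The difference of the two sides fulfils the hypotheses of
  \<open>weyl_invariant_eq_0\<close>. The factor \<open>c\<close> clears the denominators of the
  coefficients in \<open>H\<close>.\<close>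

lemma subsystem_sum_eqI:
  assumes P: "symmetric_form P" "\<And>v d. polynomial_le 12 (\<lambda>t. subsystem_sum P (\<lambda>r. v r + t * d r))"
    and H: "\<And>v i. H (v \<circ> simple_reflection i) = H v" "\<And>v d. polynomial_le 14 (\<lambda>t. H (\<lambda>r. v r + t * d r))"
    and flat: "\<And>x. (\<Sum>i<6. x i) = 0 \<Longrightarrow> x 0 = x 1 \<Longrightarrow>
      c * subsystem_sum P (functional 0 x) = H (functional 0 x)"
    and v: "linear v"
  shows "c * subsystem_sum P v = H v"
proof -
  let ?G = "\<lambda>v. c * subsystem_sum P v - H v"
  have "?G v = 0"
  proof (rule weyl_invariant_eq_0[of ?G])
    show "?G (v \<circ> simple_reflection i) = ?G v" if "linear v" for v i
      by (simp only: subsystem_sum_simple_reflection[OF that P(1)] H(1))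
    show "\<exists>p. degree p \<le> 14 \<and> (\<forall>t. ?G (\<lambda>r. v r + t * d r) = poly p t)" for v d
      unfolding polynomial_le_def[symmetric]
      by (rule polynomial_le_mono, rule polynomial_le_diff, rule polynomial_le_mult,
          rule polynomial_le_const, rule P(2), rule H(2)) simp
  qed (use v flat in simp_all)
  then show ?thesis by simp
qed

text \<open>The power sums of degrees 2, 5, 6, 8, 9 and 12 of the weights generate the invariants of
  E6. Here and in the next five lemmas, the right-hand side is a combination of all monomials of the
  given degree in these power sums; the coefficients are forced by the values for
  \<open>l = 0\<close>, \<open>x 0 = x 1\<close>.\<close>

lemma subsystem_sum_2_weights:
  assumes "linear v"
  shows "1 * subsystem_sum form_2 v = 10 * weight_sum 2 v"
proof (rule subsystem_sum_eqI[OF symmetric_forms(1) polynomial_le_forms(1) _ _ _ assms])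
  show "polynomial_le 14 (\<lambda>t. 10 * weight_sum 2 (\<lambda>r. v r + t * d r))" for v d
    by (rule polynomial_le_mono,
        (rule polynomial_le_add polynomial_le_diff polynomial_le_mult polynomial_le_minus polynomial_le_power
          polynomial_le_weight_sum polynomial_le_const)+) simp
  show "1 * subsystem_sum form_2 (functional 0 x) = 10 * weight_sum 2 (functional 0 x)"
    if x: "(\<Sum>i<6. x i) = 0" "x 0 = x 1" for x
  proof -
    obtain s t p q where "x 0 = - s - t" "x 1 = - s - t" "x 2 = s + p" "x 3 = s - p" "x 4 = t + q" "x 5 = t - q"
      using flat_parametrization[OF x] .
    note sum = subsystem_sum_flat_2[OF this]
    show ?thesis
      unfolding sum weight_sums[OF x(1)] by (simp; Groebner_Basis.algebra)
  qed
qed (simp only: weight_sum_simple_reflection)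

lemma subsystem_sum_5_weights:
  assumes "linear v"
  shows "1 * subsystem_sum form_5 v = 54 * weight_sum 5 v"
proof (rule subsystem_sum_eqI[OF symmetric_forms(2) polynomial_le_forms(2) _ _ _ assms])
  show "polynomial_le 14 (\<lambda>t. 54 * weight_sum 5 (\<lambda>r. v r + t * d r))" for v d
    by (rule polynomial_le_mono,
        (rule polynomial_le_add polynomial_le_diff polynomial_le_mult polynomial_le_minus polynomial_le_power
          polynomial_le_weight_sum polynomial_le_const)+) simp
  show "1 * subsystem_sum form_5 (functional 0 x) = 54 * weight_sum 5 (functional 0 x)"
    if x: "(\<Sum>i<6. x i) = 0" "x 0 = x 1" for x
  proof -
    obtain s t p q where "x 0 = - s - t" "x 1 = - s - t" "x 2 = s + p" "x 3 = s - p" "x 4 = t + q" "x 5 = t - q"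
      using flat_parametrization[OF x] .
    note sum = subsystem_sum_flat_5[OF this]
    show ?thesis
      unfolding sum weight_sums[OF x(1)] by (simp; Groebner_Basis.algebra)
  qed
qed (simp only: weight_sum_simple_reflection)

lemma subsystem_sum_6_weights:
  assumes "linear v"
  shows "288 * subsystem_sum form_6 v = - 864 * weight_sum 6 v + 11 * weight_sum 2 v ^ 3"
proof (rule subsystem_sum_eqI[OF symmetric_forms(3) polynomial_le_forms(3) _ _ _ assms])
  show "polynomial_le 14 (\<lambda>t. - 864 * weight_sum 6 (\<lambda>r. v r + t * d r) + 11 * weight_sum 2 (\<lambda>r. v r + t * d r) ^ 3)" for v d
    by (rule polynomial_le_mono,
        (rule polynomial_le_add polynomial_le_diff polynomial_le_mult polynomial_le_minus polynomial_le_power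
          polynomial_le_weight_sum polynomial_le_const)+) simp
  show "288 * subsystem_sum form_6 (functional 0 x) = - 864 * weight_sum 6 (functional 0 x) + 11 * weight_sum 2 (functional 0 x) ^ 3"
    if x: "(\<Sum>i<6. x i) = 0" "x 0 = x 1" for x
  proof -
    obtain s t p q where "x 0 = - s - t" "x 1 = - s - t" "x 2 = s + p" "x 3 = s - p" "x 4 = t + q" "x 5 = t - q"
      using flat_parametrization[OF x] .
    note sum = subsystem_sum_flat_6[OF this]
    show ?thesis
      unfolding sum weight_sums[OF x(1)] by (simp; Groebner_Basis.algebra)
  qed
qed (simp only: weight_sum_simple_reflection)

lemma subsystem_sum_8_weights:
  assumes "linear v"
  shows "360 * subsystem_sum form_8 v = 23328 * weight_sum 8 v - 8964 * weight_sum 2 v * weight_sum 6 v + 55 * weight_sum 2 v ^ 4"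
proof (rule subsystem_sum_eqI[OF symmetric_forms(4) polynomial_le_forms(4) _ _ _ assms])
  show "polynomial_le 14 (\<lambda>t. 23328 * weight_sum 8 (\<lambda>r. v r + t * d r) - 8964 * weight_sum 2 (\<lambda>r. v r + t * d r) * weight_sum 6 (\<lambda>r. v r + t * d r) + 55 * weight_sum 2 (\<lambda>r. v r + t * d r) ^ 4)" for v d
    by (rule polynomial_le_mono,
        (rule polynomial_le_add polynomial_le_diff polynomial_le_mult polynomial_le_minus polynomial_le_power
          polynomial_le_weight_sum polynomial_le_const)+) simp
  show "360 * subsystem_sum form_8 (functional 0 x) = 23328 * weight_sum 8 (functional 0 x) - 8964 * weight_sum 2 (functional 0 x) * weight_sum 6 (functional 0 x) + 55 * weight_sum 2 (functional 0 x) ^ 4"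
    if x: "(\<Sum>i<6. x i) = 0" "x 0 = x 1" for x
  proof -
    obtain s t p q where "x 0 = - s - t" "x 1 = - s - t" "x 2 = s + p" "x 3 = s - p" "x 4 = t + q" "x 5 = t - q"
      using flat_parametrization[OF x] .
    note sum = subsystem_sum_flat_8[OF this]
    show ?thesis
      unfolding sum weight_sums[OF x(1)] by (simp; Groebner_Basis.algebra)
  qed
qed (simp only: weight_sum_simple_reflection)

lemma subsystem_sum_9_weights:
  assumes "linear v"
  shows "224 * subsystem_sum form_9 v = - 5184 * weight_sum 9 v + 357 * weight_sum 2 v ^ 2 * weight_sum 5 v"
proof (rule subsystem_sum_eqI[OF symmetric_forms(5) polynomial_le_forms(5) _ _ _ assms])
  show "polynomial_le 14 (\<lambda>t. - 5184 * weight_sum 9 (\<lambda>r. v r + t * d r) + 357 * weight_sum 2 (\<lambda>r. v r + t * d r) ^ 2 * weight_sum 5 (\<lambda>r. v r + t * d r))" for v d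
    by (rule polynomial_le_mono,
        (rule polynomial_le_add polynomial_le_diff polynomial_le_mult polynomial_le_minus polynomial_le_power
          polynomial_le_weight_sum polynomial_le_const)+) simp
  show "224 * subsystem_sum form_9 (functional 0 x) = - 5184 * weight_sum 9 (functional 0 x) + 357 * weight_sum 2 (functional 0 x) ^ 2 * weight_sum 5 (functional 0 x)"
    if x: "(\<Sum>i<6. x i) = 0" "x 0 = x 1" for x
  proof -
    obtain s t p q where "x 0 = - s - t" "x 1 = - s - t" "x 2 = s + p" "x 3 = s - p" "x 4 = t + q" "x 5 = t - q"
      using flat_parametrization[OF x] .
    note sum = subsystem_sum_flat_9[OF this]
    show ?thesis
      unfolding sum weight_sums[OF x(1)] by (simp; Groebner_Basis.algebra)
  qed
qed (simp only: weight_sum_simple_reflection)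

lemma subsystem_sum_12_weights:
  assumes "linear v"
  shows "24883200 * subsystem_sum form_12 v = 4976640 * weight_sum 12 v + 8017920 * weight_sum 6 v ^ 2 - 594432 * weight_sum 2 v * weight_sum 5 v ^ 2 - 457920 * weight_sum 2 v ^ 2 * weight_sum 8 v - 119040 * weight_sum 2 v ^ 3 * weight_sum 6 v + 935 * weight_sum 2 v ^ 6"
proof (rule subsystem_sum_eqI[OF symmetric_forms(6) polynomial_le_forms(6) _ _ _ assms])
  show "polynomial_le 14 (\<lambda>t. 4976640 * weight_sum 12 (\<lambda>r. v r + t * d r) + 8017920 * weight_sum 6 (\<lambda>r. v r + t * d r) ^ 2 - 594432 * weight_sum 2 (\<lambda>r. v r + t * d r) * weight_sum 5 (\<lambda>r. v r + t * d r) ^ 2 - 457920 * weight_sum 2 (\<lambda>r. v r + t * d r) ^ 2 * weight_sum 8 (\<lambda>r. v r + t * d r) - 119040 * weight_sum 2 (\<lambda>r. v r + t * d r) ^ 3 * weight_sum 6 (\<lambda>r. v r + t * d r) + 935 * weight_sum 2 (\<lambda>r. v r + t * d r) ^ 6)" for v d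
    by (rule polynomial_le_mono,
        (rule polynomial_le_add polynomial_le_diff polynomial_le_mult polynomial_le_minus polynomial_le_power
          polynomial_le_weight_sum polynomial_le_const)+) simp
  show "24883200 * subsystem_sum form_12 (functional 0 x) = 4976640 * weight_sum 12 (functional 0 x) + 8017920 * weight_sum 6 (functional 0 x) ^ 2 - 594432 * weight_sum 2 (functional 0 x) * weight_sum 5 (functional 0 x) ^ 2 - 457920 * weight_sum 2 (functional 0 x) ^ 2 * weight_sum 8 (functional 0 x) - 119040 * weight_sum 2 (functional 0 x) ^ 3 * weight_sum 6 (functional 0 x) + 935 * weight_sum 2 (functional 0 x) ^ 6"
    if x: "(\<Sum>i<6. x i) = 0" "x 0 = x 1" for x
  proof -
    obtain s t p q where "x 0 = - s - t" "x 1 = - s - t" "x 2 = s + p" "x 3 = s - p" "x 4 = t + q" "x 5 = t - q"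
      using flat_parametrization[OF x] .
    note sum = subsystem_sum_flat_12[OF this]
    show ?thesis
      unfolding sum weight_sums[OF x(1)] by (simp; Groebner_Basis.algebra)
  qed
qed (simp only: weight_sum_simple_reflection)

lemma subsystem_sum_2:
  assumes "(\<Sum>i<6. x i) = 0"
  shows "subsystem_sum form_2 (functional l x) = 120 * l ^ 2 - 120 * elementary x 2"
    (is "_ = ?rhs")
proof -
  have "1 * subsystem_sum form_2 (functional l x) = 1 * ?rhs"
    unfolding subsystem_sum_2_weights[OF linear_functional] weight_sums[OF assms]
    by Groebner_Basis.algebra
  then show ?thesis by (rule mult_left_cancel[THEN iffD1, rotated]) simp
qed

lemma subsystem_sum_5:
  assumes "(\<Sum>i<6. x i) = 0"
  shows "subsystem_sum form_5 (functional l x) = - 3240 * l ^ 2 * elementary x 3 - 3240 * elementary x 5"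
    (is "_ = ?rhs")
proof -
  have "1 * subsystem_sum form_5 (functional l x) = 1 * ?rhs"
    unfolding subsystem_sum_5_weights[OF linear_functional] weight_sums[OF assms]
    by Groebner_Basis.algebra
  then show ?thesis by (rule mult_left_cancel[THEN iffD1, rotated]) simp
qed

lemma subsystem_sum_6:
  assumes "(\<Sum>i<6. x i) = 0"
  shows "subsystem_sum form_6 (functional l x) = 30 * l ^ 6 - 18 * l ^ 4 * elementary x 2 + 18 * l ^ 2 * elementary x 2 ^ 2 + 360 * l ^ 2 *
    elementary x 4 - 30 * elementary x 2 ^ 3 + 72 * elementary x 2 * elementary x 4 - 54 *
    elementary x 3 ^ 2 - 432 * elementary x 6"
    (is "_ = ?rhs")
proof -
  have "288 * subsystem_sum form_6 (functional l x) = 288 * ?rhs"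
    unfolding subsystem_sum_6_weights[OF linear_functional] weight_sums[OF assms]
    by Groebner_Basis.algebra
  then show ?thesis by (rule mult_left_cancel[THEN iffD1, rotated]) simp
qed

lemma subsystem_sum_8:
  assumes "(\<Sum>i<6. x i) = 0"
  shows "subsystem_sum form_8 (functional l x) = 360 * l ^ 8 + 1584 * l ^ 6 * elementary x 2 + 1296 * l ^ 4 * elementary x 2 ^ 2 - 432 * l ^
    4 * elementary x 4 + 1584 * l ^ 2 * elementary x 2 ^ 3 - 6912 * l ^ 2 * elementary x 2 *
    elementary x 4 + 5508 * l ^ 2 * elementary x 3 ^ 2 - 64800 * l ^ 2 * elementary x 6 + 360 *
    elementary x 2 ^ 4 - 3024 * elementary x 2 ^ 2 * elementary x 4 + 2268 * elementary x 2 *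
    elementary x 3 ^ 2 + 2592 * elementary x 2 * elementary x 6 - 7776 * elementary x 3 *
    elementary x 5 + 5184 * elementary x 4 ^ 2"
    (is "_ = ?rhs")
proof -
  have "360 * subsystem_sum form_8 (functional l x) = 360 * ?rhs"
    unfolding subsystem_sum_8_weights[OF linear_functional] weight_sums[OF assms]
    by Groebner_Basis.algebra
  then show ?thesis by (rule mult_left_cancel[THEN iffD1, rotated]) simp
qed

lemma subsystem_sum_9:
  assumes "(\<Sum>i<6. x i) = 0"
  shows "subsystem_sum form_9 (functional l x) = - 2106 * l ^ 6 * elementary x 3 - 1620 * l ^ 4 * elementary x 2 * elementary x 3 + 15390 * l
    ^ 4 * elementary x 5 - 2106 * l ^ 2 * elementary x 2 ^ 2 * elementary x 3 + 15876 * l ^ 2 *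
    elementary x 2 * elementary x 5 - 11664 * l ^ 2 * elementary x 3 * elementary x 4 - 2106 *
    elementary x 2 ^ 2 * elementary x 5 - 17496 * elementary x 3 * elementary x 6 + 5832 *
    elementary x 4 * elementary x 5"
    (is "_ = ?rhs")
proof -
  have "224 * subsystem_sum form_9 (functional l x) = 224 * ?rhs"
    unfolding subsystem_sum_9_weights[OF linear_functional] weight_sums[OF assms]
    by Groebner_Basis.algebra
  then show ?thesis by (rule mult_left_cancel[THEN iffD1, rotated]) simp
qed

lemma subsystem_sum_12:
  assumes "(\<Sum>i<6. x i) = 0"
  shows "subsystem_sum form_12 (functional l x) = 30 * l ^ 12 - 36 * l ^ 10 * elementary x 2 + 54 * l ^ 8 * elementary x 2 ^ 2 + 756 * l ^ 8 *
    elementary x 4 - 144 * l ^ 6 * elementary x 2 ^ 3 + 36 * l ^ 6 * elementary x 2 * elementary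
    x 4 - 378 * l ^ 6 * elementary x 3 ^ 2 - 1404 * l ^ 6 * elementary x 6 + 54 * l ^ 4 *
    elementary x 2 ^ 4 + 180 * l ^ 4 * elementary x 2 ^ 2 * elementary x 4 + 216 * l ^ 4 *
    elementary x 2 * elementary x 3 ^ 2 - 540 * l ^ 4 * elementary x 2 * elementary x 6 - 162 *
    l ^ 4 * elementary x 3 * elementary x 5 + 5220 * l ^ 4 * elementary x 4 ^ 2 - 36 * l ^ 2 *
    elementary x 2 ^ 5 - 684 * l ^ 2 * elementary x 2 ^ 3 * elementary x 4 - 54 * l ^ 2 *
    elementary x 2 ^ 2 * elementary x 3 ^ 2 - 684 * l ^ 2 * elementary x 2 ^ 2 * elementary x 6
    + 900 * l ^ 2 * elementary x 2 * elementary x 3 * elementary x 5 + 2016 * l ^ 2 * elementary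
    x 2 * elementary x 4 ^ 2 - 1656 * l ^ 2 * elementary x 3 ^ 2 * elementary x 4 - 10872 * l ^
    2 * elementary x 4 * elementary x 6 - 900 * l ^ 2 * elementary x 5 ^ 2 + 30 * elementary x 2
    ^ 6 - 144 * elementary x 2 ^ 4 * elementary x 4 + 108 * elementary x 2 ^ 3 * elementary x 3
    ^ 2 + 900 * elementary x 2 ^ 3 * elementary x 6 + 18 * elementary x 2 ^ 2 * elementary x 3 *
    elementary x 5 + 180 * elementary x 2 ^ 2 * elementary x 4 ^ 2 - 288 * elementary x 2 *
    elementary x 3 ^ 2 * elementary x 4 - 2520 * elementary x 2 * elementary x 4 * elementary x
    6 + 252 * elementary x 2 * elementary x 5 ^ 2 + 108 * elementary x 3 ^ 4 + 2052 * elementary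
    x 3 ^ 2 * elementary x 6 - 108 * elementary x 3 * elementary x 4 * elementary x 5 + 48 *
    elementary x 4 ^ 3 + 7560 * elementary x 6 ^ 2"
    (is "_ = ?rhs")
proof -
  have "24883200 * subsystem_sum form_12 (functional l x) = 24883200 * ?rhs"
    unfolding subsystem_sum_12_weights[OF linear_functional] weight_sums[OF assms]
    by Groebner_Basis.algebra
  then show ?thesis by (rule mult_left_cancel[THEN iffD1, rotated]) simp
qed

section \<open>Representations of the algebra given by generators and relations\<close>

lemma lookup_cscale: "Poly_Mapping.lookup (c *\<^sub>C v) k = c * Poly_Mapping.lookup v k"
  by (simp add: cscale_def map.rep_eq when_def)

lemma vector_space_cscale: "vector_space ((*\<^sub>C) :: complex \<Rightarrow> ('a \<Rightarrow>\<^sub>0 complex) \<Rightarrow> _)"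
  by unfold_locales (simp_all add: poly_mapping_eq_iff fun_eq_iff lookup_cscale lookup_add algebra_simps)

lemmas linear_cscale_iff = Vector_Spaces.linear_iff[of "(*\<^sub>C)" "(*\<^sub>C)"]

lemma cscale_simps:
  "c *\<^sub>C (u + v) = c *\<^sub>C u + c *\<^sub>C v" "(a + b) *\<^sub>C v = a *\<^sub>C v + b *\<^sub>C v"
  "a *\<^sub>C b *\<^sub>C v = (a * b) *\<^sub>C v" "1 *\<^sub>C v = v" "0 *\<^sub>C v = 0" "c *\<^sub>C 0 = 0"
  by (simp_all add: poly_mapping_eq_iff fun_eq_iff lookup_cscale lookup_add algebra_simps)

lemma cscale_sum: "c *\<^sub>C (\<Sum>i\<in>S. f i) = (\<Sum>i\<in>S. c *\<^sub>C f i)"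
  by (induction S rule: infinite_finite_induct) (simp_all add: cscale_simps)

lemma free_alg_induct [case_names single add]:
  fixes a :: free_alg
  assumes "\<And>w c. P (Poly_Mapping.single w c)" and "\<And>a b. P a \<Longrightarrow> P b \<Longrightarrow> P (a + b)"
  shows "P a"
proof -
  have "P (\<Sum>w\<in>S. Poly_Mapping.single w (f w))" if "finite S" for S and f :: "nc_word \<Rightarrow> complex"
    using that assms(1)[of 0 0] by (induction S) (simp_all add: assms)
  from this[of "Poly_Mapping.keys a" "Poly_Mapping.lookup a"]
  have "P (\<Sum>w\<in>Poly_Mapping.keys a. Poly_Mapping.single w (Poly_Mapping.lookup a w))" by simp
  also have "(\<Sum>w\<in>Poly_Mapping.keys a. Poly_Mapping.single w (Poly_Mapping.lookup a w)) = a"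
    by (auto simp: poly_mapping_eq_iff fun_eq_iff lookup_sum lookup_single when_def in_keys_iff sum.delta)
  finally show ?thesis .
qed

text \<open>Scalars are multiples of the empty word. Hence ideals of the ring are closed under
  scalar multiplication, and \<open>evaluation\<close> respects it.\<close>

lemma cscale_eq_mult: "c *\<^sub>C (a :: free_alg) = Poly_Mapping.single 0 c * a"
proof (induction a rule: free_alg_induct)
  case (single w d)
  show ?case
    by (simp add: mult_single poly_mapping_eq_iff fun_eq_iff lookup_cscale lookup_single when_def)
next
  case (add a b)
  then show ?case by (simp add: cscale_simps distrib_left)
qed

section \<open>Evaluation of noncommutative polynomials at two operators\<close>

context
  fixes X Y :: "zspace \<Rightarrow> zspace"
  assumes X: "X \<in> carrier End_zspace" and Y: "Y \<in> carrier End_zspace"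
begin

definition letter_operator :: "letter \<Rightarrow> zspace \<Rightarrow> zspace" where
  "letter_operator a = (case a of LX \<Rightarrow> X | LY \<Rightarrow> Y)"

primrec word_operator :: "nc_word \<Rightarrow> zspace \<Rightarrow> zspace" where
  "word_operator (NC_Word w) = foldr (\<lambda>a T. letter_operator a \<circ> T) w id"

lemma word_operator_plus: "word_operator (u + w) = word_operator u \<circ> word_operator w"
proof -
  have "foldr (\<lambda>a T. letter_operator a \<circ> T) u S = foldr (\<lambda>a T. letter_operator a \<circ> T) u id \<circ> S" for u S
    by (induction u) (simp_all add: o_assoc)
  note fold = this
  obtain ls ms where "u = NC_Word ls" "w = NC_Word ms" by (cases u; cases w) blast
  then show ?thesis
    using fold[of ls "word_operator w"] by (simp only: plus_nc_word.simps word_operator.simps foldr_append o_apply)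
qed

lemma word_operator_zero: "word_operator 0 = id"
  by (simp add: zero_nc_word_def)

lemma word_operator_linear:
  "word_operator w (u + v) = word_operator w u + word_operator w v"
  "word_operator w (c *\<^sub>C v) = c *\<^sub>C word_operator w v"
proof -
  have l: "letter_operator a (u + v) = letter_operator a u + letter_operator a v"
    "letter_operator a (c *\<^sub>C v) = c *\<^sub>C letter_operator a v" for a u v c
    using X Y by (auto simp: letter_operator_def End_zspace_def linear_cscale_iff split: letter.split)
  obtain ls where w: "w = NC_Word ls" by (cases w)
  show "word_operator w (u + v) = word_operator w u + word_operator w v"
    "word_operator w (c *\<^sub>C v) = c *\<^sub>C word_operator w v"
    unfolding w by (induction ls) (simp_all add: l)
qed

definition evaluation :: "free_alg \<Rightarrow> zspace \<Rightarrow> zspace" where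
  "evaluation a v = (\<Sum>w\<in>Poly_Mapping.keys a. Poly_Mapping.lookup a w *\<^sub>C word_operator w v)"

lemma evaluation_superset:
  assumes "finite S" "Poly_Mapping.keys a \<subseteq> S"
  shows "evaluation a v = (\<Sum>w\<in>S. Poly_Mapping.lookup a w *\<^sub>C word_operator w v)"
  unfolding evaluation_def using assms
  by (intro sum.mono_neutral_left) (auto simp: in_keys_iff cscale_simps)

lemma evaluation_add: "evaluation (a + b) v = evaluation a v + evaluation b v"
proof -
  let ?S = "Poly_Mapping.keys a \<union> Poly_Mapping.keys b"
  have S: "finite ?S" by simp
  show ?thesis
    using keys_add[of a b]
    by (subst (1 2 3) evaluation_superset[OF S]) (auto simp: lookup_add cscale_simps sum.distrib)
qed

lemma evaluation_single: "evaluation (Poly_Mapping.single w c) v = c *\<^sub>C word_operator w v"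
  by (subst evaluation_superset[of "{w}"]) auto

lemma evaluation_linear:
  "evaluation a (u + v) = evaluation a u + evaluation a v"
  "evaluation a (c *\<^sub>C v) = c *\<^sub>C evaluation a v"
  by (simp_all add: evaluation_def word_operator_linear cscale_simps sum.distrib cscale_sum mult.commute)

lemma evaluation_zero: "evaluation a 0 = 0"
  using evaluation_linear(2)[of a 0 0] by (simp add: cscale_simps)

lemma evaluation_mult: "evaluation (a * b) = evaluation a \<circ> evaluation b"
proof (induction a rule: free_alg_induct)
  case (single w c)
  show ?case
  proof (induction b rule: free_alg_induct)
    case (single u d)
    show ?case
      by (simp add: fun_eq_iff mult_single evaluation_single word_operator_plus word_operator_linear cscale_simps)
  next
    case (add a b)
    then show ?case by (simp add: fun_eq_iff distrib_left evaluation_add evaluation_linear)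
  qed
next
  case (add a b)
  then show ?case by (simp add: fun_eq_iff distrib_right evaluation_add)
qed

lemma evaluation_one: "evaluation 1 = id"
  using evaluation_single[of 0 1] by (simp add: fun_eq_iff word_operator_zero cscale_simps)

lemma evaluation_cscale: "evaluation (c *\<^sub>C a) v = c *\<^sub>C evaluation a v"
  by (simp add: cscale_eq_mult evaluation_mult evaluation_single zero_nc_word_def cscale_simps)

lemma evaluation_0: "evaluation 0 v = 0"
  by (simp add: evaluation_def)

lemma evaluation_minus: "evaluation (- a) v = - evaluation a v"
  using evaluation_add[of a "- a" v] by (simp add: evaluation_0 eq_neg_iff_add_eq_0 add.commute)

lemma evaluation_diff: "evaluation (a - b) v = evaluation a v - evaluation b v"
  using evaluation_add[of a "- b" v] by (simp add: evaluation_minus)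

lemma evaluation_numeral: "evaluation (numeral n) v = numeral n *\<^sub>C v"
proof -
  have "numeral n = (numeral n *\<^sub>C 1 :: free_alg)"
    by (simp add: cscale_eq_mult flip: single_numeral)
  then show ?thesis by (metis evaluation_cscale evaluation_one id_apply)
qed

lemma evaluation_gen: "evaluation gen_X = X" "evaluation gen_Y = Y"
  by (simp_all add: fun_eq_iff gen_X_def gen_Y_def evaluation_single letter_operator_def cscale_simps)

lemma ring_free_algebra: "ring free_algebra"
proof (rule ringI)
  show "abelian_group free_algebra"
  proof (rule abelian_groupI)
    fix x :: free_alg
    show "\<exists>y\<in>carrier free_algebra. y \<oplus>\<^bsub>free_algebra\<^esub> x = \<zero>\<^bsub>free_algebra\<^esub>"
      by (rule bexI[of _ "- x"]) (simp_all add: free_algebra_def)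
  qed (simp_all add: free_algebra_def add_ac)
  show "monoid free_algebra"
    by (rule monoidI) (simp_all add: free_algebra_def mult.assoc)
qed (simp_all add: free_algebra_def distrib_left distrib_right)

lemma ideal_evaluation_kernel: "ideal {a. evaluation a = (\<lambda>v. 0)} free_algebra"
proof (rule idealI[OF ring_free_algebra])
  show "subgroup {a. evaluation a = (\<lambda>v. 0)} (add_monoid free_algebra)"
  proof (rule group.subgroupI)
    show "group (add_monoid free_algebra)"
      using ring_free_algebra by (simp add: ring_def abelian_group_def abelian_group_axioms_def comm_group_def)
    fix a assume a: "a \<in> {a. evaluation a = (\<lambda>v. 0)}"
    have "inv\<^bsub>add_monoid free_algebra\<^esub> a = - a"
      using ring_free_algebra
      by (intro group.inv_equality) (simp_all add: ring_def abelian_group_def abelian_group_axioms_def comm_group_def free_algebra_def)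
    with a show "inv\<^bsub>add_monoid free_algebra\<^esub> a \<in> {a. evaluation a = (\<lambda>v. 0)}"
      by (simp add: fun_eq_iff evaluation_minus)
  qed (auto simp: free_algebra_def fun_eq_iff evaluation_add intro!: exI[of _ 0] evaluation_0)
qed (auto simp: free_algebra_def evaluation_mult fun_eq_iff evaluation_zero)

theorem quotient_representation:
  assumes relations: "\<And>r. r \<in> R \<Longrightarrow> evaluation r = (\<lambda>v. 0)"
  defines "I \<equiv> genideal free_algebra R"
  shows "\<exists>\<rho> \<in> complex_alg_hom (quotient_alg free_algebra I) End_zspace.
    \<rho> (I +>\<^bsub>free_algebra\<^esub> gen_X) = X \<and> \<rho> (I +>\<^bsub>free_algebra\<^esub> gen_Y) = Y"
proof -
  interpret ideal I free_algebra
    unfolding I_def by (rule ring.genideal_ideal[OF ring_free_algebra]) (simp add: free_algebra_def)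
  have kernel: "evaluation i = (\<lambda>v. 0)" if "i \<in> I" for i
  proof -
    have "I \<subseteq> {a. evaluation a = (\<lambda>v. 0)}"
      unfolding I_def
      by (rule ring.genideal_minimal[OF ring_free_algebra ideal_evaluation_kernel]) (use relations in auto)
    with that show ?thesis by blast
  qed
  have coset: "I +>\<^bsub>free_algebra\<^esub> a = (\<lambda>i. i + a) ` I" for a
    by (auto simp: a_r_coset_def' free_algebra_def)
  have mem: "a \<in> I +>\<^bsub>free_algebra\<^esub> a" for a
    using a_rcos_self[of a] by (simp add: free_algebra_def)
  \<comment> \<open>The chosen element does not matter: members of a coset differ by an element of
    \<open>I\<close>, on which \<open>evaluation\<close> vanishes.\<close>
  define \<rho> where "\<rho> A = evaluation (SOME a. a \<in> A)" for A
  have \<rho>: "\<rho> (I +>\<^bsub>free_algebra\<^esub> a) = evaluation a" for a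
  proof -
    have "(SOME b. b \<in> I +>\<^bsub>free_algebra\<^esub> a) \<in> I +>\<^bsub>free_algebra\<^esub> a"
      using mem by (rule someI)
    then obtain i where "i \<in> I" "(SOME b. b \<in> I +>\<^bsub>free_algebra\<^esub> a) = i + a"
      unfolding coset by auto
    then show ?thesis by (simp add: \<rho>_def fun_eq_iff evaluation_add kernel)
  qed
  let ?Q = "quotient_alg free_algebra I"
  have carrier: "carrier ?Q = range (\<lambda>a. I +>\<^bsub>free_algebra\<^esub> a)"
    by (auto simp: quotient_alg_def ring.defs module.defs FactRing_def A_RCOSETS_def' free_algebra_def)
  have mult: "(I +>\<^bsub>free_algebra\<^esub> a) \<otimes>\<^bsub>?Q\<^esub> (I +>\<^bsub>free_algebra\<^esub> b) = I +>\<^bsub>free_algebra\<^esub> (a * b)" for a b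
    using rcoset_mult_add[of a b] by (simp add: quotient_alg_def ring.defs module.defs FactRing_def free_algebra_def)
  have add: "(I +>\<^bsub>free_algebra\<^esub> a) \<oplus>\<^bsub>?Q\<^esub> (I +>\<^bsub>free_algebra\<^esub> b) = I +>\<^bsub>free_algebra\<^esub> (a + b)" for a b
    using a_rcos_sum[of a b] by (simp add: quotient_alg_def ring.defs module.defs FactRing_def free_algebra_def)
  have one: "\<one>\<^bsub>?Q\<^esub> = I +>\<^bsub>free_algebra\<^esub> 1"
    by (simp add: quotient_alg_def ring.defs module.defs FactRing_def free_algebra_def)
  \<comment> \<open>\<open>quotient_alg\<close> forms the union of the cosets of all multiples
    \<open>c *\<^sub>C b\<close>. They coincide, because scalars act as left multiplications and
    \<open>I\<close> absorbs these.\<close>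
  have smult: "c \<odot>\<^bsub>?Q\<^esub> (I +>\<^bsub>free_algebra\<^esub> a) = I +>\<^bsub>free_algebra\<^esub> (c *\<^sub>C a)" for c a
  proof -
    have "I +>\<^bsub>free_algebra\<^esub> (c *\<^sub>C b) = I +>\<^bsub>free_algebra\<^esub> (c *\<^sub>C a)" if b: "b \<in> I +>\<^bsub>free_algebra\<^esub> a" for b
    proof -
      obtain i where i: "i \<in> I" "b = i + a" using b unfolding coset by auto
      have "c *\<^sub>C i \<in> I"
        using I_l_closed[OF i(1), of "Poly_Mapping.single 0 c"] by (simp add: cscale_eq_mult free_algebra_def)
      then have "c *\<^sub>C b \<in> I +>\<^bsub>free_algebra\<^esub> (c *\<^sub>C a)"
        unfolding coset i(2) by (auto simp: cscale_simps)
      then show ?thesis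
        using a_repr_independence'[of "c *\<^sub>C b" "c *\<^sub>C a"] by (simp add: free_algebra_def)
    qed
    then have "(\<Union>b\<in>I +>\<^bsub>free_algebra\<^esub> a. I +>\<^bsub>free_algebra\<^esub> (c *\<^sub>C b)) = I +>\<^bsub>free_algebra\<^esub> (c *\<^sub>C a)"
      using mem[of a] by blast
    then show ?thesis
      by (simp add: quotient_alg_def ring.defs module.defs free_algebra_def)
  qed
  have "\<rho> \<in> complex_alg_hom ?Q End_zspace"
  proof -
    have "evaluation a \<in> carrier End_zspace" for a
      by (simp add: End_zspace_def linear_cscale_iff vector_space_cscale evaluation_linear)
    then have "\<rho> \<in> ring_hom ?Q End_zspace"
      by (intro ring_hom_memI)
        (auto simp: carrier \<rho> mult add one evaluation_mult evaluation_one evaluation_add End_zspace_def fun_eq_iff)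
    moreover have "\<forall>c. \<forall>a\<in>carrier ?Q. \<rho> (c \<odot>\<^bsub>?Q\<^esub> a) = c \<odot>\<^bsub>End_zspace\<^esub> \<rho> a"
      by (auto simp: carrier smult \<rho> evaluation_cscale End_zspace_def fun_eq_iff)
    ultimately show ?thesis by (simp add: complex_alg_hom_def)
  qed
  then show ?thesis
    by (rule bexI[rotated]) (simp add: \<rho> evaluation_gen)
qed

end

section \<open>Banded operators\<close>

text \<open>
  A family \<open>K d\<close> of functions stands for the operator with matrix entries \<open>K (j - i) (u + i)\<close> at
  \<open>(i, j)\<close>, where \<open>u\<close> is a fixed offset.
\<close>

definition band :: "nat \<Rightarrow> (int \<Rightarrow> complex \<Rightarrow> complex) \<Rightarrow> complex \<Rightarrow> (int \<Rightarrow> complex) \<Rightarrow> int \<Rightarrow> complex" where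
  "band n K u f i = (\<Sum>d\<in>{- int n..int n}. K d (u + of_int i) * f (i + d))"

text \<open>Matrix multiplication diagonal by diagonal: an entry of \<open>K\<close> on diagonal
  \<open>a\<close> leads from the row at \<open>t\<close> to the row at \<open>t + a\<close>, where
  the entry of \<open>L\<close> is taken.\<close>

definition band_comp ::
    "nat \<Rightarrow> (int \<Rightarrow> complex \<Rightarrow> complex) \<Rightarrow> (int \<Rightarrow> complex \<Rightarrow> complex) \<Rightarrow> int \<Rightarrow> complex \<Rightarrow> complex" where
  "band_comp m K L d t = (\<Sum>a\<in>{- int m..int m}. K a t * L (d - a) (t + of_int a))"

definition banded :: "nat \<Rightarrow> (int \<Rightarrow> complex \<Rightarrow> complex) \<Rightarrow> bool" where
  "banded n K \<longleftrightarrow> (\<forall>d t. \<bar>d\<bar> > int n \<longrightarrow> K d t = 0)"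

lemma band_mono:
  assumes "banded n K" "n \<le> n'"
  shows "band n K u f i = band n' K u f i"
  unfolding band_def using assms
  by (intro sum.mono_neutral_left) (auto simp: banded_def)

lemma band_band:
  assumes "banded n L"
  shows "band m K u (band n L u f) i = band (m + n) (band_comp m K L) u f i"
proof -
  let ?t = "u + of_int i"
  have inner: "band n L u f (i + a) = (\<Sum>d\<in>{- int (m + n)..int (m + n)}. L (d - a) (?t + of_int a) * f (i + d))"
    if a: "a \<in> {- int m..int m}" for a
  proof -
    have "band n L u f (i + a) = (\<Sum>d\<in>{- int n + a..int n + a}. L (d - a) (?t + of_int a) * f (i + d))"
      unfolding band_def
      by (rule sum.reindex_bij_witness[of _ "\<lambda>d. d - a" "\<lambda>d. d + a"]) (auto simp: algebra_simps)
    also have "\<dots> = (\<Sum>d\<in>{- int (m + n)..int (m + n)}. L (d - a) (?t + of_int a) * f (i + d))"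
      using a assms by (intro sum.mono_neutral_left) (auto simp: banded_def)
    finally show ?thesis .
  qed
  have "band m K u (band n L u f) i =
      (\<Sum>a\<in>{- int m..int m}. \<Sum>d\<in>{- int (m + n)..int (m + n)}. K a ?t * L (d - a) (?t + of_int a) * f (i + d))"
    unfolding band_def[of m] by (intro sum.cong refl) (simp add: inner sum_distrib_left mult.assoc)
  also have "\<dots> = band (m + n) (band_comp m K L) u f i"
    unfolding band_def band_comp_def by (subst sum.swap) (simp add: sum_distrib_right)
  finally show ?thesis .
qed

lemma banded_comp: "banded m K \<Longrightarrow> banded n L \<Longrightarrow> banded (m + n) (band_comp m K L)"
  unfolding banded_def band_comp_def by (auto intro!: sum.neutral)

lemma band_linear:
  "band n (\<lambda>d t. K d t + L d t) u f i = band n K u f i + band n L u f i"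
  "band n (\<lambda>d t. K d t - L d t) u f i = band n K u f i - band n L u f i"
  "band n (\<lambda>d t. c * K d t) u f i = c * band n K u f i"
  by (simp_all add: band_def sum.distrib sum_subtractf sum_distrib_left algebra_simps)

lemma band_comp_1: "band_comp 1 K L d t = K (- 1) t * L (d + 1) (t - 1) + K 0 t * L d t + K 1 t * L (d - 1) (t + 1)"
proof -
  have "{- int 1..int 1} = {- 1, 0, 1}" by auto
  then show ?thesis by (simp add: band_comp_def)
qed

lemma band_comp_2:
  "band_comp 2 K L d t = K (- 2) t * L (d + 2) (t - 2) + K (- 1) t * L (d + 1) (t - 1) + K 0 t * L d t
     + K 1 t * L (d - 1) (t + 1) + K 2 t * L (d - 2) (t + 2)"
proof -
  have "{- int 2..int 2} = {- 2, - 1, 0, 1, 2}" by auto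
  then show ?thesis by (simp add: band_comp_def)
qed

section \<open>The matrices satisfy the defining relations\<close>

text \<open>
  Here \<open>2 l\<close> is the value of \<open>\<Lambda>\<close>, and \<open>e\<^sub>k\<close> are the elementary symmetric functions of six numbers
  \<open>u\<^sub>i\<close> with sum zero, such that the elements of the face have the values \<open>u\<^sub>i - u\<^sub>c\<close>. The row with
  number \<open>j\<close> of the matrices corresponds to \<open>t = u\<^sub>c + j\<close>; \<open>D t\<close> and \<open>G t\<close> are the diagonal entries.
\<close>

locale face_data =
  fixes l e2 e3 e4 e5 e6 :: complex
begin

definition P :: "complex \<Rightarrow> complex" where
  "P t = t ^ 6 + e2 * t ^ 4 - e3 * t ^ 3 + e4 * t ^ 2 - e5 * t + e6"

definition D :: "complex \<Rightarrow> complex" where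
  "D t = 2 * t ^ 3 - 3 * t ^ 2 + t * l ^ 2 + t * e2 + 2 * t - (1 / 2) * l ^ 2 - (1 / 2) * e2 - (1 /
    2) * e3 - (1 / 2)"

definition G :: "complex \<Rightarrow> complex" where
  "G t = 2 * t ^ 4 - 4 * t ^ 3 - t ^ 2 * l ^ 2 + t ^ 2 * e2 + 4 * t ^ 2 + t * l ^ 2 - t * e2 - t * e3
    - 2 * t - (1 / 12) * l ^ 4 - (1 / 6) * l ^ 2 * e2 - (1 / 6) * l ^ 2 - (1 / 12) * e2 ^ 2 + (1
    / 6) * e2 + (1 / 2) * e3 + (1 / 3) * e4 + (1 / 4)"

definition X :: "int \<Rightarrow> complex \<Rightarrow> complex" where
  "X d t = (if d = - 1 then 1 else if d = 0 then D t else if d = 1 then P t else 0)"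

definition Y :: "int \<Rightarrow> complex \<Rightarrow> complex" where
  "Y d t = (if d = - 1 then t - 1 - l else if d = 0 then G t else if d = 1 then (t + l) * P t else 0)"

definition C :: "complex \<Rightarrow> complex" where
  "C t = G (t + 1) - G t - (t + l) * (D (t + 1) - D t)"

definition C' :: "complex \<Rightarrow> complex" where
  "C' t = G (t - 1) - G t + (t - 1 - l) * (D t - D (t - 1))"

text \<open>The commutator of \<open>X\<close> and \<open>Y\<close> with the factors
  \<open>P t\<close> and \<open>P (t + 1)\<close> split off. This is the form in which it enters the
  identities below, instead of a composition of bands.\<close>

definition Z :: "int \<Rightarrow> complex \<Rightarrow> complex" where
  "Z d t = (if d = - 2 then - 1 else if d = - 1 then C' t else if d = 0 then 2 * l * (P (t - 1) - P t)
     else if d = 1 then P t * C t else if d = 2 then P t * P (t + 1) else 0)"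

lemma banded: "banded 1 X" "banded 1 Y" "banded 2 Z"
  by (auto simp: banded_def X_def Y_def Z_def)

lemma Z_commutator:
  assumes "\<bar>d\<bar> \<le> 2"
  shows "band_comp 1 X Y d t - band_comp 1 Y X d t = Z d t"
proof -
  consider "d = - 2" | "d = - 1" | "d = 0" | "d = 1" | "d = 2" using assms by linarith
  then show ?thesis
    unfolding band_comp_1
    by cases (simp_all add: X_def Y_def Z_def C_def C'_def algebra_simps)
qed

text \<open>\<open>p2\<close> to \<open>p12\<close> are the values of \<open>subsystem_sum_2\<close>
  to \<open>subsystem_sum_12\<close> divided by the constants in \<open>subsystem_sums\<close>. For
  the negative sign of the face, \<open>p5\<close> and \<open>p9\<close> receive an additional
  minus.\<close>

definition p2 :: complex where
  "p2 = l ^ 2 - e2"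

definition p5 :: complex where
  "p5 = - 2 * l ^ 2 * e3 - 2 * e5"

definition p6 :: complex where
  "p6 = - (5 / 18) * l ^ 6 + (1 / 6) * l ^ 4 * e2 - (1 / 6) * l ^ 2 * e2 ^ 2 - (10 / 3) * l ^ 2 * e4
    + (5 / 18) * e2 ^ 3 - (2 / 3) * e2 * e4 + (1 / 2) * e3 ^ 2 + 4 * e6"

definition p8 :: complex where
  "p8 = - (5 / 108) * l ^ 8 - (11 / 54) * l ^ 6 * e2 - (1 / 6) * l ^ 4 * e2 ^ 2 + (1 / 18) * l ^ 4 *
    e4 - (11 / 54) * l ^ 2 * e2 ^ 3 + (8 / 9) * l ^ 2 * e2 * e4 - (17 / 24) * l ^ 2 * e3 ^ 2 +
    (25 / 3) * l ^ 2 * e6 - (5 / 108) * e2 ^ 4 + (7 / 18) * e2 ^ 2 * e4 - (7 / 24) * e2 * e3 ^ 2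
    - (1 / 3) * e2 * e6 + e3 * e5 - (2 / 3) * e4 ^ 2"

definition p9 :: complex where
  "p9 = (13 / 54) * l ^ 6 * e3 + (5 / 27) * l ^ 4 * e2 * e3 - (95 / 54) * l ^ 4 * e5 + (13 / 54) * l
    ^ 2 * e2 ^ 2 * e3 - (49 / 27) * l ^ 2 * e2 * e5 + (4 / 3) * l ^ 2 * e3 * e4 + (13 / 54) * e2
    ^ 2 * e5 + 2 * e3 * e6 - (2 / 3) * e4 * e5"

definition p12 :: complex where
  "p12 = (5 / 27) * l ^ 12 - (2 / 9) * l ^ 10 * e2 + (1 / 3) * l ^ 8 * e2 ^ 2 + (14 / 3) * l ^ 8 * e4
    - (8 / 9) * l ^ 6 * e2 ^ 3 + (2 / 9) * l ^ 6 * e2 * e4 - (7 / 3) * l ^ 6 * e3 ^ 2 - (26 / 3)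
    * l ^ 6 * e6 + (1 / 3) * l ^ 4 * e2 ^ 4 + (10 / 9) * l ^ 4 * e2 ^ 2 * e4 + (4 / 3) * l ^ 4 *
    e2 * e3 ^ 2 - (10 / 3) * l ^ 4 * e2 * e6 - l ^ 4 * e3 * e5 + (290 / 9) * l ^ 4 * e4 ^ 2 - (2
    / 9) * l ^ 2 * e2 ^ 5 - (38 / 9) * l ^ 2 * e2 ^ 3 * e4 - (1 / 3) * l ^ 2 * e2 ^ 2 * e3 ^ 2 -
    (38 / 9) * l ^ 2 * e2 ^ 2 * e6 + (50 / 9) * l ^ 2 * e2 * e3 * e5 + (112 / 9) * l ^ 2 * e2 *
    e4 ^ 2 - (92 / 9) * l ^ 2 * e3 ^ 2 * e4 - (604 / 9) * l ^ 2 * e4 * e6 - (50 / 9) * l ^ 2 *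
    e5 ^ 2 + (5 / 27) * e2 ^ 6 - (8 / 9) * e2 ^ 4 * e4 + (2 / 3) * e2 ^ 3 * e3 ^ 2 + (50 / 9) *
    e2 ^ 3 * e6 + (1 / 9) * e2 ^ 2 * e3 * e5 + (10 / 9) * e2 ^ 2 * e4 ^ 2 - (16 / 9) * e2 * e3 ^
    2 * e4 - (140 / 9) * e2 * e4 * e6 + (14 / 9) * e2 * e5 ^ 2 + (2 / 3) * e3 ^ 4 + (38 / 3) *
    e3 ^ 2 * e6 - (2 / 3) * e3 * e4 * e5 + (8 / 27) * e4 ^ 3 + (140 / 3) * e6 ^ 2"

definition a2 :: complex where "a2 = p2 - 3"
definition a5 :: complex where "a5 = - p5"
definition a6 :: complex where
  "a6 = p6 + (1 / 9) * p2 ^ 3 + (2 / 3) * p2 ^ 2 - (3 / 2) * p2 + 1"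
definition a8 :: complex where
  "a8 = - p8 + (1 / 54) * p2 ^ 4 + (1 / 12) * p2 * p6 + (1 / 18) * p2 ^ 3 + (1 / 2) * p6 + (1 / 6) * p2 ^ 2
     - (1 / 4) * p2 + 1 / 8"
definition a9 :: complex where
  "a9 = - p9 - p5 * ((1 / 27) * p2 ^ 2 + (1 / 3) * p2 - 1 / 4)"
definition a12 :: complex where
  "a12 = - p12 + (35 / 12) * p6 ^ 2 + (1 / 36) * p2 ^ 6 + (17 / 72) * p2 ^ 3 * p6 - (1 / 18) * p2 ^ 2 * p8
     - (7 / 18) * p2 * p5 ^ 2 + (1 / 162) * p2 ^ 5 - (1 / 3) * p2 * p8 + (1 / 36) * p2 ^ 2 * p6
     - (1 / 4) * p5 ^ 2 - (13 / 108) * p2 ^ 4 + (13 / 2) * p8 - (13 / 24) * p2 * p6 - (19 / 54) * p2 ^ 3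
     - 3 * p6 - (11 / 12) * p2 ^ 2 + (11 / 8) * p2 - 11 / 16"

lemmas a_defs = a2_def a5_def a6_def a8_def a9_def a12_def
  p2_def p5_def p6_def p8_def p9_def p12_def

definition one :: "int \<Rightarrow> complex \<Rightarrow> complex" where
  "one d t = (if d = 0 then 1 else 0)"

lemmas relation_defs = C_def C'_def P_def D_def G_def a_defs

text \<open>A product of bands 1 and 2 reaches the diagonals up to distance 3. On each of them, the
  relation is a polynomial identity in \<open>t\<close>, \<open>l\<close> and the
  \<open>e_k\<close>. In \<open>relation_3\<close> the terms \<open>X^4\<close> and
  \<open>Z^2\<close> raise the distance to 4.\<close>

lemma relation_1:
  assumes "\<bar>d\<bar> \<le> 3"
  shows "band_comp 1 X Z d t - band_comp 2 Z X d t =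
    - 6 * band_comp 1 Y Y d t + a2 * band_comp 1 X X d t + a5 * X d t + a8 * one d t"
proof -
  consider "d = - 3" | "d = - 2" | "d = - 1" | "d = 0" | "d = 1" | "d = 2" | "d = 3" using assms by linarith
  then show ?thesis
  proof cases
    case 1
    show ?thesis
      unfolding band_comp_1 band_comp_2 1
      by (simp add: X_def Y_def Z_def one_def; unfold relation_defs; Groebner_Basis.algebra)
  next
    case 2
    show ?thesis
      unfolding band_comp_1 band_comp_2 2
      by (simp add: X_def Y_def Z_def one_def; unfold relation_defs; Groebner_Basis.algebra)
  next
    case 3
    show ?thesis
      unfolding band_comp_1 band_comp_2 3
      by (simp add: X_def Y_def Z_def one_def; unfold relation_defs; Groebner_Basis.algebra)
  next
    case 4
    show ?thesis
      unfolding band_comp_1 band_comp_2 4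
      by (simp add: X_def Y_def Z_def one_def; unfold relation_defs; Groebner_Basis.algebra)
  next
    case 5
    show ?thesis
      unfolding band_comp_1 band_comp_2 5
      by (simp add: X_def Y_def Z_def one_def; unfold relation_defs; Groebner_Basis.algebra)
  next
    case 6
    show ?thesis
      unfolding band_comp_1 band_comp_2 6
      by (simp add: X_def Y_def Z_def one_def; unfold relation_defs; Groebner_Basis.algebra)
  next
    case 7
    show ?thesis
      unfolding band_comp_1 band_comp_2 7
      by (simp add: X_def Y_def Z_def one_def; unfold relation_defs; Groebner_Basis.algebra)
  qed
qed

lemma relation_2:
  assumes "\<bar>d\<bar> \<le> 3"
  shows "band_comp 1 Y Z d t - band_comp 2 Z Y d t =
    - 2 * band_comp 1 X (band_comp 1 X X) d t - a2 * (band_comp 1 X Y d t + band_comp 1 Y X d t)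
    - a5 * Y d t + a6 * X d t + a9 * one d t"
proof -
  consider "d = - 3" | "d = - 2" | "d = - 1" | "d = 0" | "d = 1" | "d = 2" | "d = 3" using assms by linarith
  then show ?thesis
  proof cases
    case 1
    show ?thesis
      unfolding band_comp_1 band_comp_2 1
      by (simp add: X_def Y_def Z_def one_def; unfold relation_defs; Groebner_Basis.algebra)
  next
    case 2
    show ?thesis
      unfolding band_comp_1 band_comp_2 2
      by (simp add: X_def Y_def Z_def one_def; unfold relation_defs; Groebner_Basis.algebra)
  next
    case 3
    show ?thesis
      unfolding band_comp_1 band_comp_2 3
      by (simp add: X_def Y_def Z_def one_def; unfold relation_defs; Groebner_Basis.algebra)
  next
    case 4
    show ?thesis
      unfolding band_comp_1 band_comp_2 4
      by (simp add: X_def Y_def Z_def one_def; unfold relation_defs; Groebner_Basis.algebra)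
  next
    case 5
    show ?thesis
      unfolding band_comp_1 band_comp_2 5
      by (simp add: X_def Y_def Z_def one_def; unfold relation_defs; Groebner_Basis.algebra)
  next
    case 6
    show ?thesis
      unfolding band_comp_1 band_comp_2 6
      by (simp add: X_def Y_def Z_def one_def; unfold relation_defs; Groebner_Basis.algebra)
  next
    case 7
    show ?thesis
      unfolding band_comp_1 band_comp_2 7
      by (simp add: X_def Y_def Z_def one_def; unfold relation_defs; Groebner_Basis.algebra)
  qed
qed

definition x1 :: complex where "x1 = 6 * a5 + 2 * a9"
definition x2 :: complex where "x2 = - 2 * a6 - 2 * a8"
definition x3 :: complex where "x3 = 6 * a2 + a6"
definition x4 :: complex where "x4 = - a5"
definition x5 :: complex where "x5 = 8 * a2 - 24"
definition x7 :: complex where "x7 = - 2 * a2 + 12"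

lemmas x_defs = x1_def x2_def x3_def x4_def x5_def x7_def

lemma relation_3:
  assumes "\<bar>d\<bar> \<le> 4"
  shows "x1 * X d t + x2 * Y d t + x3 * band_comp 1 X X d t + x4 * (band_comp 1 X Y d t + band_comp 1 Y X d t)
    + x5 * band_comp 1 Y Y d t + x7 * band_comp 1 X (band_comp 1 Y X) d t
    - band_comp 1 X (band_comp 1 X (band_comp 1 X X)) d t + 4 * band_comp 1 Y (band_comp 1 Y Y) d t
    + band_comp 2 Z Z d t = a12 * one d t"
proof -
  consider "d = - 4" | "d = - 3" | "d = - 2" | "d = - 1" | "d = 0" | "d = 1" | "d = 2" | "d = 3" | "d = 4" using assms by linarith
  then show ?thesis
  proof cases
    case 1
    show ?thesis
      unfolding band_comp_1 band_comp_2 1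
      by (simp add: X_def Y_def Z_def one_def x_defs; unfold relation_defs; Groebner_Basis.algebra)
  next
    case 2
    show ?thesis
      unfolding band_comp_1 band_comp_2 2
      by (simp add: X_def Y_def Z_def one_def x_defs; unfold relation_defs; Groebner_Basis.algebra)
  next
    case 3
    show ?thesis
      unfolding band_comp_1 band_comp_2 3
      by (simp add: X_def Y_def Z_def one_def x_defs; unfold relation_defs; Groebner_Basis.algebra)
  next
    case 4
    show ?thesis
      unfolding band_comp_1 band_comp_2 4
      by (simp add: X_def Y_def Z_def one_def x_defs; unfold relation_defs; Groebner_Basis.algebra)
  next
    case 5
    show ?thesis
      unfolding band_comp_1 band_comp_2 5
      by (simp add: X_def Y_def Z_def one_def x_defs; unfold relation_defs; Groebner_Basis.algebra)
  next
    case 6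
    show ?thesis
      unfolding band_comp_1 band_comp_2 6
      by (simp add: X_def Y_def Z_def one_def x_defs; unfold relation_defs; Groebner_Basis.algebra)
  next
    case 7
    show ?thesis
      unfolding band_comp_1 band_comp_2 7
      by (simp add: X_def Y_def Z_def one_def x_defs; unfold relation_defs; Groebner_Basis.algebra)
  next
    case 8
    show ?thesis
      unfolding band_comp_1 band_comp_2 8
      by (simp add: X_def Y_def Z_def one_def x_defs; unfold relation_defs; Groebner_Basis.algebra)
  next
    case 9
    show ?thesis
      unfolding band_comp_1 band_comp_2 9
      by (simp add: X_def Y_def Z_def one_def x_defs; unfold relation_defs; Groebner_Basis.algebra)
  qed
qed

end

section \<open>From identities on diagonals to identities of operators\<close>

lemma band_cong:
  assumes "\<And>d t. \<bar>d\<bar> \<le> int n \<Longrightarrow> K d t = L d t"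
  shows "band n K u f i = band n L u f i"
  unfolding band_def
proof (rule sum.cong[OF refl])
  fix d assume "d \<in> {- int n..int n}"
  then have "\<bar>d\<bar> \<le> int n" by auto
  then show "K d (u + of_int i) * f (i + d) = L d (u + of_int i) * f (i + d)" by (simp only: assms)
qed

lemma band_function_linear:
  "band n K u (\<lambda>i. c * f i) i = c * band n K u f i"
  "band n K u (\<lambda>i. f i + g i) i = band n K u f i + band n K u g i"
  "band n K u (\<lambda>i. f i - g i) i = band n K u f i - band n K u g i"
  by (simp_all add: band_def sum_distrib_left sum.distrib sum_subtractf algebra_simps)

lemma band_band_eq:
  assumes "banded n L" "m + n = k"
  shows "band m K u (band n L u f) = band k (band_comp m K L) u f"
  using band_band[OF assms(1)] assms(2) by auto

lemma banded_comp_eq: "banded m K \<Longrightarrow> banded n L \<Longrightarrow> m + n = k \<Longrightarrow> banded k (band_comp m K L)"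
  using banded_comp by blast

context face_data
begin

lemma banded_products:
  "banded 2 (band_comp 1 X X)" "banded 2 (band_comp 1 X Y)" "banded 2 (band_comp 1 Y X)"
  "banded 2 (band_comp 1 Y Y)" "banded 3 (band_comp 1 X (band_comp 1 X X))"
  "banded 3 (band_comp 1 X (band_comp 1 Y X))" "banded 3 (band_comp 1 Y (band_comp 1 Y Y))" "banded 0 one"
  by ((rule banded_comp_eq | rule banded | simp)+)[7] (simp add: banded_def one_def)

lemma band_one: "band 0 one u f i = f i"
  by (simp add: band_def one_def)

text \<open>Terms of different bandwidth are padded to a common one, so that
  \<open>band_linear\<close> can merge each side into a single band and \<open>band_cong\<close>
  compares the coefficients.\<close>

lemma band_3:
  "band 1 X u f i = band 3 X u f i" "band 1 Y u f i = band 3 Y u f i" "f i = band 3 one u f i"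
  "band 2 (band_comp 1 X X) u f i = band 3 (band_comp 1 X X) u f i"
  "band 2 (band_comp 1 X Y) u f i = band 3 (band_comp 1 X Y) u f i"
  "band 2 (band_comp 1 Y X) u f i = band 3 (band_comp 1 Y X) u f i"
  "band 2 (band_comp 1 Y Y) u f i = band 3 (band_comp 1 Y Y) u f i"
  unfolding band_one[where u = u and f = f and i = i, symmetric]
  by (rule band_mono, (rule banded banded_products), simp)+

lemma band_4:
  "band 1 X u f i = band 4 X u f i" "band 1 Y u f i = band 4 Y u f i" "f i = band 4 one u f i"
  "band 2 (band_comp 1 X X) u f i = band 4 (band_comp 1 X X) u f i"
  "band 2 (band_comp 1 X Y) u f i = band 4 (band_comp 1 X Y) u f i"
  "band 2 (band_comp 1 Y X) u f i = band 4 (band_comp 1 Y X) u f i"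
  "band 2 (band_comp 1 Y Y) u f i = band 4 (band_comp 1 Y Y) u f i"
  "band 3 (band_comp 1 X (band_comp 1 Y X)) u f i = band 4 (band_comp 1 X (band_comp 1 Y X)) u f i"
  "band 3 (band_comp 1 Y (band_comp 1 Y Y)) u f i = band 4 (band_comp 1 Y (band_comp 1 Y Y)) u f i"
  unfolding band_one[where u = u and f = f and i = i, symmetric]
  by (rule band_mono, (rule banded banded_products), simp)+

lemma operator_products:
  "band 1 X u (band 1 Y u f) = band 2 (band_comp 1 X Y) u f"
  "band 1 Y u (band 1 X u f) = band 2 (band_comp 1 Y X) u f"
  "band 1 X u (band 1 X u f) = band 2 (band_comp 1 X X) u f"
  "band 1 Y u (band 1 Y u f) = band 2 (band_comp 1 Y Y) u f"
  "band 1 X u (band 2 Z u f) = band 3 (band_comp 1 X Z) u f"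
  "band 2 Z u (band 1 X u f) = band 3 (band_comp 2 Z X) u f"
  "band 1 Y u (band 2 Z u f) = band 3 (band_comp 1 Y Z) u f"
  "band 2 Z u (band 1 Y u f) = band 3 (band_comp 2 Z Y) u f"
  "band 2 Z u (band 2 Z u f) = band 4 (band_comp 2 Z Z) u f"
  "band 1 X u (band 2 (band_comp 1 X X) u f) = band 3 (band_comp 1 X (band_comp 1 X X)) u f"
  "band 1 X u (band 2 (band_comp 1 Y X) u f) = band 3 (band_comp 1 X (band_comp 1 Y X)) u f"
  "band 1 Y u (band 2 (band_comp 1 Y Y) u f) = band 3 (band_comp 1 Y (band_comp 1 Y Y)) u f"
  "band 1 X u (band 3 (band_comp 1 X (band_comp 1 X X)) u f) =
    band 4 (band_comp 1 X (band_comp 1 X (band_comp 1 X X))) u f"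
  by (rule band_band_eq; (rule banded banded_products | simp))+

lemma operator_commutator:
  "band 1 X u (band 1 Y u f) i - band 1 Y u (band 1 X u f) i = band 2 Z u f i"
  unfolding operator_products band_linear(2)[symmetric] using Z_commutator by (intro band_cong) auto

lemma operator_relation_1:
  "band 1 X u (band 2 Z u f) i - band 2 Z u (band 1 X u f) i =
    - 6 * band 1 Y u (band 1 Y u f) i + a2 * band 1 X u (band 1 X u f) i + a5 * band 1 X u f i + a8 * f i"
  unfolding operator_products band_3(1,4,7)
  unfolding band_3(3)[where u = u and f = f and i = i] band_linear[symmetric]
  using relation_1 by (intro band_cong) auto

lemma operator_relation_2:
  "band 1 Y u (band 2 Z u f) i - band 2 Z u (band 1 Y u f) i =
    - 2 * band 1 X u (band 1 X u (band 1 X u f)) i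
    - a2 * (band 1 X u (band 1 Y u f) i + band 1 Y u (band 1 X u f) i)
    - a5 * band 1 Y u f i + a6 * band 1 X u f i + a9 * f i"
  unfolding operator_products band_3(1,2,5,6)
  unfolding band_3(3)[where u = u and f = f and i = i] band_linear[symmetric]
  using relation_2 by (intro band_cong) auto

lemma operator_relation_3:
  "x1 * band 1 X u f i + x2 * band 1 Y u f i + x3 * band 1 X u (band 1 X u f) i
    + x4 * (band 1 X u (band 1 Y u f) i + band 1 Y u (band 1 X u f) i)
    + x5 * band 1 Y u (band 1 Y u f) i + x7 * band 1 X u (band 1 Y u (band 1 X u f)) i
    - band 1 X u (band 1 X u (band 1 X u (band 1 X u f))) i
    + 4 * band 1 Y u (band 1 Y u (band 1 Y u f)) i + band 2 Z u (band 2 Z u f) i = a12 * f i"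
  unfolding operator_products band_4(1,2,4-9)
  unfolding band_4(3)[where u = u and f = f and i = i] band_linear[symmetric]
  using relation_3 by (intro band_cong) auto

end

text \<open>\<open>matrix_operator\<close> is defined by columns, \<open>band\<close> works by rows.
  A row involves only the columns at distance at most \<open>n\<close>, so all sums are finite and
  can be exchanged with taking a coordinate.\<close>

lemma lookup_matrix_operator:
  assumes M: "\<And>i j. M i j = K (j - i) (u + of_int i)" and K: "banded n K"
  shows "Poly_Mapping.lookup (matrix_operator M v) i = band n K u (Poly_Mapping.lookup v) i"
proof -
  have zero: "M i j = 0" if "\<bar>j - i\<bar> > int n" for i j
    using K that by (simp add: M banded_def)
  have fin: "finite {i. M i j \<noteq> 0}" for j
  proof (rule finite_subset)
    show "{i. M i j \<noteq> 0} \<subseteq> {j - int n..j + int n}" using zero by force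
  qed simp
  have "Poly_Mapping.lookup (matrix_operator M v) i =
      (\<Sum>j\<in>Poly_Mapping.keys v. \<Sum>i' | M i' j \<noteq> 0. (M i' j * Poly_Mapping.lookup v j when i' = i))"
    unfolding matrix_operator_def by (simp add: lookup_sum lookup_single)
  also have "\<dots> = (\<Sum>j\<in>Poly_Mapping.keys v. M i j * Poly_Mapping.lookup v j)"
    by (intro sum.cong refl) (simp add: when_def sum.delta fin)
  also have "\<dots> = (\<Sum>j\<in>Poly_Mapping.keys v \<union> {i - int n..i + int n}. M i j * Poly_Mapping.lookup v j)"
    by (intro sum.mono_neutral_left) (auto simp: in_keys_iff)
  also have "\<dots> = (\<Sum>j\<in>{i - int n..i + int n}. M i j * Poly_Mapping.lookup v j)"
    by (intro sum.mono_neutral_right) (auto simp: zero)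
  also have "\<dots> = band n K u (Poly_Mapping.lookup v) i"
    unfolding band_def M
    by (rule sum.reindex_bij_witness[of _ "\<lambda>d. i + d" "\<lambda>j. j - i"]) auto
  finally show ?thesis .
qed

lemma matrix_operator_in_End:
  assumes "\<And>i j. M i j = K (j - i) (u + of_int i)" "banded n K"
  shows "matrix_operator M \<in> carrier End_zspace"
  by (simp add: End_zspace_def linear_cscale_iff vector_space_cscale poly_mapping_eq_iff fun_eq_iff
      lookup_matrix_operator[of M K u n, OF assms] lookup_add lookup_cscale band_def sum.distrib sum_distrib_left algebra_simps)

section \<open>Conclusion\<close>

definition highest_root_words :: "nat list list" where
  "highest_root_words =
     [[2, 3, 6, 4, 5, 3, 4, 2, 3, 6], [3, 6, 4, 5, 3, 4, 1, 2, 3, 6], [6, 4, 5, 2, 3, 4, 1, 2,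
      3, 6], [3, 6, 5, 2, 3, 4, 1, 2, 3, 6], [4, 3, 6, 2, 3, 4, 1, 2, 3, 6], [3, 4, 5, 2, 3, 4,
      1, 2, 3, 6]]"

lemma highest_root_words:
  "\<forall>i\<in>set indices. set (highest_root_words ! (i - 1)) \<subseteq> set indices \<and>
     foldr reflect (highest_root_words ! (i - 1)) (1, 2, 3, 2, 1, 2) = unit_vec i"
  by code_simp

text \<open>The words lead from the highest root to every simple root, and hence the group leads
  from it to every root. The set over which the length is minimized is therefore nonempty and
  contains the chosen minimizer.\<close>

lemma minimal_weyl:
  assumes "\<Lambda> \<in> e6_roots"
  shows "minimal_weyl \<Lambda> \<in> weyl_group" "minimal_weyl \<Lambda> highest_root = \<Lambda>"
proof -
  obtain w i where w: "w \<in> weyl_group" "\<Lambda> = w (\<alpha> i)" using assms by (auto simp: e6_roots_def)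
  obtain j where j: "j \<in> set indices" "i = of_nat j"
    using exhaust_6[of i] by (force simp: indices_def)
  let ?u = "highest_root_words ! (j - 1)"
  have "highest_root = lattice_vec (1, 2, 3, 2, 1, 2)"
    by (simp add: highest_root_def lattice_vec_def)
  then have "weyl_word (map of_nat ?u) highest_root = \<alpha> i"
    using bspec[OF highest_root_words j(1)] foldr_reflect[of ?u "(1, 2, 3, 2, 1, 2)"] lattice_vec_unit_vec[OF j(1)]
    by (simp add: j(2))
  then have "(w \<circ> weyl_word (map of_nat ?u)) highest_root = \<Lambda>" using w(2) by simp
  moreover have "w \<circ> weyl_word (map of_nat ?u) \<in> weyl_group"
    by (rule weyl_group_comp[OF w(1)]) (simp add: weyl_group_def)
  ultimately have "minimal_weyl \<Lambda> \<in> {w \<in> weyl_group. w highest_root = \<Lambda>}"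
    unfolding minimal_weyl_def arg_min_on_def
    by (intro arg_min_natI[of "\<lambda>w. w \<in> {w \<in> weyl_group. w highest_root = \<Lambda>}"]) blast
  then show "minimal_weyl \<Lambda> \<in> weyl_group" "minimal_weyl \<Lambda> highest_root = \<Lambda>" by auto
qed

text \<open>The vectors \<open>\<xi>\<^sub>1, \<dots>, \<xi>\<^sub>5, 0\<close>; the face with number \<open>k\<close> consists of their differences with one of them.\<close>

definition vertex :: "real ^ 6 \<Rightarrow> nat \<Rightarrow> real ^ 6" where
  "vertex \<Lambda> i = minimal_weyl \<Lambda> ((highest_face @ [0]) ! i)"

text \<open>The zero vector has position 5 in \<open>highest_face @ [0]\<close> and serves
  \<open>k = 0\<close>; the other positions are lower by one than the numbering of the
  vertices.\<close>

definition center :: "nat \<Rightarrow> nat" where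
  "center k = (if k = 0 then 5 else k - 1)"

context
  fixes \<Lambda> :: "real ^ 6"
  assumes \<Lambda>: "\<Lambda> \<in> e6_roots"
begin

lemma linear_minimal_weyl: "linear (minimal_weyl \<Lambda>)"
  using minimal_weyl(1)[OF \<Lambda>] by (rule linear_weyl_group)

lemma inj_minimal_weyl: "inj (minimal_weyl \<Lambda>)"
  using weyl_group_inverse[OF minimal_weyl(1)[OF \<Lambda>]] by (metis inj_on_id inj_on_imageI2)

text \<open>Faces are sets of vectors, so rewriting their sums and products over indices requires
  the vectors to be distinct, even where their complex values agree.\<close>

lemma inj_on_vertex: "inj_on (vertex \<Lambda>) {..<6}"
proof -
  have "distinct (highest_face @ [0])"
    by (simp add: highest_face_def vec_eq_iff forall_6 axis_def)
  then have "inj_on (\<lambda>i. (highest_face @ [0]) ! i) {..<6}"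
    by (intro inj_on_nth) (auto simp: highest_face_def)
  then have "inj_on (minimal_weyl \<Lambda> \<circ> (\<lambda>i. (highest_face @ [0]) ! i)) {..<6}"
    using inj_minimal_weyl by (intro comp_inj_on) (auto intro: inj_on_subset)
  then show ?thesis by (simp add: vertex_def[abs_def] o_def)
qed

lemma length_highest_face: "length highest_face = 5"
  by (simp add: highest_face_def)

lemma face_vertex_eq: "i \<in> {1..5} \<Longrightarrow> face_vertex \<Lambda> i = vertex \<Lambda> (i - 1)"
  by (auto simp: face_vertex_def vertex_def nth_append length_highest_face)

lemma vertex_5: "vertex \<Lambda> 5 = 0"
  using linear_0[OF linear_minimal_weyl] by (simp add: vertex_def highest_face_def nth_append)

lemma Xi_face_eq:
  assumes "k \<in> {0..5}"
  shows "Xi_face \<Lambda> k = (\<lambda>i. vertex \<Lambda> i - vertex \<Lambda> (center k)) ` ({..<6} - {center k})"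
proof (cases "k = 0")
  case True
  have "face_vertex \<Lambda> ` {1..5} = vertex \<Lambda> ` (\<lambda>i. i - 1) ` {1..5}"
    unfolding image_image by (intro image_cong) (auto simp: face_vertex_eq)
  also have "(\<lambda>i. i - 1) ` {1..5} = {..<6} - {5 :: nat}"
  proof (intro equalityI subsetI)
    fix i :: nat assume "i \<in> {..<6} - {5}"
    then have "i = Suc i - 1" "Suc i \<in> {1..5}" by auto
    then show "i \<in> (\<lambda>i. i - 1) ` {1..5}" by (rule image_eqI)
  qed auto
  finally show ?thesis using True by (simp add: Xi_face_def center_def vertex_5)
next
  case False
  then have k: "k \<in> {1..5}" "center k = k - 1" using assms by (auto simp: center_def)
  have "{face_vertex \<Lambda> j - face_vertex \<Lambda> k |j. j \<in> {1..5} \<and> j \<noteq> k} =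
      (\<lambda>i. vertex \<Lambda> i - vertex \<Lambda> (k - 1)) ` ({..<5} - {k - 1})"
  proof (intro equalityI subsetI)
    fix z assume "z \<in> {face_vertex \<Lambda> j - face_vertex \<Lambda> k |j. j \<in> {1..5} \<and> j \<noteq> k}"
    then obtain j where "z = face_vertex \<Lambda> j - face_vertex \<Lambda> k" "j \<in> {1..5}" "j \<noteq> k" by auto
    then show "z \<in> (\<lambda>i. vertex \<Lambda> i - vertex \<Lambda> (k - 1)) ` ({..<5} - {k - 1})"
      using k by (intro image_eqI[of _ _ "j - 1"]) (auto simp: face_vertex_eq)
  next
    fix z assume "z \<in> (\<lambda>i. vertex \<Lambda> i - vertex \<Lambda> (k - 1)) ` ({..<5} - {k - 1})"
    then obtain i where "z = vertex \<Lambda> i - vertex \<Lambda> (k - 1)" "i < 5" "i \<noteq> k - 1" by auto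
    then have "z = face_vertex \<Lambda> (Suc i) - face_vertex \<Lambda> k" "Suc i \<in> {1..5}" "Suc i \<noteq> k"
      using k by (auto simp: face_vertex_eq)
    then show "z \<in> {face_vertex \<Lambda> j - face_vertex \<Lambda> k |j. j \<in> {1..5} \<and> j \<noteq> k}" by blast
  qed
  moreover have "- face_vertex \<Lambda> k = vertex \<Lambda> 5 - vertex \<Lambda> (k - 1)"
    using k by (simp add: face_vertex_eq vertex_5)
  moreover have "{..<6} - {k - 1} = insert 5 ({..<5} - {k - 1})" using k by auto
  ultimately show ?thesis using False by (simp add: Xi_face_def k(2))
qed

lemma signed_face_eq:
  assumes "k \<in> {0..5}"
  shows "signed_face \<epsilon> \<Lambda> k =
    (\<lambda>i. of_int \<epsilon> *\<^sub>R (vertex \<Lambda> i - vertex \<Lambda> (center k))) ` ({..<6} - {center k})"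
  unfolding signed_face_def Xi_face_eq[OF assms] image_image ..

lemma inj_on_signed_vertex:
  assumes "\<epsilon> \<noteq> 0"
  shows "inj_on (\<lambda>i. of_int \<epsilon> *\<^sub>R (vertex \<Lambda> i - vertex \<Lambda> (center k))) {..<6}"
  using inj_on_vertex assms by (auto simp: inj_on_def)

lemma insert_zero_signed_face:
  assumes "k \<in> {0..5}"
  shows "insert 0 (signed_face \<epsilon> \<Lambda> k) =
    (\<lambda>i. of_int \<epsilon> *\<^sub>R (vertex \<Lambda> i - vertex \<Lambda> (center k))) ` {..<6}"
proof -
  have "{..<6} = insert (center k) ({..<6} - {center k})" using assms by (auto simp: center_def)
  then show ?thesis
    unfolding signed_face_eq[OF assms] by (metis (no_types, lifting) diff_self image_insert scaleR_zero_right)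
qed

end

text \<open>
  In coordinates adapted to \<open>\<Lambda>\<close> the functional \<open>root_value m\<close> has values \<open>\<plusminus>(x\<^sub>i - x\<^sub>c)\<close> on the face,
  where \<open>c\<close> is the number of the vertex from which the differences are taken.
\<close>

theorem theorem4p1:
  fixes m :: "param \<Rightarrow> complex" and \<Lambda> :: "real ^ 6" and k :: nat and \<epsilon> :: int
  assumes "\<Lambda> \<in> e6_positive_roots" and "k \<in> {0..5}" and "\<epsilon> \<in> {- 1, 1}"
  shows "\<exists>\<rho> \<in> complex_alg_hom (Z2_su3 m) End_zspace.
           \<rho> (Z2_X m) =
             matrix_operator (\<lambda>i j. of_int \<epsilon> * matrix_A m \<Lambda> (signed_face \<epsilon> \<Lambda> k) i j) \<and>
           \<rho> (Z2_Y m) = matrix_operator (matrix_B m \<Lambda> (signed_face \<epsilon> \<Lambda> k))"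
proof -
  have \<Lambda>: "\<Lambda> \<in> e6_roots" using assms(1) by (simp add: e6_positive_roots_def)
  note w = minimal_weyl[OF \<Lambda>]
  define v where "v = root_value m \<circ> minimal_weyl \<Lambda>"
  have v: "v = root_value (weyl_act (minimal_weyl \<Lambda>) m)" "linear v"
    using root_value_weyl_act[OF w(1), of m] root_value(1)[of "weyl_act (minimal_weyl \<Lambda>) m"] by (simp_all add: v_def)
  define l where "l = v highest_root / 2"
  have L: "root_value m \<Lambda> = 2 * l" by (simp add: l_def v_def w(2))
  obtain x where x: "v = functional l x" "(\<Sum>i<6. x i) = 0"
    using functional_exists[OF v(2)] unfolding l_def by blast
  \<comment> \<open>The entry at position \<open>i\<close> of \<open>highest_face\<close> is the sum
    of the first \<open>5 - i\<close> simple roots, whose values telescope.\<close>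
  have vertex: "root_value m (vertex \<Lambda> i) = x i - x 5" if "i < 6" for i
  proof -
    have "root_value m (vertex \<Lambda> i) = v ((highest_face @ [0]) ! i)" by (simp add: vertex_def v_def)
    also have "\<dots> = x i - x 5"
      using that less_Suc_eq[of i]
      by (auto simp: numeral_eq_Suc less_Suc_eq x(1) highest_face_def linear_add[OF linear_functional] 
          linear_0[OF linear_functional] functional_simple_root)
    finally show ?thesis .
  qed
  define c where "c = center k"
  have c: "c < 6" using assms(2) by (auto simp: c_def center_def)
  define e where "e = (of_int \<epsilon> :: complex)"
  have e: "e = 1 \<or> e = - 1" using assms(3) by (auto simp: e_def)
  have e2: "e * e = 1" using e by auto
  define y where "y i = e * x i" for i
  have y: "(\<Sum>i<6. y i) = 0" by (simp add: y_def sum_distrib_left[symmetric] x(2))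
  let ?b = "\<lambda>i. of_int \<epsilon> *\<^sub>R (vertex \<Lambda> i - vertex \<Lambda> c)"
  have vals: "root_value m (?b i) = y i - y c" if "i < 6" for i
    using that c
    by (simp add: linear_scale[OF root_value(1)] linear_diff[OF root_value(1)] vertex y_def e_def
        scaleR_conv_of_real[where 'a = complex] algebra_simps)
  define F where "F = signed_face \<epsilon> \<Lambda> k"
  have F: "F = ?b ` ({..<6} - {c})" "insert 0 F = ?b ` {..<6}"
    using signed_face_eq[OF \<Lambda> assms(2)] insert_zero_signed_face[OF \<Lambda> assms(2)] by (simp_all add: F_def c_def)
  have inj: "inj_on ?b {..<6}"
    using inj_on_signed_vertex[OF \<Lambda>, of \<epsilon> k] assms(3) by (auto simp: c_def)
  then have inj': "inj_on ?b ({..<6} - {c})" by (rule inj_on_subset) simp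
  \<comment> \<open>The index \<open>c\<close> contributes zero, so the sum may run over all six.
    With \<open>t = y c + j\<close> this gives \<open>j - lambda_plus = t - l\<close> and
    \<open>j - lambda_minus = t + l\<close>.\<close>
  have sum_F: "(\<Sum>\<xi>\<in>F. root_value m \<xi>) = - 6 * y c"
  proof -
    have "(\<Sum>\<xi>\<in>F. root_value m \<xi>) = (\<Sum>i\<in>{..<6} - {c}. y i - y c)"
      unfolding F(1) by (simp add: sum.reindex[OF inj'] vals)
    also have "\<dots> = (\<Sum>i<6. y i - y c)"
      using c by (simp add: sum.remove[of "{..<6}" c "\<lambda>i. y i - y c"])
    finally show ?thesis using y by (simp add: sum_subtractf)
  qed
  interpret face: face_data l "elementary y 2" "elementary y 3" "elementary y 4" "elementary y 5" "elementary y 6" .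
  \<comment> \<open>The factor \<open>of_int i\<close> supplies the missing factor with index
    \<open>c\<close>, which completes the product to the sextic \<open>P\<close>.\<close>
  have prod_F: "of_int i * (\<Prod>\<xi>\<in>F. of_int i - root_value m \<xi>) = face.P (y c + of_int i)" for i
  proof -
    have "(\<Prod>\<xi>\<in>F. of_int i - root_value m \<xi>) = (\<Prod>j\<in>{..<6} - {c}. y c + of_int i - y j)"
      unfolding F(1) prod.reindex[OF inj'] o_def
    proof (rule prod.cong[OF refl])
      fix j assume "j \<in> {..<6} - {c}"
      then show "of_int i - root_value m (?b j) = y c + of_int i - y j" by (simp only: Diff_iff lessThan_iff vals) simp
    qed
    then have "of_int i * (\<Prod>\<xi>\<in>F. of_int i - root_value m \<xi>) = (\<Prod>j<6. y c + of_int i - y j)"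
      using c by (simp add: prod.remove[of "{..<6}" c "\<lambda>j. y c + of_int i - y j"])
    then show ?thesis
      unfolding prod_elementary[OF y] face.P_def .
  qed
  have power: "power_sum m F j n = (\<Sum>i<6. (y i + (1 / 2 - (y c + of_int j))) ^ n)" for j n
    unfolding power_sum_def F(2) sum.reindex[OF inj] o_def
  proof (rule sum.cong[OF refl])
    fix i :: nat assume "i \<in> {..<6}"
    then have "root_value m (?b i) - of_int j + 1 / 2 = y i + (1 / 2 - (y c + of_int j))" by (simp only: lessThan_iff vals) simp
    then show "(root_value m (?b i) - of_int j + 1 / 2) ^ n = (y i + (1 / 2 - (y c + of_int j))) ^ n" by (simp only:)
  qed
  have psum: "psum y 1 = 0" "psum y 2 = - 2 * elementary y 2" "psum y 3 = 3 * elementary y 3"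
      "psum y 4 = 2 * elementary y 2 ^ 2 - 4 * elementary y 4"
    using psum_small[OF y] by simp_all
  have E: "(\<Sum>i<6. (y i + z) ^ 1) = 6 * z" "(\<Sum>i<6. (y i + z) ^ 2) = - 2 * elementary y 2 + 6 * z ^ 2"
    "(\<Sum>i<6. (y i + z) ^ 3) = 3 * elementary y 3 - 6 * z * elementary y 2 + 6 * z ^ 3"
    "(\<Sum>i<6. (y i + z) ^ 4) = 2 * elementary y 2 ^ 2 - 4 * elementary y 4 + 12 * z * elementary y 3
       - 12 * z ^ 2 * elementary y 2 + 6 * z ^ 4" for z
  proof -
    note p = psum[unfolded psum_def[OF y] sum_lessThan_6 power_one_right]
    show "(\<Sum>i<6. (y i + z) ^ 1) = 6 * z"
      unfolding sum_lessThan_6 power_one_right using p(1) by Groebner_Basis.algebra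
    show "(\<Sum>i<6. (y i + z) ^ 2) = - 2 * elementary y 2 + 6 * z ^ 2"
      unfolding sum_lessThan_6 using p(1,2) by Groebner_Basis.algebra
    show "(\<Sum>i<6. (y i + z) ^ 3) = 3 * elementary y 3 - 6 * z * elementary y 2 + 6 * z ^ 3"
      unfolding sum_lessThan_6 using p(1,2,3) by Groebner_Basis.algebra
    show "(\<Sum>i<6. (y i + z) ^ 4) = 2 * elementary y 2 ^ 2 - 4 * elementary y 4 + 12 * z * elementary y 3
       - 12 * z ^ 2 * elementary y 2 + 6 * z ^ 4"
      unfolding sum_lessThan_6 using p(1,2,3,4) by Groebner_Basis.algebra
  qed
  have diag: "diag_A m \<Lambda> F j = face.D (y c + of_int j)" "diag_B m \<Lambda> F j = face.G (y c + of_int j)" for j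
    unfolding diag_A_def diag_B_def Let_def power E L face.D_def face.G_def
    by (simp_all add: field_simps, Groebner_Basis.algebra+)
  have matrix_A: "of_int \<epsilon> * matrix_A m \<Lambda> F i j = e * face.X (j - i) (y c + of_int i)" for i j
    by (auto simp: matrix_A_def face.X_def e_def diag prod_F)
  \<comment> \<open>\<open>face.Y\<close> is indexed by the row \<open>i\<close>. Below the diagonal
    the column is \<open>j = i - 1\<close>, hence the shift in \<open>t - 1 - l\<close>.\<close>
  have matrix_B: "matrix_B m \<Lambda> F i j = face.Y (j - i) (y c + of_int i)" for i j
    using prod_F[of i]
    by (auto simp: matrix_B_def face.Y_def diag lambda_plus_def lambda_minus_def L sum_F algebra_simps)
  define Xop where "Xop = matrix_operator (\<lambda>i j. of_int \<epsilon> * matrix_A m \<Lambda> F i j)"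
  define Yop where "Yop = matrix_operator (matrix_B m \<Lambda> F)"
  have banded: "banded 1 (\<lambda>d t. e * face.X d t)" "banded 1 face.Y"
    using face.banded(1,2) by (auto simp: banded_def)
  have End: "Xop \<in> carrier End_zspace" "Yop \<in> carrier End_zspace"
    unfolding Xop_def Yop_def
    using matrix_operator_in_End[of "\<lambda>i j. of_int \<epsilon> * matrix_A m \<Lambda> F i j" "\<lambda>d t. e * face.X d t" "y c", OF matrix_A banded(1)]
      matrix_operator_in_End[of "matrix_B m \<Lambda> F" face.Y "y c", OF matrix_B banded(2)] by auto
  define A where "A = band 1 face.X (y c)"
  define B where "B = band 1 face.Y (y c)"
  define C where "C = band 2 face.Z (y c)"
  have X: "Poly_Mapping.lookup (Xop v) = (\<lambda>i. e * A (Poly_Mapping.lookup v) i)" for v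
    using lookup_matrix_operator[of "\<lambda>i j. of_int \<epsilon> * matrix_A m \<Lambda> F i j" "\<lambda>d t. e * face.X d t" "y c", OF matrix_A banded(1)]
    unfolding Xop_def A_def by (intro ext) (simp only: band_linear)
  have Y: "Poly_Mapping.lookup (Yop v) = B (Poly_Mapping.lookup v)" for v
    using lookup_matrix_operator[of "matrix_B m \<Lambda> F" face.Y "y c", OF matrix_B banded(2)]
    unfolding Yop_def B_def by (intro ext)
  have scale: "A (\<lambda>i. z * f i) = (\<lambda>i. z * A f i)" "B (\<lambda>i. z * f i) = (\<lambda>i. z * B f i)"
    "C (\<lambda>i. z * f i) = (\<lambda>i. z * C f i)" for z f
    unfolding A_def B_def C_def by (intro ext; simp only: band_function_linear)+
  define Zop where "Zop = evaluation Xop Yop gen_Z"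
  note ev = evaluation_add[OF End] evaluation_diff[OF End] evaluation_minus[OF End] evaluation_mult[OF End]
    evaluation_gen[OF End] evaluation_one[OF End] evaluation_cscale[OF End]
    evaluation_numeral[OF End]
  note commutator = face.operator_commutator[of "y c", folded A_def B_def C_def]
    and relation_1 = face.operator_relation_1[of "y c", folded A_def B_def C_def]
    and relation_2 = face.operator_relation_2[of "y c", folded A_def B_def C_def]
    and relation_3 = face.operator_relation_3[of "y c", folded A_def B_def C_def]
  have Z: "Poly_Mapping.lookup (Zop v) = (\<lambda>i. e * C (Poly_Mapping.lookup v) i)" for v
    by (simp add: Zop_def gen_Z_def ev fun_eq_iff lookup_minus X Y scale commutator[symmetric] right_diff_distrib)
  \<comment> \<open>The sign of the face survives only in odd degree; this is the source of the
    factors \<open>e\<close> in \<open>p_5\<close>, \<open>p_9\<close>, \<open>a_5\<close>,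
    \<open>a_9\<close>, \<open>x_1\<close> and \<open>x_4\<close>.\<close>
  have elementary: "elementary x 2 = elementary y 2" "elementary x 3 = e * elementary y 3"
    "elementary x 4 = elementary y 4" "elementary x 5 = e * elementary y 5" "elementary x 6 = elementary y 6"
    using e by (auto simp: elementary_def Let_def y_def algebra_simps)
  let ?m = "weyl_act (minimal_weyl \<Lambda>) m"
  have invariant: "p_2 ?m = p_2 m" "p_5 ?m = p_5 m" "p_6 ?m = p_6 m" "p_8 ?m = p_8 m" "p_9 ?m = p_9 m" "p_12 ?m = p_12 m"
    by (simp_all add: p_2_def p_5_def p_6_def p_8_def p_9_def p_12_def weyl_average_weyl_act[OF w(1)])
  note sums = subsystem_sums[of ?m, unfolded v(1)[symmetric] x(1) invariant elementary
      subsystem_sum_2[OF x(2)] subsystem_sum_5[OF x(2)] subsystem_sum_6[OF x(2)]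
      subsystem_sum_8[OF x(2)] subsystem_sum_9[OF x(2)] subsystem_sum_12[OF x(2)]]
  have p: "p_2 m = face.p2" "p_5 m = e * face.p5" "p_6 m = face.p6" "p_8 m = face.p8" "p_9 m = e * face.p9" "p_12 m = face.p12"
  proof -
    have "120 * p_2 m = 120 * face.p2"
      unfolding sums(1)[symmetric] elementary face.p2_def by Groebner_Basis.algebra
    then show "p_2 m = face.p2" by simp
    have "1620 * p_5 m = 1620 * (e * face.p5)"
      unfolding sums(2)[symmetric] elementary face.p5_def by Groebner_Basis.algebra
    then show "p_5 m = e * face.p5" by simp
    have "- 108 * p_6 m = - 108 * face.p6"
      unfolding sums(3)[symmetric] elementary face.p6_def using e2 by Groebner_Basis.algebra
    then show "p_6 m = face.p6" by simp
    have "- 7776 * p_8 m = - 7776 * face.p8"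
      unfolding sums(4)[symmetric] elementary face.p8_def using e2 by Groebner_Basis.algebra
    then show "p_8 m = face.p8" by simp
    have "- 8748 * p_9 m = - 8748 * (e * face.p9)"
      unfolding sums(5)[symmetric] elementary face.p9_def by Groebner_Basis.algebra
    then show "p_9 m = e * face.p9" by simp
    have "162 * p_12 m = 162 * face.p12"
      unfolding sums(6)[symmetric] elementary face.p12_def using e2 by Groebner_Basis.algebra
    then show "p_12 m = face.p12" by simp
  qed
  have a: "a_2 m = face.a2" "a_5 m = e * face.a5" "a_6 m = face.a6" "a_8 m = face.a8" "a_9 m = e * face.a9" "a_12 m = face.a12"
    using e2 by (simp_all add: power_mult_distrib power2_eq_square[of e] a_2_def a_5_def a_6_def a_8_def a_9_def a_12_def face.a2_def face.a5_def face.a6_def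
        face.a8_def face.a9_def face.a12_def p algebra_simps)
  have x_eq: "x_1 m = e * face.x1" "x_2 m = face.x2" "x_3 m = face.x3" "x_4 m = e * face.x4" "x_5 m = face.x5" "x_7 m = face.x7"
    by (simp_all add: x_1_def x_2_def x_3_def x_4_def x_5_def x_7_def face.x_defs a algebra_simps)
  \<comment> \<open>\<open>Xop\<close> and \<open>Zop\<close> carry one factor \<open>e\<close>,
    \<open>Yop\<close> none. Since \<open>e * e = 1\<close>, the first and third relations become
    those of \<open>face_data\<close>, and the second becomes \<open>e\<close> times it.\<close>
  have "evaluation Xop Yop r = (\<lambda>v. 0)" if r: "r \<in> Z2_relations m" for r
  proof (intro ext poly_mapping_eqI)
    fix v :: zspace and i
    let ?f = "Poly_Mapping.lookup v"
    note simps = ev Zop_def[symmetric] lookup_add lookup_minus lookup_uminus lookup_cscale X Y Z scale scale[of "- 1", simplified] a x_eq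
      power2_eq_square power3_eq_cube power4_eq_xxxx
    consider "r = gen_X * gen_Z - gen_Z * gen_X
        - (- 6 * gen_Y ^ 2 + a_2 m *\<^sub>C gen_X ^ 2 + a_5 m *\<^sub>C gen_X + a_8 m *\<^sub>C 1)"
      | "r = gen_Y * gen_Z - gen_Z * gen_Y
        - (- 2 * gen_X ^ 3 - a_2 m *\<^sub>C (gen_X * gen_Y + gen_Y * gen_X) - a_5 m *\<^sub>C gen_Y
          + a_6 m *\<^sub>C gen_X + a_9 m *\<^sub>C 1)"
      | "r = x_1 m *\<^sub>C gen_X + x_2 m *\<^sub>C gen_Y + x_3 m *\<^sub>C gen_X ^ 2
        + x_4 m *\<^sub>C (gen_X * gen_Y + gen_Y * gen_X) + x_5 m *\<^sub>C gen_Y ^ 2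
        + x_7 m *\<^sub>C (gen_X * gen_Y * gen_X) - gen_X ^ 4 + 4 * gen_Y ^ 3 + gen_Z ^ 2 - a_12 m *\<^sub>C 1"
      using r unfolding Z2_relations_def Let_def by blast
    then have "Poly_Mapping.lookup (evaluation Xop Yop r v) i = 0"
    proof cases
      case 1
      show ?thesis
        unfolding 1 using e relation_1[of ?f i]
        by (elim disjE; simp add: simps; simp add: algebra_simps)
    next
      case 2
      show ?thesis
        unfolding 2 using e relation_2[of ?f i]
        by (elim disjE; simp add: simps; simp add: algebra_simps)
    next
      case 3
      show ?thesis
        unfolding 3 using e relation_3[of ?f i]
        by (elim disjE; simp add: simps; simp add: algebra_simps)
    qed
    then show "Poly_Mapping.lookup (evaluation Xop Yop r v) i = Poly_Mapping.lookup 0 i" by simp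
  qed
  from quotient_representation[OF End this] show ?thesis
    by (simp add: Z2_su3_def Z2_X_def Z2_Y_def Z2_ideal_def Xop_def Yop_def F_def)
qed

end
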